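(* Let $N\ge 1$. Let $G:(0,\infty)\to(0,\infty)$ and $H:(0,\infty)\to(0,\infty)$ be functions such that (i) $G$ and $H$ are non-decreasing and $\lim_{x\to\infty}G(x)=\lim_{x\to\infty}H(x)=\infty$; (ii) the functions $G(x)/\sqrt{x}$ and $H(x)/\sqrt{x}$ are non-increasing. Then, for any $\boldsymbol{\xi}\in(\overline{\mathbb{Q}}^{\times})^N$ and any $F\in\mathcal{A}$, we have $$\mathcal{E}(F,\boldsymbol{\xi})\le \frac{2\,C_1(F,G)}{G\big((8\pi h(\boldsymbol{\xi}))^{-1}\big)}+\frac{C_2(F,H)}{H\big((24\,h_{\mathcal{D}}(\boldsymbol{\xi}))^{-1}\big)},$$ where $$C_1(F,G):=\sum_{\boldsymbol{n}\in\mathbb{Z}^N}\int_{\mathbb{R}^N}\big|\widehat{F}(\boldsymbol{n},\boldsymbol{t})\big|\,G(\|\boldsymbol{t}\|_\infty)\,d\boldsymbol{t}\quad\text{and}\quad C_2(F,H):=\sum_{\boldsymbol{n}\in\mathbb{Z}^N\setminus\{\boldsymbol{0}\}}\big|\widehat{F_{\boldsymbol{0}}}(\boldsymbol{n})\big|\,H(\|\boldsymbol{n}\|_1).$$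
   Context: Fix $\overline{\mathbb{Q}}\subset\mathbb{C}$, the algebraic closure of $\mathbb{Q}$; $\overline{\mathbb{Q}}^\times$, $\mathbb{C}^\times$ are the multiplicative groups. Heights. For $\xi\in\overline{\mathbb{Q}}$ let $P_\xi(x)=c_d\prod_{j=1}^d(x-\alpha_j)\in\mathbb{Z}[x]$ be its minimal polynomial (primitive, with integer coefficients), $d=\deg(\xi)=[\mathbb{Q}(\xi):\mathbb{Q}]$. Its Weil height is $h(\xi)=\frac1d\big(\log|c_d|+\sum_{j=1}^d\log^+|\alpha_j|\big)$, where $\log^+x=\max\{0,\log x\}$ (and $\log^+0=0$). For $\boldsymbol{\xi}=(\xi_1,\dots,\xi_N)\in(\overline{\mathbb{Q}}^\times)^N$, $h(\boldsymbol{\xi}):=h(\xi_1)+\dots+h(\xi_N)$. For $\boldsymbol{n}\in\mathbb{Z}^N$, $\chi^{\boldsymbol{n}}(\boldsymbol{\xi}):=\xi_1^{n_1}\cdots\xi_N^{n_N}$. The generalized degree is $\mathcal{D}(\boldsymbol{\xi}):=\min_{\boldsymbol{n}\in\mathbb{Z}^N\setminus\{\boldsymbol{0}\}}\{\|\boldsymbol{n}\|_1\deg(\chi^{\boldsymbol{n}}(\boldsymbol{\xi}))\}$, and $h_{\mathcal{D}}(\boldsymbol{\xi}):=h(\boldsymbol{\xi})+\frac{\log(2\mathcal{D}(\boldsymbol{\xi}))}{3\mathcal{D}(\boldsymbol{\xi})}$. Here $\|\boldsymbol{n}\|_1=\sum_j|n_j|$, $\|\boldsymbol{t}\|_\infty=\max_j|t_j|$.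 Equidistribution error. Let $\mathbb{T}=\mathbb{R}/\mathbb{Z}$. The space $\mathbb{T}^N\times\mathbb{R}^N$ is identified with $(\mathbb{C}^\times)^N$ via $(\boldsymbol{\theta},\boldsymbol{s})\mapsto(e^{2\pi i\theta_1+s_1},\dots,e^{2\pi i\theta_N+s_N})$, and test functions are viewed as functions $F(\boldsymbol{\theta},\boldsymbol{s})$ on $\mathbb{T}^N\times\mathbb{R}^N$. Let $S=\{(\sigma\xi_1,\dots,\sigma\xi_N):\sigma\in\mathrm{Gal}(\overline{\mathbb{Q}}/\mathbb{Q})\}$ be the (finite) Galois orbit of $\boldsymbol{\xi}$. For $\boldsymbol{\alpha}\in S$ let $(\boldsymbol{\theta}(\boldsymbol{\alpha}),\boldsymbol{s}(\boldsymbol{\alpha}))$ be the corresponding point of $\mathbb{T}^N\times\mathbb{R}^N$, i.e. $\boldsymbol{\theta}(\boldsymbol{\alpha})=(\arg(\alpha_j)/2\pi)_j$, $\boldsymbol{s}(\boldsymbol{\alpha})=(\log|\alpha_j|)_j$. Then $$\mathcal{E}(F,\boldsymbol{\xi}):=\Big|\frac1{|S|}\sum_{\boldsymbol{\alpha}\in S}F(\boldsymbol{\theta}(\boldsymbol{\alpha}),\boldsymbol{s}(\boldsymbol{\alpha}))-\int_{\mathbb{T}^N}F(\boldsymbol{\theta},\boldsymbol{0})\,d\boldsymbol{\theta}\Big|,$$ that is, the absolute difference of the integrals of $F$ against the uniform probability measure on $S$ and the Haar probability measure on the unit polycircle $(\mathbb{S}^1)^N$. Fourier transforms. For $F\in L^1(\mathbb{T}^N\times\mathbb{R}^N)$,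 $\widehat{F}(\boldsymbol{n},\boldsymbol{t})=\int_{\mathbb{T}^N}\int_{\mathbb{R}^N}F(\boldsymbol{\theta},\boldsymbol{s})e^{-2\pi i\boldsymbol{n}\cdot\boldsymbol{\theta}}e^{-2\pi i\boldsymbol{t}\cdot\boldsymbol{s}}\,d\boldsymbol{s}\,d\boldsymbol{\theta}$ for $(\boldsymbol{n},\boldsymbol{t})\in\mathbb{Z}^N\times\mathbb{R}^N$, extended to $L^2$ by Plancherel. For continuous $F$, $F_{\boldsymbol{0}}(\boldsymbol{\theta}):=F(\boldsymbol{\theta},\boldsymbol{0})$ and $\widehat{F_{\boldsymbol{0}}}(\boldsymbol{n})=\int_{\mathbb{T}^N}F_{\boldsymbol{0}}(\boldsymbol{\theta})e^{-2\pi i\boldsymbol{n}\cdot\boldsymbol{\theta}}\,d\boldsymbol{\theta}$. Class of test functions. $\mathcal{A}$ is the set of continuous $F:\mathbb{T}^N\times\mathbb{R}^N\to\mathbb{C}$ with $F\in L^2(\mathbb{T}^N\times\mathbb{R}^N)$ and $\widehat{F}\in L^1(\mathbb{Z}^N\times\mathbb{R}^N)$ (counting measure times Lebesgue measure). Conventions. If $C_1(F,G)$ or $C_2(F,H)$ is infinite, the right-hand side is understood as $+\infty$ (the estimate is trivially true). If both are finite and $h(\boldsymbol{\xi})=0$, the first term on the right-hand side is understood as $0$ (since $G(x)\to\infty$ as $x\to\infty$). *)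

theory Defs
  imports "HOL-Analysis.Analysis"
begin

text \<open>
  The field of algebraic numbers inside \<^typ>\<open>complex\<close> is \<open>{x. algebraic x}\<close>. Points of the
  \<open>N\<close>-dimensional torus are vectors \<open>complex ^ 'n\<close> with \<open>N = CARD('n)\<close>.
\<close>

text \<open>The sign normalisation makes the primitive integer minimal polynomial unique.\<close>

definition is_min_int_poly :: "complex \<Rightarrow> int poly \<Rightarrow> bool" where
  "is_min_int_poly x p \<longleftrightarrow>
     content p = 1 \<and> lead_coeff p > 0 \<and> poly (map_poly of_int p) x = 0 \<and>
     (\<forall>q. q \<noteq> 0 \<longrightarrow> poly (map_poly of_int q) x = 0 \<longrightarrow> degree p \<le> degree q)"

definition min_int_poly :: "complex \<Rightarrow> int poly" where
  "min_int_poly x = (THE p. is_min_int_poly x p)"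

definition alg_degree :: "complex \<Rightarrow> nat" where
  "alg_degree x = degree (min_int_poly x)"

definition log_plus :: "real \<Rightarrow> real" where
  "log_plus x = (if x = 0 then 0 else max 0 (ln x))"

definition weil_height :: "complex \<Rightarrow> real" where
  "weil_height x =
     (ln \<bar>of_int (lead_coeff (min_int_poly x))\<bar>
        + (\<Sum>a\<in>#proots (map_poly of_int (min_int_poly x)). log_plus (cmod a)))
     / real (alg_degree x)"

definition height :: "complex ^ 'n \<Rightarrow> real" where
  "height \<xi> = (\<Sum>j\<in>UNIV. weil_height (\<xi> $ j))"

definition character :: "int ^ 'n \<Rightarrow> complex ^ 'n \<Rightarrow> complex" where
  "character n \<xi> = (\<Prod>j\<in>UNIV. (\<xi> $ j) powi (n $ j))"

definition l1norm :: "int ^ 'n \<Rightarrow> nat" where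
  "l1norm n = (\<Sum>j\<in>UNIV. nat \<bar>n $ j\<bar>)"

definition gen_degree :: "complex ^ 'n \<Rightarrow> nat" where
  "gen_degree \<xi> = (INF n\<in>UNIV - {0}. l1norm n * alg_degree (character n \<xi>))"

definition height_D :: "complex ^ 'n \<Rightarrow> real" where
  "height_D \<xi> = height \<xi> + ln (2 * real (gen_degree \<xi>)) / (3 * real (gen_degree \<xi>))"

text \<open>
  A function on \<open>(\<real>/\<int>)\<^sup>N \<times> \<real>\<^sup>N\<close> is a function of \<open>(\<theta>, s)\<close> on \<open>\<real>\<^sup>N \<times> \<real>\<^sup>N\<close> that is \<open>\<int>\<^sup>N\<close>-periodic
  in \<open>\<theta>\<close>. The Haar probability measure on \<open>(\<real>/\<int>)\<^sup>N\<close> is Lebesgue measure on the unit cube.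
\<close>

definition torus_periodic :: "((real ^ 'n) \<times> (real ^ 'n) \<Rightarrow> complex) \<Rightarrow> bool" where
  "torus_periodic F \<longleftrightarrow> (\<forall>\<theta> s (n :: int ^ 'n). F (\<theta> + (\<chi> j. of_int (n $ j)), s) = F (\<theta>, s))"

definition torus_measure :: "(real ^ 'n) measure" where
  "torus_measure = restrict_space lborel (cbox 0 (vec 1))"

definition space_measure :: "((real ^ 'n) \<times> (real ^ 'n)) measure" where
  "space_measure = torus_measure \<Otimes>\<^sub>M lborel"

definition freq_measure :: "((int ^ 'n) \<times> (real ^ 'n)) measure" where
  "freq_measure = count_space UNIV \<Otimes>\<^sub>M lborel"

definition torus_char :: "int ^ 'n \<Rightarrow> real ^ 'n \<Rightarrow> complex" where
  "torus_char n \<theta> = cis (- 2 * pi * (\<Sum>j\<in>UNIV. of_int (n $ j) * \<theta> $ j))"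

definition fourier_L1 ::
    "((real ^ 'n) \<times> (real ^ 'n) \<Rightarrow> complex) \<Rightarrow> (int ^ 'n) \<times> (real ^ 'n) \<Rightarrow> complex" where
  "fourier_L1 F = (\<lambda>(n, t).
     LINT (\<theta>, s)|space_measure. F (\<theta>, s) * torus_char n \<theta> * cis (- 2 * pi * (t \<bullet> s)))"

definition square_integrable :: "'a measure \<Rightarrow> ('a \<Rightarrow> complex) \<Rightarrow> bool" where
  "square_integrable M f \<longleftrightarrow> f \<in> borel_measurable M \<and> integrable M (\<lambda>x. (cmod (f x))\<^sup>2)"

definition L2_tendsto :: "'a measure \<Rightarrow> (nat \<Rightarrow> 'a \<Rightarrow> complex) \<Rightarrow> ('a \<Rightarrow> complex) \<Rightarrow> bool" where
  "L2_tendsto M f g \<longleftrightarrow> (\<lambda>k. \<integral>\<^sup>+x. ennreal ((cmod (f k x - g x))\<^sup>2) \<partial>M) \<longlonglongrightarrow> 0"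

text \<open>
  The Plancherel transform is the continuous extension of \<^const>\<open>fourier_L1\<close> from
  \<open>L\<^sup>1 \<inter> L\<^sup>2\<close> to \<open>L\<^sup>2\<close>; its value at \<open>F\<close>, a function determined up to null sets, is the limit of
  the transforms along any sequence in \<open>L\<^sup>1 \<inter> L\<^sup>2\<close> that tends to \<open>F\<close>.
\<close>

definition is_fourier ::
    "((real ^ 'n) \<times> (real ^ 'n) \<Rightarrow> complex) \<Rightarrow> ((int ^ 'n) \<times> (real ^ 'n) \<Rightarrow> complex) \<Rightarrow> bool" where
  "is_fourier F Fh \<longleftrightarrow>
     square_integrable freq_measure Fh \<and>
     (\<forall>f. (\<forall>k. integrable space_measure (f k) \<and> square_integrable space_measure (f k)) \<longrightarrow>
          L2_tendsto space_measure f F \<longrightarrow>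
          L2_tendsto freq_measure (\<lambda>k. fourier_L1 (f k)) Fh)"

definition fourier ::
    "((real ^ 'n) \<times> (real ^ 'n) \<Rightarrow> complex) \<Rightarrow> (int ^ 'n) \<times> (real ^ 'n) \<Rightarrow> complex" where
  "fourier F = (SOME Fh. is_fourier F Fh)"

definition fourier_zero :: "((real ^ 'n) \<times> (real ^ 'n) \<Rightarrow> complex) \<Rightarrow> int ^ 'n \<Rightarrow> complex" where
  "fourier_zero F n = (LINT \<theta>|torus_measure. F (\<theta>, 0) * torus_char n \<theta>)"

definition test_functions :: "((real ^ 'n) \<times> (real ^ 'n) \<Rightarrow> complex) set" where
  "test_functions = {F. torus_periodic F \<and> continuous_on UNIV F \<and>
     square_integrable space_measure F \<and>
     (\<exists>Fh. is_fourier F Fh \<and> integrable freq_measure Fh)}"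

text \<open>The point \<open>t = 0\<close>, where \<open>G\<close> is not constrained, is a null set.\<close>

definition C1 :: "((real ^ 'n) \<times> (real ^ 'n) \<Rightarrow> complex) \<Rightarrow> (real \<Rightarrow> real) \<Rightarrow> ennreal" where
  "C1 F G = (\<integral>\<^sup>+n. (\<integral>\<^sup>+t. ennreal (cmod (fourier F (n, t)) * G (infnorm t)) \<partial>lborel)
               \<partial>count_space UNIV)"

definition C2 :: "((real ^ 'n) \<times> (real ^ 'n) \<Rightarrow> complex) \<Rightarrow> (real \<Rightarrow> real) \<Rightarrow> ennreal" where
  "C2 F H = (\<integral>\<^sup>+n. ennreal (cmod (fourier_zero F n) * H (real (l1norm n)))
               \<partial>count_space (UNIV - {0}))"

text \<open>
  Automorphisms of the field of algebraic numbers over the rationals; values outside that field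
  are irrelevant.
\<close>

definition abs_galois :: "(complex \<Rightarrow> complex) set" where
  "abs_galois = {\<sigma>. bij_betw \<sigma> {x. algebraic x} {x. algebraic x} \<and>
     (\<forall>x y. algebraic x \<longrightarrow> algebraic y \<longrightarrow>
        \<sigma> (x + y) = \<sigma> x + \<sigma> y \<and> \<sigma> (x * y) = \<sigma> x * \<sigma> y) \<and>
     (\<forall>x\<in>\<rat>. \<sigma> x = x)}"

definition galois_orbit :: "complex ^ 'n \<Rightarrow> (complex ^ 'n) set" where
  "galois_orbit \<xi> = (\<lambda>\<sigma>. \<chi> j. \<sigma> (\<xi> $ j)) ` abs_galois"

definition polar_coords :: "complex ^ 'n \<Rightarrow> (real ^ 'n) \<times> (real ^ 'n)" where
  "polar_coords \<alpha> = ((\<chi> j. Arg (\<alpha> $ j) / (2 * pi)), (\<chi> j. ln (cmod (\<alpha> $ j))))"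

definition equi_error :: "((real ^ 'n) \<times> (real ^ 'n) \<Rightarrow> complex) \<Rightarrow> complex ^ 'n \<Rightarrow> real" where
  "equi_error F \<xi> =
     cmod ((\<Sum>\<alpha>\<in>galois_orbit \<xi>. F (polar_coords \<alpha>)) / of_nat (card (galois_orbit \<xi>))
           - (LINT \<theta>|torus_measure. F (\<theta>, 0)))"

end

theory Submission
  imports Defs "Jordan_Normal_Form.Char_Poly" "HOL-Probability.Characteristic_Functions"
begin

text \<open>
  A test function is a superposition of its frequencies, because Fourier inversion holds pointwise on
  this class (\<open>fourier_inversion\<close>). Each frequency can therefore be averaged over the Galois orbit
  separately, and the equidistribution error splits into a radial part, from moving the points of the
  orbit to the unit polycircle along rays, and an angular part.
  
  For the radial part, moving a point with logarithmic radii \<open>s\<close> changes the frequency \<open>t\<close> by at most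
  \<open>min 2 (2 pi \<parallel>t\<parallel>\<^sub>\<infinity> \<parallel>s\<parallel>\<^sub>1)\<close>. The mean of \<open>\<parallel>s\<parallel>\<^sub>1\<close> over the orbit is at most twice the height, since the
  constant coefficient of a minimal polynomial is a nonzero integer (\<open>sum_abs_ln_conjugates\<close>).
  
  For the angular part, the frequency \<open>n\<close> averages to the mean of \<open>z / \<bar>z\<bar>\<close> over the conjugates \<open>z\<close> of the
  algebraic number \<open>\<chi>\<^sup>n(\<xi>)\<close>, because all conjugates are hit equally often (\<open>fibre_card\<close>). If this number
  has degree \<open>D\<close> and height \<open>h\<close>, the mean is at most \<open>sqrt (24 (h + ln (2 D) / (3 D)))\<close>
  (\<open>angular_sum_bound\<close>). Here \<open>h\<close> is at most \<open>\<parallel>n\<parallel>\<^sub>1\<close> times the height of \<open>\<xi>\<close> (\<open>weil_height_character\<close>) and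
  \<open>\<parallel>n\<parallel>\<^sub>1 D\<close> is at least the generalized degree, so the mean is at most \<open>sqrt (24 \<parallel>n\<parallel>\<^sub>1 h\<^sub>D)\<close>. In both parts the
  conditions on \<open>G\<close> and \<open>H\<close> say exactly that such a bound, capped by a constant, is dominated by a ratio of
  values of the weight (\<open>growth_comparison\<close>).
  
  The bound in one variable is an energy argument. The discriminant is a nonzero integer, so the mean of
  \<open>ln \<bar>z - w\<bar>\<close> over pairs of conjugates is not very negative. Reflecting the exterior of the unit disc into
  the disc replaces \<open>\<bar>z - w\<bar>\<close>, at the cost of the height, by the kernel \<open>\<bar>1 - z cnj w\<bar>\<close>, and minus its
  logarithm is a series of positive kernels whose first term is the square of the mean of the reflected
  points.
  
  The arithmetic rests on two facts: the leading coefficient times any product of distinct roots of an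
  integer polynomial is an algebraic integer (\<open>algebraic_int_lead_times_roots\<close>), and the automorphisms of
  the field of algebraic numbers act transitively on conjugates (\<open>galois_transitive\<close>). Together they show
  that symmetric expressions in the conjugates, cleared of denominators, are integers.
\<close>

text \<open>
  The symbol \<open>$\<close> and the name \<open>vec\<close> belong to finite Cartesian products throughout.
\<close>

no_notation Matrix.vec_index (infixl "$" 100)
hide_const (open) Matrix.vec Module.smult

section \<open>Algebraic integers\<close>

interpretation int_module: Modules.module "\<lambda>(k::int) (x::complex). of_int k * x"
  by unfold_locales (simp_all add: algebra_simps)

text \<open>
  Integrality is handled through finitely generated subgroups of the complex numbers: the numbers that
  map the span of \<open>B\<close> into itself form a ring, and for suitable \<open>B\<close> they are algebraic integers.
\<close>

definition stabilizes :: "complex set \<Rightarrow> complex \<Rightarrow> bool" where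
  "stabilizes B x \<longleftrightarrow> (\<forall>b\<in>B. x * b \<in> int_module.span B)"

lemma stabilizes_span:
  assumes "stabilizes B x" "y \<in> int_module.span B"
  shows "x * y \<in> int_module.span B"
  using assms(2)
proof (induction y rule: int_module.span_induct_alt)
  case base
  then show ?case by (simp add: int_module.span_zero)
next
  case (step c b y)
  have "x * (of_int c * b + y) = of_int c * (x * b) + x * y"
    by (simp add: algebra_simps)
  then show ?case
    using assms(1) step by (auto simp: stabilizes_def intro!: int_module.span_add int_module.span_scale)
qed

lemma stabilizes_add: "stabilizes B x \<Longrightarrow> stabilizes B y \<Longrightarrow> stabilizes B (x + y)"
  by (auto simp: stabilizes_def distrib_right intro: int_module.span_add)

lemma stabilizes_mult: "stabilizes B x \<Longrightarrow> stabilizes B y \<Longrightarrow> stabilizes B (x * y)"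
  using stabilizes_span[of B x] by (auto simp: stabilizes_def mult.assoc)

text \<open>
  Multiplication by \<open>x\<close> acts on the generators through an integer matrix that has \<open>x\<close> as an eigenvalue,
  and the characteristic polynomial of that matrix is monic with integer coefficients.
\<close>

lemma algebraic_int_if_stabilizes:
  assumes "finite B" "b \<in> B" "b \<noteq> 0" "stabilizes B x"
  shows "algebraic_int x"
proof -
  obtain bs where bs: "set bs = B" "distinct bs"
    using finite_distinct_list[OF assms(1)] by blast
  define n where "n = length bs"
  have "\<exists>u. x * c = (\<Sum>v\<in>B. of_int (u v) * v)" if "c \<in> B" for c
    using assms(4) that int_module.span_finite[OF assms(1)] unfolding stabilizes_def by auto
  then obtain u :: "complex \<Rightarrow> complex \<Rightarrow> int" where u: "\<And>c. c \<in> B \<Longrightarrow> x * c = (\<Sum>v\<in>B. of_int (u c v) * v)"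
    by metis
  define A where "A = mat n n (\<lambda>(i,j). u (bs ! i) (bs ! j))"
  let ?A = "map_mat of_int A :: complex mat"
  have A: "A \<in> carrier_mat n n" "?A \<in> carrier_mat n n" by (auto simp: A_def)
  define v where "v = Matrix.vec n (\<lambda>i. bs ! i)"
  have "v \<noteq> 0\<^sub>v n"
  proof
    assume v0: "v = 0\<^sub>v n"
    obtain i where i: "i < n" "bs ! i = b" using assms(2) bs unfolding n_def by (metis in_set_conv_nth)
    then show False using v0 assms(3) by (metis index_vec index_zero_vec(1) v_def)
  qed
  moreover have "?A *\<^sub>v v = x \<cdot>\<^sub>v v"
  proof (rule eq_vecI)
    fix i assume "i < dim_vec (x \<cdot>\<^sub>v v)"
    then have i: "i < n" by (simp add: v_def)
    have "vec_index (?A *\<^sub>v v) i = (\<Sum>j = 0..<n. of_int (u (bs ! i) (bs ! j)) * bs ! j)"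
      using i by (simp add: A_def v_def scalar_prod_def)
    also have "\<dots> = (\<Sum>w\<in>B. of_int (u (bs ! i) w) * w)"
      using bs by (intro sum.reindex_bij_betw[where g = "\<lambda>w. of_int (u (bs ! i) w) * w"])
        (auto simp: n_def intro!: bij_betw_nth)
    also have "\<dots> = x * bs ! i"
      by (rule u[symmetric]) (use i bs(1) in \<open>auto simp: n_def\<close>)
    finally show "vec_index (?A *\<^sub>v v) i = vec_index (x \<cdot>\<^sub>v v) i"
      using i by (simp add: v_def)
  qed (simp add: A_def v_def)
  ultimately have "eigenvalue ?A x"
    unfolding eigenvalue_def eigenvector_def
    using A by (intro exI[of _ v]) (auto simp: v_def)
  then have "poly (char_poly ?A) x = 0"
    using eigenvalue_root_char_poly[OF A(2)] by simp
  moreover have "char_poly ?A = map_poly of_int (char_poly A)"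
    using of_int_hom.char_poly_hom[OF A(1)] .
  moreover have "monic (char_poly A)"
    using degree_monic_char_poly[OF A(1)] by simp
  ultimately show ?thesis
    unfolding algebraic_int_altdef_ipoly by metis
qed

lemma algebraic_int_stabilizes:
  assumes "algebraic_int x"
  obtains B where "finite B" "1 \<in> B" "stabilizes B x"
proof -
  obtain p where p: "poly (map_poly of_int p) x = 0" "monic p"
    using assms unfolding algebraic_int_altdef_ipoly by blast
  define d where "d = degree p"
  have sum0: "(\<Sum>i\<le>d. of_int (coeff p i) * x ^ i) = 0"
    using p(1) by (simp add: poly_altdef degree_map_poly coeff_map_poly d_def)
  have "d > 0"
  proof (rule ccontr)
    assume "\<not> d > 0"
    then show False using sum0 p(2) by (simp add: d_def)
  qed
  define B where "B = (\<lambda>i. x ^ i) ` {..<d}"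
  have pow: "x ^ i \<in> int_module.span B" if "i < d" for i
    using that by (auto simp: B_def intro!: int_module.span_base)
  have "x ^ d = - (\<Sum>i<d. of_int (coeff p i) * x ^ i)"
    using sum0 p(2) by (simp add: lessThan_Suc_atMost[symmetric] d_def eq_neg_iff_add_eq_0 add.commute)
  also have "\<dots> \<in> int_module.span B"
    by (intro int_module.span_neg int_module.span_sum int_module.span_scale pow) auto
  finally have "x ^ d \<in> int_module.span B" .
  then have "x ^ Suc i \<in> int_module.span B" if "i < d" for i
    using pow[of "Suc i"] that by (cases "Suc i = d") auto
  then have "stabilizes B x"
    by (auto simp: stabilizes_def B_def)
  moreover have "1 \<in> B" unfolding B_def using \<open>d > 0\<close> by (auto intro!: image_eqI[of _ _ 0])
  ultimately show ?thesis using that[of B] by (simp add: B_def)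
qed

lemma stabilizes_product:
  assumes "stabilizes B x"
  shows "stabilizes ((\<lambda>(b, c). b * c) ` (B \<times> C)) x"
  unfolding stabilizes_def
proof safe
  fix b c assume bc: "b \<in> B" "c \<in> C"
  have "y * c \<in> int_module.span ((\<lambda>(b, c). b * c) ` (B \<times> C))" if "y \<in> int_module.span B" for y
    using that
  proof (induction y rule: int_module.span_induct_alt)
    case base
    then show ?case by (simp add: int_module.span_zero)
  next
    case (step k b y)
    have "b * c \<in> int_module.span ((\<lambda>(b, c). b * c) ` (B \<times> C))"
      using step(1) bc by (intro int_module.span_base) auto
    then show ?case
      using step by (auto simp: distrib_right mult.assoc intro!: int_module.span_add int_module.span_scale)
  qed
  from this[of "x * b"] show "x * (b * c) \<in> int_module.span ((\<lambda>(b, c). b * c) ` (B \<times> C))"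
    using assms bc by (simp add: stabilizes_def mult.assoc)
qed

text \<open>
  Products of generators provide one group for several algebraic integers at once; this is why sums and
  products of algebraic integers are integral.
\<close>

lemma algebraic_ints_stabilize:
  assumes "finite X" "\<And>x. x \<in> X \<Longrightarrow> algebraic_int x"
  shows "\<exists>B. finite B \<and> 1 \<in> B \<and> (\<forall>x\<in>X. stabilizes B x)"
  using assms
proof (induction X rule: finite_induct)
  case empty
  then show ?case by (intro exI[of _ "{1}"]) auto
next
  case (insert x X)
  then obtain B where B: "finite B" "1 \<in> B" "\<forall>x\<in>X. stabilizes B x" by auto
  obtain C where C: "finite C" "1 \<in> C" "stabilizes C x"
    using algebraic_int_stabilizes insert(4) by blast
  define BC where "BC = (\<lambda>(b, c). b * c) ` (B \<times> C)"
  have eq: "BC = (\<lambda>(b, c). b * c) ` (C \<times> B)"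
  proof -
    have "(\<lambda>(b, c). b * c) \<circ> prod.swap = (\<lambda>(b, c). b * c :: complex)"
      by (auto simp: fun_eq_iff mult.commute)
    then show ?thesis unfolding BC_def product_swap[of B C, symmetric] image_comp by simp
  qed
  have "1 \<in> BC" unfolding BC_def using B C by (intro image_eqI[of _ _ "(1, 1)"]) auto
  moreover have "finite BC" using B C by (simp add: BC_def)
  moreover have "\<forall>y\<in>X. stabilizes BC y"
    using B(3) stabilizes_product[of B _ C] unfolding BC_def by blast
  moreover have "stabilizes BC x"
    unfolding eq by (rule stabilizes_product) fact
  ultimately show ?case by blast
qed

lemma algebraic_int_add:
  assumes "algebraic_int (x::complex)" "algebraic_int y"
  shows "algebraic_int (x + y)"
proof -
  obtain B where "finite B" "1 \<in> B" "\<forall>z\<in>{x, y}. stabilizes B z"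
    using algebraic_ints_stabilize[of "{x, y}"] assms by auto
  then show ?thesis
    by (intro algebraic_int_if_stabilizes[of B 1]) (auto intro: stabilizes_add)
qed

lemma algebraic_int_mult:
  assumes "algebraic_int (x::complex)" "algebraic_int y"
  shows "algebraic_int (x * y)"
proof -
  obtain B where "finite B" "1 \<in> B" "\<forall>z\<in>{x, y}. stabilizes B z"
    using algebraic_ints_stabilize[of "{x, y}"] assms by auto
  then show ?thesis
    by (intro algebraic_int_if_stabilizes[of B 1]) (auto intro: stabilizes_mult)
qed

lemma algebraic_int_sum: "(\<And>i. i \<in> S \<Longrightarrow> algebraic_int (f i :: complex)) \<Longrightarrow> algebraic_int (sum f S)"
  by (induction S rule: infinite_finite_induct) (auto intro: algebraic_int_add)

lemma algebraic_int_prod: "(\<And>i. i \<in> S \<Longrightarrow> algebraic_int (f i :: complex)) \<Longrightarrow> algebraic_int (prod f S)"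
  by (induction S rule: infinite_finite_induct) (auto intro: algebraic_int_mult)

lemma algebraic_int_power: "algebraic_int (x :: complex) \<Longrightarrow> algebraic_int (x ^ n)"
  by (induction n) (auto intro: algebraic_int_mult)

text \<open>
  The coefficients of \<open>q\<close> are the partial Horner sums at \<open>a\<close> of the dividend \<open>f\<close>. If the coefficients of \<open>f\<close>
  stabilize the span of \<open>B\<close>, these sums stabilize the span of the products \<open>b a\<^sup>j\<close> with \<open>j\<close> less than the
  degree of \<open>f\<close>: a power of \<open>a\<close> that becomes too large is lowered by the relation \<open>f(a) = 0\<close>.
\<close>

lemma algebraic_int_coeffs_divide_linear:
  fixes q :: "complex poly"
  assumes int: "\<And>i. algebraic_int (coeff ([:- a, 1:] * q) i)"
  shows "algebraic_int (coeff q k)"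
proof (cases "q = 0")
  case False
  define f where "f = [:- a, 1:] * q"
  define d where "d = degree f"
  have d: "d = Suc (degree q)"
    using False by (simp add: d_def f_def degree_mult_eq del: mult_pCons_left)
  have f0: "coeff f 0 = - (a * coeff q 0)" by (simp add: f_def)
  have fSuc: "coeff q k = coeff f (Suc k) + a * coeff q (Suc k)" for k
    by (simp add: f_def)
  obtain B where B: "finite B" "1 \<in> B" and stB: "\<And>i. i \<le> d \<Longrightarrow> stabilizes B (coeff f i)"
    using algebraic_ints_stabilize[of "coeff f ` {..d}"] int unfolding f_def by auto
  define M where "M = (\<lambda>(b, j). b * a ^ j) ` (B \<times> {..<d})"
  have "1 \<in> M" unfolding M_def using B d by (intro image_eqI[of _ _ "(1, 0)"]) auto
  have fB: "coeff f i * (a ^ j * b) \<in> int_module.span M" if "j < d" "b \<in> B" for i j b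
  proof (cases "i \<le> d")
    case True
    have "y * a ^ j \<in> int_module.span M" if "y \<in> int_module.span B" for y
      using that
    proof (induction y rule: int_module.span_induct_alt)
      case base
      then show ?case by (simp add: int_module.span_zero)
    next
      case (step k b y)
      have "b * a ^ j \<in> int_module.span M"
        using step(1) \<open>j < d\<close> by (intro int_module.span_base) (auto simp: M_def)
      then show ?case
        using step by (auto simp: distrib_right mult.assoc intro!: int_module.span_add int_module.span_scale)
    qed
    from this[of "coeff f i * b"] stB[OF True] that show ?thesis
      by (simp add: stabilizes_def mult_ac)
  next
    case False
    then have "coeff f i = 0" by (intro coeff_eq_0) (simp add: d_def)
    then show ?thesis by (simp add: int_module.span_zero)
  qed
  \<comment> \<open>Horner's recursion lowers the exponent of \<open>a\<close> when read upwards from the constant term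
     and raises it when read downwards from the leading term.\<close>
  have low: "j < d \<Longrightarrow> b \<in> B \<Longrightarrow> k < j \<Longrightarrow> coeff q k * (a ^ j * b) \<in> int_module.span M" for k j b
  proof (induction k arbitrary: j)
    case 0
    then obtain j' where j': "j = Suc j'" by (cases j) auto
    have "coeff q 0 * (a ^ j * b) = - (coeff f 0 * (a ^ j' * b))" by (simp add: f0 j' mult_ac)
    then show ?case using fB[of j' b 0] 0 j' by (simp add: int_module.span_neg)
  next
    case (Suc k)
    then obtain j' where j': "j = Suc j'" by (cases j) auto
    have "coeff q (Suc k) * (a ^ j * b) = coeff q k * (a ^ j' * b) - coeff f (Suc k) * (a ^ j' * b)"
      using fSuc[of k] by (simp add: j' algebra_simps)
    then show ?case using fB[of j' b "Suc k"] Suc j' by (auto intro!: int_module.span_diff)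
  qed
  have high: "b \<in> B \<Longrightarrow> j \<le> k \<Longrightarrow> m + k = d \<Longrightarrow> coeff q k * (a ^ j * b) \<in> int_module.span M" for k j b m
  proof (induction m arbitrary: k j)
    case 0
    then have "coeff q k = 0" using d by (intro coeff_eq_0) auto
    then show ?case by (simp add: int_module.span_zero)
  next
    case (Suc m)
    have "coeff q k * (a ^ j * b) = coeff f (Suc k) * (a ^ j * b) + coeff q (Suc k) * (a ^ Suc j * b)"
      using fSuc[of k] by (simp add: algebra_simps)
    then show ?case using fB[of j b "Suc k"] Suc.IH[of "Suc j" "Suc k"] Suc.prems
      by (auto intro!: int_module.span_add)
  qed
  have "stabilizes M (coeff q k)"
  proof (cases "k < d")
    case True
    have "coeff q k * (a ^ j * b) \<in> int_module.span M" if "j < d" "b \<in> B" for j b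
      using low[of j b k] high[of b j k "d - k"] that True by (cases "k < j") auto
    then show ?thesis by (force simp: stabilizes_def M_def mult_ac)
  next
    case False
    then have "coeff q k = 0" using d by (intro coeff_eq_0) auto
    then show ?thesis by (simp add: stabilizes_def int_module.span_zero)
  qed
  then show ?thesis
    using \<open>1 \<in> M\<close> B by (intro algebraic_int_if_stabilizes[of M 1]) (auto simp: M_def)
qed auto

text \<open>
  Dividing out the other roots leaves a polynomial with integral coefficients, whose constant term is, up
  to sign, the product in question.
\<close>

lemma algebraic_int_lead_times_roots:
  fixes X :: "'i \<Rightarrow> complex"
  assumes "finite S" "I \<subseteq> S"
    and int: "\<And>i. algebraic_int (coeff (smult c (\<Prod>s\<in>S. [:- X s, 1:])) i)"
  shows "algebraic_int (c * (\<Prod>s\<in>I. X s))"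
proof -
  have *: "finite J \<Longrightarrow> J \<inter> I = {} \<Longrightarrow> (\<And>i. algebraic_int (coeff (smult c (\<Prod>s\<in>J \<union> I. [:- X s, 1:])) i)) \<Longrightarrow>
     (\<And>i. algebraic_int (coeff (smult c (\<Prod>s\<in>I. [:- X s, 1:])) i))" for J
  proof (induction J rule: finite_induct)
    case (insert x J)
    have "smult c (\<Prod>s\<in>insert x J \<union> I. [:- X s, 1:]) = [:- X x, 1:] * smult c (\<Prod>s\<in>J \<union> I. [:- X s, 1:])"
      using insert finite_subset[OF assms(2,1)] by (simp add: prod.insert del: mult_pCons_left)
    then have "algebraic_int (coeff ([:- X x, 1:] * smult c (\<Prod>s\<in>J \<union> I. [:- X s, 1:])) i)" for i
      using insert(5)[of i] by (simp only: Un_insert_left)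
    then have "algebraic_int (coeff (smult c (\<Prod>s\<in>J \<union> I. [:- X s, 1:])) i)" for i
      by (rule algebraic_int_coeffs_divide_linear)
    then show ?case using insert(3,4) by blast
  qed auto
  have un: "(S - I) \<union> I = S" and disj: "(S - I) \<inter> I = {}" using assms(2) by auto
  have "algebraic_int (coeff (smult c (\<Prod>s\<in>I. [:- X s, 1:])) 0)"
    by (rule *[OF _ disj, unfolded un, OF _ int]) (use assms(1) in auto)
  moreover have "coeff (smult c (\<Prod>s\<in>I. [:- X s, 1:])) 0 = c * (\<Prod>s\<in>I. - X s)"
    by (simp add: poly_0_coeff_0[symmetric] poly_prod)
  moreover have "(\<Prod>s\<in>I. - X s) = (-1) ^ card I * (\<Prod>s\<in>I. X s)"
    by (rule prod_uminus)
  ultimately have h: "algebraic_int (c * ((-1) ^ card I * (\<Prod>s\<in>I. X s)))"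
    by (simp only:)
  have "algebraic_int ((-1) ^ card I * (c * ((-1) ^ card I * (\<Prod>s\<in>I. X s))))"
    by (rule algebraic_int_mult[OF algebraic_int_power h]) auto
  also have "(-1) ^ card I * (c * ((-1) ^ card I * (\<Prod>s\<in>I. X s))) =
      ((-1) ^ card I * (-1) ^ card I) * (c * (\<Prod>s\<in>I. X s))"
    by (simp only: mult_ac)
  finally show ?thesis by (simp add: flip: power_mult_distrib)
qed

section \<open>Algebraic numbers and their automorphisms\<close>

lemma algebraic_int_multiple:
  assumes "algebraic (x::complex)"
  obtains k :: int where "k \<noteq> 0" "algebraic_int (of_int k * x)"
proof -
  obtain p where p: "p \<noteq> 0" "poly (map_poly of_int p) x = 0"
    using assms by (rule algebraicE')
  define f :: "complex poly" where "f = map_poly of_int p"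
  have int: "algebraic_int (coeff f i)" for i by (simp add: f_def coeff_map_poly)
  obtain q where q: "f = [:- x, 1:] * q"
    using p(2) unfolding f_def poly_eq_0_iff_dvd by (elim dvdE)
  have "f \<noteq> 0" using p(1) by (simp add: f_def)
  then have "q \<noteq> 0" using q by auto
  have intq: "algebraic_int (coeff q i)" for i
    using int unfolding q by (rule algebraic_int_coeffs_divide_linear)
  have degf: "degree f = Suc (degree q)"
    using \<open>q \<noteq> 0\<close> by (simp add: q degree_mult_eq del: mult_pCons_left)
  have lead: "lead_coeff q = of_int (lead_coeff p)"
  proof -
    have "lead_coeff f = lead_coeff q" unfolding q lead_coeff_mult by simp
    then show ?thesis by (simp add: f_def coeff_map_poly)
  qed
  \<comment> \<open>The coefficient of \<open>f\<close> below the leading one exhibits \<open>lead_coeff q * x\<close> as an integral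
     combination.\<close>
  have "algebraic_int (lead_coeff q * x)"
  proof (cases "degree q")
    case 0
    have "lead_coeff q * x = - coeff f 0" unfolding q using 0 by simp
    then show ?thesis using int[of 0] by simp
  next
    case (Suc m)
    have "lead_coeff q * x = coeff q m + (- coeff f (Suc m))" unfolding q using Suc by simp
    then show ?thesis using int[of "Suc m"] intq[of m] algebraic_int_add[of "coeff q m" "- coeff f (Suc m)"] by simp
  qed
  then show ?thesis using that[of "lead_coeff p"] p(1) lead by simp
qed

lemma algebraic_if_int_multiple_algebraic:
  assumes "algebraic (of_int k * x)" "k \<noteq> 0"
  shows "algebraic (x::complex)"
proof -
  obtain p where p: "\<And>i. coeff p i \<in> \<int>" "p \<noteq> 0" "poly p (of_int k * x) = 0"
    using assms(1) by (auto simp: algebraic_def)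
  show ?thesis
    unfolding algebraic_def
  proof (intro exI[of _ "pcompose p [:0, of_int k:]"] conjI allI)
    show "coeff (pcompose p [:0, of_int k:]) i \<in> \<int>" for i
      using p(1) by (simp add: coeff_pcompose_linear)
    show "pcompose p [:0, of_int k:] \<noteq> 0"
      using p(2) assms(2) by (simp add: pcompose_eq_0_iff)
    show "poly (pcompose p [:0, of_int k:]) x = 0"
      using p(3) by (simp add: poly_pcompose mult.commute)
  qed
qed

lemma algebraic_add:
  assumes "algebraic (x::complex)" "algebraic y"
  shows "algebraic (x + y)"
proof -
  obtain k l :: int where k: "k \<noteq> 0" "algebraic_int (of_int k * x)" and l: "l \<noteq> 0" "algebraic_int (of_int l * y)"
    using assms algebraic_int_multiple by metis
  have "algebraic_int (of_int l * (of_int k * x) + of_int k * (of_int l * y))"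
    by (intro algebraic_int_add algebraic_int_mult k l) auto
  also have "of_int l * (of_int k * x) + of_int k * (of_int l * y) = of_int (k * l) * (x + y)"
    by (simp add: algebra_simps)
  finally show ?thesis
    using k l algebraic_if_int_multiple_algebraic[of "k * l"] by auto
qed

lemma algebraic_mult:
  assumes "algebraic (x::complex)" "algebraic y"
  shows "algebraic (x * y)"
proof -
  obtain k l :: int where k: "k \<noteq> 0" "algebraic_int (of_int k * x)" and l: "l \<noteq> 0" "algebraic_int (of_int l * y)"
    using assms algebraic_int_multiple by metis
  have "algebraic_int ((of_int k * x) * (of_int l * y))"
    by (intro algebraic_int_mult k l)
  also have "(of_int k * x) * (of_int l * y) = of_int (k * l) * (x * y)"
    by (simp add: algebra_simps)
  finally show ?thesis
    using k l algebraic_if_int_multiple_algebraic[of "k * l"] by auto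
qed

lemma algebraic_Rats: "x \<in> \<rat> \<Longrightarrow> algebraic (x::complex)"
  unfolding algebraic_altdef
  by (intro exI[of _ "[:- x, 1:]"]) (auto simp: coeff_pCons split: nat.splits)

lemma algebraic_sum: "(\<And>i. i \<in> S \<Longrightarrow> algebraic (f i :: complex)) \<Longrightarrow> algebraic (sum f S)"
  by (induction S rule: infinite_finite_induct) (auto intro: algebraic_add)

lemma algebraic_prod: "(\<And>i. i \<in> S \<Longrightarrow> algebraic (f i :: complex)) \<Longrightarrow> algebraic (prod f S)"
  by (induction S rule: infinite_finite_induct) (auto intro: algebraic_mult)

lemma algebraic_power: "algebraic (x :: complex) \<Longrightarrow> algebraic (x ^ n)"
  by (induction n) (auto intro: algebraic_mult)

lemma algebraic_powi: "algebraic (x :: complex) \<Longrightarrow> algebraic (x powi k)"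
  by (auto simp: power_int_def intro: algebraic_power)

lemma algebraic_poly:
  "(\<And>i. algebraic (coeff p i)) \<Longrightarrow> algebraic x \<Longrightarrow> algebraic (poly p (x::complex))"
  by (auto simp: poly_altdef intro!: algebraic_sum algebraic_mult algebraic_power)

lemma clear_denominators:
  fixes p :: "complex poly"
  assumes "\<And>i. coeff p i \<in> \<rat>"
  obtains k :: int and q where "k \<noteq> 0" "map_poly of_int q = smult (of_int k) p"
proof -
  have "\<exists>n::int. n \<noteq> 0 \<and> of_int n * c \<in> (\<int>::complex set)" if c: "c \<in> \<rat>" for c :: complex
  proof -
    obtain a b :: int where "b > 0" "c = of_int a / of_int b"
      using c by (elim Rats_cases') blast
    then show ?thesis by (intro exI[of _ b]) auto
  qed
  then have "\<forall>i. \<exists>n::int. n \<noteq> 0 \<and> of_int n * coeff p i \<in> \<int>" using assms by blast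
  then obtain n :: "nat \<Rightarrow> int" where "\<forall>i. n i \<noteq> 0 \<and> of_int (n i) * coeff p i \<in> \<int>"
    unfolding choice_iff by blast
  then have n: "\<And>i. n i \<noteq> 0" "\<And>i. of_int (n i) * coeff p i \<in> \<int>" by auto
  define k where "k = (\<Prod>i\<le>degree p. n i)"
  have "coeff (smult (of_int k) p) i \<in> \<int>" for i
  proof (cases "i \<le> degree p")
    case True
    then have "k = n i * (\<Prod>j\<in>{..degree p} - {i}. n j)"
      unfolding k_def by (subst prod.remove[of _ i]) auto
    then have "coeff (smult (of_int k) p) i = of_int (\<Prod>j\<in>{..degree p} - {i}. n j) * (of_int (n i) * coeff p i)"
      by simp
    then show ?thesis using Ints_mult[OF Ints_of_int n(2)] by (simp only:)
  qed (simp add: coeff_eq_0)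
  then obtain q where "smult (of_int k) p = map_poly of_int q"
    by (rule intpolyE)
  moreover have "k \<noteq> 0" using n(1) by (simp add: k_def)
  ultimately show ?thesis using that by metis
qed

text \<open>
  The graph of a homomorphism from a field of algebraic numbers to the complex numbers. Working with
  graphs makes the union of a chain again such a graph, and lets a polynomial over the domain and its
  image be handled as one pair of polynomials.
\<close>

definition hom_graph :: "(complex \<times> complex) set \<Rightarrow> bool" where
  "hom_graph \<Gamma> \<longleftrightarrow> (\<forall>x y. (x, y) \<in> \<Gamma> \<longrightarrow> algebraic x) \<and> (\<forall>q\<in>\<rat>. (q, q) \<in> \<Gamma>) \<and>
     (\<forall>x y x' y'. (x, y) \<in> \<Gamma> \<longrightarrow> (x', y') \<in> \<Gamma> \<longrightarrow> (x + x', y + y') \<in> \<Gamma> \<and> (x * x', y * y') \<in> \<Gamma>) \<and>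
     (\<forall>y. (0, y) \<in> \<Gamma> \<longrightarrow> y = 0)"

context
  fixes \<Gamma> assumes \<Gamma>: "hom_graph \<Gamma>"
begin

lemma graph_Rats: "q \<in> \<rat> \<Longrightarrow> (q, q) \<in> \<Gamma>"
  and graph_add: "(x, y) \<in> \<Gamma> \<Longrightarrow> (x', y') \<in> \<Gamma> \<Longrightarrow> (x + x', y + y') \<in> \<Gamma>"
  and graph_mult: "(x, y) \<in> \<Gamma> \<Longrightarrow> (x', y') \<in> \<Gamma> \<Longrightarrow> (x * x', y * y') \<in> \<Gamma>"
  and graph_zero: "(0, y) \<in> \<Gamma> \<Longrightarrow> y = 0"
  and graph_algebraic: "(x, y) \<in> \<Gamma> \<Longrightarrow> algebraic x"
  using \<Gamma> unfolding hom_graph_def by blast+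

lemma graph_diff: "(x, y) \<in> \<Gamma> \<Longrightarrow> (x', y') \<in> \<Gamma> \<Longrightarrow> (x - x', y - y') \<in> \<Gamma>"
  using graph_add[of x y "-1 * x'" "-1 * y'"] graph_mult[OF graph_Rats[of "-1"]] by simp

lemma graph_unique: "(x, y) \<in> \<Gamma> \<Longrightarrow> (x, y') \<in> \<Gamma> \<Longrightarrow> y = y'"
  using graph_diff[of x y x y'] graph_zero[of "y - y'"] by simp

lemma graph_sum: "(\<And>i. i \<in> S \<Longrightarrow> (f i, g i) \<in> \<Gamma>) \<Longrightarrow> (sum f S, sum g S) \<in> \<Gamma>"
  by (induction S rule: infinite_finite_induct) (auto intro: graph_add graph_Rats)

lemma graph_power: "(x, y) \<in> \<Gamma> \<Longrightarrow> (x ^ n, y ^ n) \<in> \<Gamma>"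
  by (induction n) (auto intro: graph_mult graph_Rats)

lemma graph_poly_Rats:
  "(\<And>i. coeff p i \<in> \<rat>) \<Longrightarrow> (x, y) \<in> \<Gamma> \<Longrightarrow> (poly p x, poly p y) \<in> \<Gamma>"
  unfolding poly_altdef by (intro graph_sum graph_mult graph_power graph_Rats) auto

lemma graph_inverse:
  assumes "(x, y) \<in> \<Gamma>" "x \<noteq> 0"
  shows "y \<noteq> 0" "(inverse x, inverse y) \<in> \<Gamma>"
proof -
  \<comment> \<open>An integral equation for \<open>x\<close> with nonzero constant term writes the inverse as a polynomial.\<close>
  obtain p where p: "coeff p 0 \<noteq> 0" "poly (map_poly of_int p) x = 0"
    using graph_algebraic[OF assms(1)] assms(2) by (rule algebraicE'_nonzero)
  obtain a q where aq: "p = pCons a q" by (rule pCons_cases)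
  define Q :: "complex poly" where "Q = map_poly of_int q"
  have a: "a \<noteq> 0" using p(1) aq by simp
  have QR: "coeff Q i \<in> \<rat>" for i by (simp add: Q_def coeff_map_poly)
  have eqx: "of_int a + x * poly Q x = 0"
    using p(2) by (simp add: aq a map_poly_pCons Q_def)
  have gQ: "(poly Q x, poly Q y) \<in> \<Gamma>" by (rule graph_poly_Rats[OF QR assms(1)])
  have "(of_int a + x * poly Q x, of_int a + y * poly Q y) \<in> \<Gamma>"
    by (intro graph_add graph_mult graph_Rats gQ assms) auto
  then have eqy: "of_int a + y * poly Q y = 0" using eqx graph_zero by simp
  show y: "y \<noteq> 0" using eqy a by auto
  have ix: "inverse x = (- 1 / of_int a) * poly Q x"
    using eqx assms(2) a by (simp add: field_simps eq_neg_iff_add_eq_0)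
  have iy: "inverse y = (- 1 / of_int a) * poly Q y"
    using eqy y a by (simp add: field_simps eq_neg_iff_add_eq_0)
  show "(inverse x, inverse y) \<in> \<Gamma>"
    unfolding ix iy by (intro graph_mult graph_Rats gQ) auto
qed

definition poly_rel :: "complex poly \<Rightarrow> complex poly \<Rightarrow> bool" where
  "poly_rel p p' \<longleftrightarrow> (\<forall>i. (coeff p i, coeff p' i) \<in> \<Gamma>)"

lemma poly_rel_0: "poly_rel 0 0"
  by (auto simp: poly_rel_def intro: graph_Rats)

lemma poly_rel_add: "poly_rel p p' \<Longrightarrow> poly_rel q q' \<Longrightarrow> poly_rel (p + q) (p' + q')"
  by (auto simp: poly_rel_def intro: graph_add)

lemma poly_rel_diff: "poly_rel p p' \<Longrightarrow> poly_rel q q' \<Longrightarrow> poly_rel (p - q) (p' - q')"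
  by (auto simp: poly_rel_def intro: graph_diff)

lemma poly_rel_mult: "poly_rel p p' \<Longrightarrow> poly_rel q q' \<Longrightarrow> poly_rel (p * q) (p' * q')"
  by (auto simp: poly_rel_def coeff_mult intro!: graph_sum graph_mult)

lemma poly_rel_monom: "(c, c') \<in> \<Gamma> \<Longrightarrow> poly_rel (monom c n) (monom c' n)"
  by (auto simp: poly_rel_def intro: graph_Rats)

lemma poly_rel_Rats: "(\<And>i. coeff p i \<in> \<rat>) \<Longrightarrow> poly_rel p p"
  by (auto simp: poly_rel_def intro: graph_Rats)

lemma poly_rel_division:
  assumes "poly_rel p p'" "monic p" "poly_rel g g'"
  shows "\<exists>q q' r r'. poly_rel q q' \<and> poly_rel r r' \<and> g = q * p + r \<and> g' = q' * p' + r' \<and>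
    (\<forall>i\<ge>degree p. coeff r i = 0)"
proof -
  have "\<forall>i\<ge>n. coeff g i = 0 \<Longrightarrow> poly_rel g g' \<Longrightarrow> ?thesis" for n
  proof (induction n arbitrary: g g')
    case 0
    then have "poly_rel 0 0" "\<forall>i\<ge>degree p. coeff g i = 0" by (auto intro: poly_rel_0)
    then show ?case using 0(2) by (metis add_0 mult_zero_left)
  next
    case (Suc n)
    show ?case
    proof (cases "n < degree p")
      case True
      then have "poly_rel 0 0" "\<forall>i\<ge>degree p. coeff g i = 0" using Suc.prems by (auto intro: poly_rel_0)
      then show ?thesis using Suc.prems(2) by (metis add_0 mult_zero_left)
    next
      case False
      define m m' where "m = monom (coeff g n) (n - degree p)" and "m' = monom (coeff g' n) (n - degree p)"
      have m: "poly_rel m m'"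
        using Suc.prems(2) unfolding m_def m'_def by (intro poly_rel_monom) (simp add: poly_rel_def)
      have "coeff (g - m * p) i = 0" if "i \<ge> n" for i
      proof (cases "i = n")
        case True
        then show ?thesis using False assms(2) by (simp add: m_def coeff_monom_mult)
      next
        case ne: False
        then have "i - (n - degree p) > degree p" using that False by simp
        then show ?thesis using Suc.prems(1) ne that by (simp add: m_def coeff_monom_mult coeff_eq_0)
      qed
      moreover have "poly_rel (g - m * p) (g' - m' * p')"
        using Suc.prems(2) m assms(1) by (intro poly_rel_diff poly_rel_mult)
      ultimately obtain q q' r r' where qr: "poly_rel q q'" "poly_rel r r'" "g - m * p = q * p + r"
        "g' - m' * p' = q' * p' + r'" "\<forall>i\<ge>degree p. coeff r i = 0"
        using Suc.IH by blast
      show ?thesis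
      proof (intro exI conjI)
        show "poly_rel (m + q) (m' + q')" using m qr by (intro poly_rel_add)
        show "poly_rel r r'" "\<forall>i\<ge>degree p. coeff r i = 0" by fact+
        show "g = (m + q) * p + r" using qr(3) by (simp add: algebra_simps)
        show "g' = (m' + q') * p' + r'" using qr(4) by (simp add: algebra_simps)
      qed
    qed
  qed
  from this[of "Suc (degree g)"] assms(3) show ?thesis by (simp add: coeff_eq_0)
qed

text \<open>
  Sending \<open>g(x)\<close> to \<open>g'(y)\<close> is well defined: a polynomial over the domain that vanishes at \<open>x\<close> is a
  multiple of \<open>p\<close>, so its image is a multiple of \<open>p'\<close> and vanishes at \<open>y\<close>.
\<close>

lemma adjoin_root:
  assumes p: "poly_rel p p'" "monic p" "poly p x = 0" "poly p' y = 0" and x: "algebraic x"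
    and minimal: "\<And>r r'. poly_rel r r' \<Longrightarrow> poly r x = 0 \<Longrightarrow> \<forall>i\<ge>degree p. coeff r i = 0 \<Longrightarrow> r = 0"
  shows "\<exists>\<Gamma>'. hom_graph \<Gamma>' \<and> \<Gamma> \<subseteq> \<Gamma>' \<and> (x, y) \<in> \<Gamma>'"
proof -
  define \<Gamma>' where "\<Gamma>' = {(poly g x, poly g' y) | g g'. poly_rel g g'}"
  have sub: "(a, b) \<in> \<Gamma>'" if "(a, b) \<in> \<Gamma>" for a b
  proof -
    have "poly_rel [:a:] [:b:]"
      using that by (auto simp: poly_rel_def coeff_pCons graph_Rats split: nat.splits)
    then show ?thesis by (force simp: \<Gamma>'_def)
  qed
  have "poly_rel [:0, 1:] [:0, 1:]"
    by (rule poly_rel_Rats) (auto simp: coeff_pCons split: nat.splits)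
  then have xy: "(x, y) \<in> \<Gamma>'" by (force simp: \<Gamma>'_def)
  have zero: "poly g' y = 0" if g: "poly_rel g g'" "poly g x = 0" for g g'
  proof -
    obtain q q' r r' where qr: "poly_rel q q'" "poly_rel r r'" "g = q * p + r" "g' = q' * p' + r'"
      "\<forall>i\<ge>degree p. coeff r i = 0"
      using poly_rel_division[OF p(1,2) g(1)] by blast
    have "poly r x = 0" using g(2) p(3) by (simp add: qr(3))
    then have "r = 0" using minimal[OF qr(2)] qr(5) by blast
    then have "r' = 0" using qr(2) graph_zero by (auto simp: poly_rel_def poly_eq_iff)
    then show ?thesis using p(4) by (simp add: qr(4))
  qed
  have "hom_graph \<Gamma>'"
    unfolding hom_graph_def
  proof (intro conjI allI impI ballI)
    fix a b assume "(a, b) \<in> \<Gamma>'"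
    then obtain g g' where "poly_rel g g'" "a = poly g x" by (auto simp: \<Gamma>'_def)
    then show "algebraic a" using x graph_algebraic by (auto simp: poly_rel_def intro!: algebraic_poly)
  next
    fix q :: complex assume "q \<in> \<rat>"
    then show "(q, q) \<in> \<Gamma>'" by (intro sub graph_Rats)
  next
    fix a b a' b' assume "(a, b) \<in> \<Gamma>'" "(a', b') \<in> \<Gamma>'"
    then obtain g g' h h' where gh: "poly_rel g g'" "poly_rel h h'"
      "a = poly g x" "b = poly g' y" "a' = poly h x" "b' = poly h' y" by (auto simp: \<Gamma>'_def)
    show "(a + a', b + b') \<in> \<Gamma>'"
      using gh poly_rel_add[OF gh(1,2)] unfolding \<Gamma>'_def
      by (intro CollectI exI[of _ "g + h"] exI[of _ "g' + h'"]) auto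
    show "(a * a', b * b') \<in> \<Gamma>'"
      using gh poly_rel_mult[OF gh(1,2)] unfolding \<Gamma>'_def
      by (intro CollectI exI[of _ "g * h"] exI[of _ "g' * h'"]) auto
  next
    fix b assume "(0, b) \<in> \<Gamma>'"
    then obtain g g' where "poly_rel g g'" "poly g x = 0" "b = poly g' y" by (auto simp: \<Gamma>'_def)
    then show "b = 0" using zero by simp
  qed
  then show ?thesis using sub xy by auto
qed

text \<open>
  Every root of the image of the minimal polynomial of \<open>x\<close> can serve as image of \<open>x\<close>, and the complex
  numbers contain one.
\<close>

lemma hom_graph_extend:
  assumes x: "algebraic x"
  shows "\<exists>\<Gamma>' y. hom_graph \<Gamma>' \<and> \<Gamma> \<subseteq> \<Gamma>' \<and> (x, y) \<in> \<Gamma>'"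
proof -
  define P where "P = (\<lambda>p. p \<noteq> 0 \<and> poly p x = 0 \<and> (\<exists>p'. poly_rel p p'))"
  obtain p1 where "\<forall>i. coeff p1 i \<in> \<rat>" "p1 \<noteq> 0" "poly p1 x = 0"
    using x unfolding algebraic_altdef by auto
  then have "P p1" unfolding P_def using poly_rel_Rats by blast
  then obtain p0 where p0: "P p0" and min: "\<And>q. P q \<Longrightarrow> degree p0 \<le> degree q"
    using ex_has_least_nat[of P p1 degree] by blast
  obtain p0' where p0': "poly_rel p0 p0'" using p0 by (auto simp: P_def)
  define c c' where "c = inverse (lead_coeff p0)" and "c' = inverse (coeff p0' (degree p0))"
  have "c \<noteq> 0" using p0 by (simp add: c_def P_def)
  have cc': "(c, c') \<in> \<Gamma>"
    unfolding c_def c'_def by (rule graph_inverse(2)) (use p0' p0 in \<open>auto simp: poly_rel_def P_def\<close>)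
  define p p' where "p = smult c p0" and "p' = smult c' p0'"
  have rel: "poly_rel p p'" using p0' cc' by (auto simp: p_def p'_def poly_rel_def intro: graph_mult)
  have deg: "degree p = degree p0" using \<open>c \<noteq> 0\<close> by (simp add: p_def)
  have monic: "monic p" using p0 \<open>c \<noteq> 0\<close> by (simp add: p_def c_def P_def)
  have root: "poly p x = 0" using p0 by (simp add: p_def P_def)
  have "degree p \<noteq> 0"
  proof
    assume "degree p = 0"
    then have "p = 1" using monic by (metis monic_degree_0)
    then show False using root by simp
  qed
  moreover have "coeff p' (degree p) = 1"
    using rel monic graph_unique graph_Rats[of 1] unfolding poly_rel_def by (metis Rats_1)
  then have "degree p \<le> degree p'" by (intro le_degree) simp
  ultimately obtain y where y: "poly p' y = 0"
    using alg_closed_imp_poly_has_root[of p'] by auto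
  have "r = 0" if r: "poly_rel r r'" "poly r x = 0" "\<forall>i\<ge>degree p. coeff r i = 0" for r r'
  proof (rule ccontr)
    assume "r \<noteq> 0"
    then have "P r" using r by (auto simp: P_def)
    then have "degree p \<le> degree r" using min deg by simp
    then show False using r(3) \<open>r \<noteq> 0\<close> by auto
  qed
  then show ?thesis using adjoin_root[OF rel monic root y x] by blast
qed

end

lemma hom_graph_total:
  assumes \<Gamma>: "hom_graph \<Gamma>"
  obtains M where "hom_graph M" "\<Gamma> \<subseteq> M" "\<And>x. algebraic x \<Longrightarrow> \<exists>y. (x, y) \<in> M"
proof -
  define \<A> where "\<A> = {\<Delta>. hom_graph \<Delta> \<and> \<Gamma> \<subseteq> \<Delta>}"
  have "\<exists>M\<in>\<A>. \<forall>X\<in>\<A>. M \<subseteq> X \<longrightarrow> X = M"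
  proof (rule subset_Zorn_nonempty)
    show "\<A> \<noteq> {}" using \<Gamma> by (auto simp: \<A>_def)
    fix C assume C: "C \<noteq> {}" "subset.chain \<A> C"
    have sub: "\<And>\<Delta>. \<Delta> \<in> C \<Longrightarrow> hom_graph \<Delta> \<and> \<Gamma> \<subseteq> \<Delta>" using C(2) by (auto simp: subset.chain_def \<A>_def)
    have "hom_graph (\<Union>C)"
      unfolding hom_graph_def
    proof (intro conjI allI impI ballI)
      show "algebraic x" if "(x, y) \<in> \<Union>C" for x y
        using that sub graph_algebraic by blast
      show "(q, q) \<in> \<Union>C" if "q \<in> \<rat>" for q
        using that sub C(1) graph_Rats by blast
      show "y = 0" if "(0, y) \<in> \<Union>C" for y
        using that sub graph_zero by blast
      fix x y x' y' assume "(x, y) \<in> \<Union>C" "(x', y') \<in> \<Union>C"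
      then obtain \<Delta> \<Delta>' where \<Delta>: "\<Delta> \<in> C" "\<Delta>' \<in> C" "(x, y) \<in> \<Delta>" "(x', y') \<in> \<Delta>'" by blast
      have "\<Delta> \<subseteq> \<Delta>' \<or> \<Delta>' \<subseteq> \<Delta>" using C(2) \<Delta> by (auto simp: subset.chain_def)
      then obtain \<Delta>'' where "\<Delta>'' \<in> C" "(x, y) \<in> \<Delta>''" "(x', y') \<in> \<Delta>''" using \<Delta> by blast
      then show "(x + x', y + y') \<in> \<Union>C" "(x * x', y * y') \<in> \<Union>C"
        using sub graph_add[of \<Delta>''] graph_mult[of \<Delta>''] by blast+
    qed
    then show "\<Union>C \<in> \<A>" using sub C(1) by (auto simp: \<A>_def)
  qed
  then obtain M where M: "hom_graph M" "\<Gamma> \<subseteq> M" and max: "\<And>X. hom_graph X \<Longrightarrow> M \<subseteq> X \<Longrightarrow> X = M"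
    by (auto simp: \<A>_def)
  have "\<exists>y. (x, y) \<in> M" if "algebraic x" for x
    using hom_graph_extend[OF M(1) that] max by blast
  then show ?thesis using that M by blast
qed

lemma poly_Rats_hom:
  fixes \<sigma> :: "complex \<Rightarrow> complex"
  assumes "\<And>x. x \<in> \<rat> \<Longrightarrow> \<sigma> x = x"
    "\<And>x y. algebraic x \<Longrightarrow> algebraic y \<Longrightarrow> \<sigma> (x + y) = \<sigma> x + \<sigma> y \<and> \<sigma> (x * y) = \<sigma> x * \<sigma> y"
    "\<And>i. coeff p i \<in> \<rat>" "algebraic x"
  shows "\<sigma> (poly p x) = poly p (\<sigma> x)"
  using assms(3)
proof (induction p)
  case (pCons a p)
  have c: "coeff p i \<in> \<rat>" for i using pCons.prems[of "Suc i"] by simp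
  have "algebraic (poly p x)" by (rule algebraic_poly[OF algebraic_Rats[OF c] assms(4)])
  moreover have "a \<in> \<rat>" using pCons.prems[of 0] by simp
  ultimately show ?case
    using assms(1,2,4) pCons.IH[OF c] by (simp add: algebraic_Rats algebraic_mult)
qed (use assms(1) in auto)

lemma abs_galois_if_total:
  assumes M: "hom_graph M" and total: "\<And>x. algebraic x \<Longrightarrow> \<exists>y. (x, y) \<in> M"
  obtains \<sigma> where "\<sigma> \<in> abs_galois" "\<And>x y. (x, y) \<in> M \<Longrightarrow> \<sigma> x = y"
proof -
  obtain \<sigma> where in_M: "\<And>x. algebraic x \<Longrightarrow> (x, \<sigma> x) \<in> M" using total by metis
  have eq: "\<sigma> x = y" if "(x, y) \<in> M" for x y
    using graph_unique[OF M in_M that] graph_algebraic[OF M that] by simp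
  have rat: "\<sigma> x = x" if "x \<in> \<rat>" for x using graph_Rats[OF M that] eq by simp
  have hom: "\<sigma> (x + y) = \<sigma> x + \<sigma> y \<and> \<sigma> (x * y) = \<sigma> x * \<sigma> y" if "algebraic x" "algebraic y" for x y
    using graph_add[OF M in_M in_M] graph_mult[OF M in_M in_M] that eq by simp
  have inj: "inj_on \<sigma> {x. algebraic x}"
  proof (rule inj_onI)
    fix x y assume xy: "x \<in> {x. algebraic x}" "y \<in> {x. algebraic x}" "\<sigma> x = \<sigma> y"
    then have "(x - y, 0) \<in> M" using graph_diff[OF M in_M in_M, of x y] by simp
    then show "x = y" using graph_inverse(1)[OF M] by fastforce
  qed
  have surj: "\<sigma> ` {x. algebraic x} = {x. algebraic x}"
  proof (intro equalityI subsetI)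
    fix y assume "y \<in> \<sigma> ` {x. algebraic x}"
    then obtain x where x: "algebraic x" "y = \<sigma> x" by auto
    then obtain p where p: "\<forall>i. coeff p i \<in> \<rat>" "p \<noteq> 0" "poly p x = 0" unfolding algebraic_altdef by auto
    have "poly p y = \<sigma> (poly p x)" using x poly_Rats_hom[of \<sigma> p x] rat hom p by simp
    then show "y \<in> {x. algebraic x}" using p rat[of 0] unfolding algebraic_altdef by auto
  next
    fix y assume "y \<in> {x. algebraic (x::complex)}"
    then obtain p where p: "\<forall>i. coeff p i \<in> \<rat>" "p \<noteq> 0" "poly p y = 0" unfolding algebraic_altdef by auto
    \<comment> \<open>The automorphism permutes the finitely many roots of a rational polynomial.\<close>
    define R where "R = {x. poly p x = 0}"
    have R: "R \<subseteq> {x. algebraic x}" using p unfolding R_def algebraic_altdef by auto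
    have "\<sigma> ` R = R"
    proof (rule endo_inj_surj)
      show "finite R" using p by (simp add: R_def poly_roots_finite)
      show "inj_on \<sigma> R" using inj R by (rule inj_on_subset)
      show "\<sigma> ` R \<subseteq> R"
      proof
        fix z assume "z \<in> \<sigma> ` R"
        then obtain x where x: "x \<in> R" "z = \<sigma> x" by auto
        then have "poly p z = \<sigma> (poly p x)" using R poly_Rats_hom[of \<sigma> p x] rat hom p(1) by auto
        then show "z \<in> R" using x rat[of 0] by (simp add: R_def)
      qed
    qed
    then show "y \<in> \<sigma> ` {x. algebraic x}" using R p(3) by (auto simp: R_def)
  qed
  have "\<sigma> \<in> abs_galois"
    unfolding abs_galois_def using inj surj hom rat by (auto simp: bij_betw_def)
  then show ?thesis using that eq by blast
qed

section \<open>Conjugates and the minimal polynomial\<close>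

lemma is_min_int_poly_exists:
  assumes "algebraic x"
  shows "\<exists>p. is_min_int_poly x p"
proof -
  define V where "V = (\<lambda>q::int poly. q \<noteq> 0 \<and> poly (map_poly of_int q) x = 0)"
  obtain q1 where "V q1" using assms unfolding V_def by (rule algebraicE') auto
  then obtain q where q: "V q" and min: "\<And>r. V r \<Longrightarrow> degree q \<le> degree r"
    using ex_has_least_nat[of V q1 degree] by blast
  define p0 where "p0 = primitive_part q"
  define s where "s = sgn (lead_coeff p0)"
  define p where "p = smult s p0"
  have q0: "q = smult (content q) p0" by (simp add: p0_def)
  have "p0 \<noteq> 0" using q q0 by (auto simp: V_def)
  then have s: "s \<noteq> 0" "\<bar>s\<bar> = 1" by (auto simp: s_def abs_sgn_eq sgn_0_0)
  have "poly (map_poly of_int q) x = of_int (content q) * poly (map_poly of_int p0) x"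
    by (subst q0) (simp add: of_int_hom.map_poly_hom_smult)
  then have "poly (map_poly of_int p0) x = 0" using q by (auto simp: V_def)
  moreover have "content p = 1"
    using q s by (simp add: p_def p0_def content_smult V_def)
  moreover have "lead_coeff p = \<bar>lead_coeff p0\<bar>"
    by (simp add: p_def s_def abs_sgn[of "lead_coeff p0"] mult.commute)
  then have "lead_coeff p > 0" using \<open>p0 \<noteq> 0\<close> by simp
  moreover have "degree p = degree q" using s q by (simp add: p_def p0_def)
  ultimately have "is_min_int_poly x p"
    using min unfolding is_min_int_poly_def V_def by (auto simp: p_def of_int_hom.map_poly_hom_smult)
  then show ?thesis by blast
qed

text \<open>
  Two candidates have the same degree, so the combination that cancels their leading terms is zero by
  minimality; contents and signs then determine the factor between them.
\<close>

lemma is_min_int_poly_unique: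
  assumes p: "is_min_int_poly x p" and q: "is_min_int_poly x q"
  shows "p = q"
proof -
  have p0: "p \<noteq> 0" and q0: "q \<noteq> 0" using p q by (auto simp: is_min_int_poly_def)
  have deg: "degree p = degree q"
    using p q p0 q0 unfolding is_min_int_poly_def by (auto intro: order_antisym)
  define r where "r = smult (lead_coeff q) p - smult (lead_coeff p) q"
  have "poly (map_poly of_int r) x = 0"
    using p q by (simp add: r_def is_min_int_poly_def hom_distribs)
  then have "r \<noteq> 0 \<Longrightarrow> degree p \<le> degree r" using p by (auto simp: is_min_int_poly_def)
  moreover have "coeff r (degree p) = 0" using deg by (simp add: r_def)
  moreover have "degree r \<le> degree p"
    unfolding r_def using deg degree_smult_le[of "lead_coeff q" p] degree_smult_le[of "lead_coeff p" q]
    by (intro degree_diff_le) auto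
  ultimately have "r = 0" by (metis leading_coeff_0_iff order_antisym)
  then have eq: "smult (lead_coeff q) p = smult (lead_coeff p) q" by (simp add: r_def)
  then have "content (smult (lead_coeff q) p) = content (smult (lead_coeff p) q)" by simp
  then have "lead_coeff q = lead_coeff p"
    using p q by (simp add: content_smult is_min_int_poly_def)
  then have "smult (lead_coeff p) p = smult (lead_coeff p) q" using eq by simp
  then show ?thesis using p by (auto simp: is_min_int_poly_def poly_eq_iff)
qed

lemma min_int_poly:
  assumes "algebraic x"
  shows "is_min_int_poly x (min_int_poly x)"
  unfolding min_int_poly_def
  using is_min_int_poly_exists[OF assms] is_min_int_poly_unique by (metis theI)

lemma is_min_int_poly_rational:
  assumes p: "is_min_int_poly x p" and r: "\<And>i. coeff r i \<in> \<rat>" "poly r x = 0" "\<forall>i\<ge>degree p. coeff r i = 0"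
  shows "r = 0"
proof (rule ccontr)
  assume "r \<noteq> 0"
  obtain k :: int and q where q: "k \<noteq> 0" "map_poly of_int q = smult (of_int k) r"
    using clear_denominators[of r] r(1) by blast
  have "poly (map_poly of_int q) x = 0" using q r by simp
  moreover have "q \<noteq> 0" using q \<open>r \<noteq> 0\<close> by auto
  moreover have "degree q = degree r"
    using q by (metis degree_smult_eq of_int_eq_0_iff of_int_hom.degree_map_poly_hom)
  ultimately have "degree p \<le> degree r" using p by (auto simp: is_min_int_poly_def)
  then show False using r(3) \<open>r \<noteq> 0\<close> by auto
qed

context
  fixes \<sigma> assumes \<sigma>: "\<sigma> \<in> abs_galois"
begin

lemma galois_Rats: "x \<in> \<rat> \<Longrightarrow> \<sigma> x = x"
  and galois_add: "algebraic x \<Longrightarrow> algebraic y \<Longrightarrow> \<sigma> (x + y) = \<sigma> x + \<sigma> y"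
  and galois_mult: "algebraic x \<Longrightarrow> algebraic y \<Longrightarrow> \<sigma> (x * y) = \<sigma> x * \<sigma> y"
  and galois_bij: "bij_betw \<sigma> {x. algebraic x} {x. algebraic x}"
  using \<sigma> unfolding abs_galois_def by auto

lemma galois_algebraic: "algebraic x \<Longrightarrow> algebraic (\<sigma> x)"
  using galois_bij by (auto simp: bij_betw_def)

lemma galois_inj: "algebraic x \<Longrightarrow> algebraic y \<Longrightarrow> \<sigma> x = \<sigma> y \<longleftrightarrow> x = y"
  using galois_bij by (auto simp: bij_betw_def inj_on_def)

lemma galois_eq_0: "algebraic x \<Longrightarrow> \<sigma> x = 0 \<longleftrightarrow> x = 0"
  using galois_inj[of x 0] galois_Rats[of 0] by simp

lemma galois_inverse: "algebraic x \<Longrightarrow> \<sigma> (inverse x) = inverse (\<sigma> x)"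
proof (cases "x = 0")
  case False
  assume x: "algebraic x"
  have "\<sigma> x * \<sigma> (inverse x) = 1"
    using False x galois_mult[of x "inverse x"] galois_Rats[of 1] by (simp add: algebraic_inverse)
  then show ?thesis by (metis inverse_unique)
qed (use galois_Rats[of 0] in auto)

lemma galois_power: "algebraic x \<Longrightarrow> \<sigma> (x ^ n) = \<sigma> x ^ n"
  using galois_Rats[of 1] by (induction n) (auto simp: galois_mult algebraic_power)

lemma galois_powi: "algebraic x \<Longrightarrow> \<sigma> (x powi k) = \<sigma> x powi k"
  by (auto simp: power_int_def galois_power galois_inverse algebraic_power algebraic_inverse)

lemma galois_prod: "(\<And>i. i \<in> S \<Longrightarrow> algebraic (f i)) \<Longrightarrow> \<sigma> (\<Prod>i\<in>S. f i) = (\<Prod>i\<in>S. \<sigma> (f i))"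
  using galois_Rats[of 1]
  by (induction S rule: infinite_finite_induct) (auto simp: galois_mult algebraic_prod)

lemma galois_poly: "(\<And>i. coeff p i \<in> \<rat>) \<Longrightarrow> algebraic x \<Longrightarrow> \<sigma> (poly p x) = poly p (\<sigma> x)"
  by (rule poly_Rats_hom) (auto simp: galois_Rats galois_add galois_mult)

lemma galois_int_poly_root:
  "algebraic x \<Longrightarrow> poly (map_poly of_int q) (\<sigma> x) = 0 \<longleftrightarrow> poly (map_poly of_int q) x = 0"
  using galois_poly[of "map_poly of_int q" x] galois_eq_0[of "poly (map_poly of_int q) x"]
  by (simp add: coeff_map_poly algebraic_poly algebraic_Rats)

lemma is_min_int_poly_galois: "algebraic x \<Longrightarrow> is_min_int_poly (\<sigma> x) = is_min_int_poly x"
  by (rule ext) (simp add: is_min_int_poly_def galois_int_poly_root)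

lemma min_int_poly_galois: "algebraic x \<Longrightarrow> min_int_poly (\<sigma> x) = min_int_poly x"
  by (simp add: min_int_poly_def is_min_int_poly_galois)

end

lemma galois_comp:
  assumes \<sigma>: "\<sigma> \<in> abs_galois" and \<tau>: "\<tau> \<in> abs_galois"
  shows "\<sigma> \<circ> \<tau> \<in> abs_galois"
proof -
  have "bij_betw (\<sigma> \<circ> \<tau>) {x. algebraic x} {x. algebraic x}"
    using bij_betw_trans[OF galois_bij[OF \<tau>] galois_bij[OF \<sigma>]] .
  then show ?thesis
    unfolding abs_galois_def
    using \<sigma> \<tau> by (auto simp: galois_Rats galois_add galois_mult galois_algebraic)
qed

lemma galois_id: "(\<lambda>x. x) \<in> abs_galois"
  by (simp add: abs_galois_def bij_betw_def inj_on_def)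

definition conjugates :: "complex \<Rightarrow> complex set" where
  "conjugates x = {y. poly (map_poly of_int (min_int_poly x)) y = 0}"

text \<open>
  The identity on the rationals extends by \<open>x \<mapsto> y\<close>, because \<open>x\<close> and \<open>y\<close> are roots of the same irreducible
  polynomial, and then to all algebraic numbers.
\<close>

lemma galois_transitive:
  assumes x: "algebraic x" and y: "y \<in> conjugates x"
  obtains \<sigma> where "\<sigma> \<in> abs_galois" "\<sigma> x = y"
proof -
  define P where "P = min_int_poly x"
  have P: "is_min_int_poly x P" using min_int_poly[OF x] by (simp add: P_def)
  define \<Gamma> :: "(complex \<times> complex) set" where "\<Gamma> = {(q, q) | q. q \<in> \<rat>}"
  have \<Gamma>: "hom_graph \<Gamma>"
    by (auto simp: hom_graph_def \<Gamma>_def algebraic_Rats)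
  define p :: "complex poly" where "p = smult (1 / of_int (lead_coeff P)) (map_poly of_int P)"
  have "lead_coeff P > 0" using P by (simp add: is_min_int_poly_def)
  then have c: "complex_of_int (lead_coeff P) \<noteq> 0" by (metis less_irrefl of_int_eq_0_iff)
  then have deg: "degree p = degree P" by (simp add: p_def)
  have "\<exists>\<Gamma>'. hom_graph \<Gamma>' \<and> \<Gamma> \<subseteq> \<Gamma>' \<and> (x, y) \<in> \<Gamma>'"
  proof (rule adjoin_root[OF \<Gamma>])
    show "poly_rel \<Gamma> p p" by (intro poly_rel_Rats[OF \<Gamma>]) (simp add: p_def coeff_map_poly)
    show "monic p" using c by (simp add: deg) (simp add: p_def coeff_map_poly)
    show "poly p x = 0" using P by (simp add: p_def is_min_int_poly_def)
    show "poly p y = 0" using y by (simp add: p_def conjugates_def P_def)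
    show "algebraic x" by fact
    fix r r' assume r: "poly_rel \<Gamma> r r'" "poly r x = 0" "\<forall>i\<ge>degree p. coeff r i = 0"
    have "coeff r i \<in> \<rat>" for i
      using r(1) unfolding poly_rel_def[OF \<Gamma>] by (auto simp: \<Gamma>_def)
    then show "r = 0"
      using is_min_int_poly_rational[OF P] r(2,3) deg by metis
  qed
  then obtain \<Gamma>' where \<Gamma>': "hom_graph \<Gamma>'" "(x, y) \<in> \<Gamma>'" by auto
  obtain M where M: "hom_graph M" "\<Gamma>' \<subseteq> M" "\<And>z. algebraic z \<Longrightarrow> \<exists>w. (z, w) \<in> M"
    using hom_graph_total[OF \<Gamma>'(1)] by blast
  obtain \<sigma> where "\<sigma> \<in> abs_galois" "\<And>z w. (z, w) \<in> M \<Longrightarrow> \<sigma> z = w"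
    using abs_galois_if_total[OF M(1,3)] by blast
  then show ?thesis using that M(2) \<Gamma>'(2) by blast
qed

lemma galois_conjugates:
  assumes "algebraic x" "\<sigma> \<in> abs_galois"
  shows "\<sigma> x \<in> conjugates x"
  using galois_int_poly_root[OF assms(2,1)] min_int_poly[OF assms(1)]
  by (simp add: conjugates_def is_min_int_poly_def)

lemma conjugates_refl: "algebraic x \<Longrightarrow> x \<in> conjugates x"
  using galois_conjugates[OF _ galois_id] .

lemma min_int_poly_conjugate:
  "algebraic x \<Longrightarrow> y \<in> conjugates x \<Longrightarrow> algebraic y \<and> min_int_poly y = min_int_poly x"
  using galois_transitive min_int_poly_galois galois_algebraic by metis

context
  fixes x :: complex assumes x: "algebraic x"
begin

lemma min_int_poly_nonzero: "min_int_poly x \<noteq> 0"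
  and lead_coeff_min_int_poly: "lead_coeff (min_int_poly x) > 0"
  and content_min_int_poly: "content (min_int_poly x) = 1"
  using min_int_poly[OF x] by (auto simp: is_min_int_poly_def)

lemma finite_conjugates: "finite (conjugates x)"
  unfolding conjugates_def using min_int_poly_nonzero by (intro poly_roots_finite) simp

text \<open>
  A multiple root would be a root of the derivative, whose degree is smaller; but the minimal
  polynomial is minimal for each of its roots.
\<close>

lemma rsquarefree_min_int_poly: "rsquarefree (map_poly of_int (min_int_poly x) :: complex poly)"
  unfolding rsquarefree_roots
proof (intro allI notI)
  let ?p = "min_int_poly x"
  fix a :: complex
  assume a: "poly (map_poly of_int ?p) a = 0 \<and> poly (pderiv (map_poly of_int ?p)) a = 0"
  have "a \<in> conjugates x" using a by (simp add: conjugates_def)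
  then have *: "is_min_int_poly a ?p" using min_int_poly_conjugate[OF x] min_int_poly by metis
  have deg: "degree ?p \<noteq> 0"
  proof
    assume "degree ?p = 0"
    then obtain c where "?p = [:c:]" by (rule degree_eq_zeroE)
    then show False using a min_int_poly_nonzero by (auto simp: map_poly_pCons)
  qed
  then have "pderiv ?p \<noteq> 0" by (simp add: pderiv_eq_0_iff)
  moreover have "poly (map_poly of_int (pderiv ?p)) a = 0" using a by (simp add: of_int_hom.map_poly_pderiv)
  ultimately have "degree ?p \<le> degree (pderiv ?p)" using * by (auto simp: is_min_int_poly_def)
  then show False using deg by (simp add: degree_pderiv)
qed

lemma card_conjugates: "card (conjugates x) = alg_degree x"
  using rsquarefree_card_degree[of "map_poly of_int (min_int_poly x) :: complex poly"]
    rsquarefree_min_int_poly min_int_poly_nonzero by (simp add: conjugates_def alg_degree_def)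

lemma alg_degree_pos: "alg_degree x > 0"
  using conjugates_refl[OF x] finite_conjugates card_conjugates by (metis card_gt_0_iff empty_iff)

lemma min_int_poly_factorization:
  "map_poly of_int (min_int_poly x) =
     smult (of_int (lead_coeff (min_int_poly x))) (\<Prod>z\<in>conjugates x. [:- z, 1:])"
  using complex_poly_decompose_rsquarefree[OF rsquarefree_min_int_poly]
  by (simp add: conjugates_def coeff_map_poly)

lemma proots_min_int_poly: "proots (map_poly of_int (min_int_poly x)) = mset_set (conjugates x)"
proof (rule multiset_eqI)
  fix z
  let ?p = "map_poly of_int (min_int_poly x) :: complex poly"
  have "?p \<noteq> 0" using min_int_poly_nonzero by simp
  then show "count (proots ?p) z = count (mset_set (conjugates x)) z"
    using rsquarefree_min_int_poly finite_conjugates rsquarefree_root_order[of ?p z]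
    by (auto simp: count_mset_set' conjugates_def order_root)
qed

lemma weil_height_conjugates:
  "real (alg_degree x) * weil_height x =
     ln (of_int (lead_coeff (min_int_poly x))) + (\<Sum>z\<in>conjugates x. log_plus (cmod z))"
  using alg_degree_pos lead_coeff_min_int_poly
  by (simp add: weil_height_def proots_min_int_poly sum_unfold_sum_mset)

text \<open>
  A number that equals all its conjugates has a minimal polynomial with a single root; as the roots are
  simple, this polynomial is linear.
\<close>

lemma rational_if_galois_fixed:
  assumes "\<And>\<sigma>. \<sigma> \<in> abs_galois \<Longrightarrow> \<sigma> x = x"
  shows "x \<in> \<rat>"
proof -
  have "conjugates x = {x}"
    using assms galois_transitive[OF x] conjugates_refl[OF x] by blast
  then have "map_poly of_int (min_int_poly x) = smult (of_int (lead_coeff (min_int_poly x))) [:- x, 1:]"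
    using min_int_poly_factorization by simp
  then have "coeff (map_poly of_int (min_int_poly x)) 0 = - of_int (lead_coeff (min_int_poly x)) * x"
    by simp
  then have "x = - (of_int (coeff (min_int_poly x) 0) / of_int (lead_coeff (min_int_poly x)))"
    using lead_coeff_min_int_poly min_int_poly_nonzero by (simp add: coeff_map_poly field_simps)
  then show ?thesis by (metis Rats_divide Rats_minus_iff Rats_of_int)
qed

end

lemma integer_if_galois_fixed:
  assumes "algebraic_int x" "\<And>\<sigma>. \<sigma> \<in> abs_galois \<Longrightarrow> \<sigma> x = x"
  shows "x \<in> \<int>"
  using assms by (intro rational_algebraic_int_is_int rational_if_galois_fixed) auto

lemma galois_permutes_conjugates:
  assumes "algebraic x" "\<sigma> \<in> abs_galois"
  shows "bij_betw \<sigma> (conjugates x) (conjugates x)"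
proof -
  have alg: "algebraic y" if "y \<in> conjugates x" for y
    using min_int_poly_conjugate[OF assms(1) that] by simp
  have inj: "inj_on \<sigma> (conjugates x)"
    by (rule inj_onI) (use galois_inj[OF assms(2)] alg in blast)
  have "\<sigma> ` conjugates x \<subseteq> conjugates x"
    using alg galois_int_poly_root[OF assms(2)] by (auto simp: conjugates_def)
  then show ?thesis
    using inj endo_inj_surj[OF finite_conjugates[OF assms(1)]] by (simp add: bij_betw_def)
qed

section \<open>The discriminant bound\<close>

text \<open>
  A criterion for the integrality of the elementary symmetric functions, each of which is a sum of the
  products in the hypothesis. The set \<open>K\<close> of factors already chosen makes the induction work.
\<close>

lemma algebraic_int_elementary:
  fixes X :: "'i \<Rightarrow> complex"
  assumes "finite S" "finite K" "K \<inter> S = {}"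
    and "\<And>I. K \<subseteq> I \<Longrightarrow> I \<subseteq> K \<union> S \<Longrightarrow> algebraic_int (d * (\<Prod>s\<in>I. X s))"
  shows "algebraic_int (coeff (smult (d * (\<Prod>s\<in>K. X s)) (\<Prod>s\<in>S. [:- X s, 1:])) i)"
  using assms
proof (induction S arbitrary: K i rule: finite_induct)
  case empty
  then show ?case by (auto simp: coeff_pCons one_pCons split: nat.splits)
next
  case (insert s S)
  let ?f = "\<lambda>K. smult (d * (\<Prod>s\<in>K. X s)) (\<Prod>s\<in>S. [:- X s, 1:])"
  have IH1: "algebraic_int (coeff (?f K) i)" for i
    using insert.prems insert.hyps by (intro insert.IH) auto
  have IH2: "algebraic_int (coeff (?f (insert s K)) i)" for i
    using insert.prems insert.hyps by (intro insert.IH) auto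
  have eq: "smult (d * (\<Prod>s\<in>K. X s)) (\<Prod>s\<in>insert s S. [:- X s, 1:]) =
      pCons 0 (?f K) + - ?f (insert s K)"
    using insert.prems insert.hyps by (simp add: mult_ac smult_diff_right)
  have "algebraic_int (coeff (pCons 0 (?f K)) i)"
    using IH1 by (cases i) auto
  moreover have "algebraic_int (coeff (- ?f (insert s K)) i)"
    using IH2[of i] by (simp only: coeff_minus algebraic_int_minus)
  ultimately show ?case
    unfolding eq coeff_add by (rule algebraic_int_add)
qed

lemma poly_eq_sum_lessThan:
  fixes p :: "'a :: comm_ring_1 poly"
  assumes "degree p < n"
  shows "poly p x = (\<Sum>i<n. coeff p i * x ^ i)"
  unfolding poly_altdef
  by (rule sum.mono_neutral_left) (use assms in \<open>auto simp: coeff_eq_0\<close>)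

context
  fixes x :: complex assumes x: "algebraic x"
begin

lemma algebraic_int_lead_times_conjugates:
  assumes "I \<subseteq> conjugates x"
  shows "algebraic_int (of_int (lead_coeff (min_int_poly x)) * \<Prod>I)"
proof -
  have "algebraic_int (coeff (smult (of_int (lead_coeff (min_int_poly x))) (\<Prod>z\<in>conjugates x. [:- z, 1:])) i)" for i
    unfolding min_int_poly_factorization[OF x, symmetric] by (simp add: coeff_map_poly)
  then show ?thesis
    using algebraic_int_lead_times_roots[OF finite_conjugates[OF x] assms, where X = "\<lambda>z. z"] by simp
qed

text \<open>
  Expanding the product gives integral multiples of products of powers of conjugates in which no
  exponent reaches the degree; collecting for each \<open>r\<close> the conjugates whose exponent exceeds \<open>r\<close>, one
  power of the leading coefficient per \<open>r\<close> makes the monomial integral.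
\<close>

lemma norm_integral:
  assumes q: "degree q < alg_degree x"
  shows "of_int (lead_coeff (min_int_poly x)) ^ (alg_degree x - 1) *
    (\<Prod>z\<in>conjugates x. poly (map_poly of_int q) z) \<in> (\<int> :: complex set)"
proof -
  define T where "T = conjugates x"
  define D where "D = alg_degree x"
  define c :: complex where "c = of_int (lead_coeff (min_int_poly x))"
  define N where "N = c ^ (D - 1) * (\<Prod>z\<in>T. poly (map_poly of_int q) z)"
  have T: "finite T" by (simp add: T_def finite_conjugates[OF x])
  have algT: "algebraic z" if "z \<in> T" for z
    using min_int_poly_conjugate[OF x] that unfolding T_def by blast
  have mono: "algebraic_int (c ^ (D - 1) * (\<Prod>z\<in>T. z ^ e z))" if e: "\<And>z. z \<in> T \<Longrightarrow> e z < D" for e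
  proof -
    have "z ^ e z = (\<Prod>r<D - 1. if r < e z then z else 1)" if "z \<in> T" for z
    proof -
      have "{r\<in>{..<D - 1}. r < e z} = {..<e z}" using e[OF that] by auto
      then show ?thesis
        using prod.inter_filter[of "{..<D - 1}" "\<lambda>_. z" "\<lambda>r. r < e z"] by simp
    qed
    then have "(\<Prod>z\<in>T. z ^ e z) = (\<Prod>z\<in>T. \<Prod>r<D - 1. if r < e z then z else 1)"
      by (intro prod.cong) auto
    also have "\<dots> = (\<Prod>r<D - 1. \<Prod>z\<in>T. if r < e z then z else 1)"
      by (rule prod.swap)
    also have "\<dots> = (\<Prod>r<D - 1. \<Prod>{z\<in>T. r < e z})"
      using T by (simp add: prod.inter_filter)
    finally have "c ^ (D - 1) * (\<Prod>z\<in>T. z ^ e z) = (\<Prod>r<D - 1. c * \<Prod>{z\<in>T. r < e z})"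
      by (simp add: prod.distrib)
    then show ?thesis
      unfolding c_def by (auto simp: T_def intro!: algebraic_int_prod algebraic_int_lead_times_conjugates)
  qed
  have "(\<Prod>z\<in>T. poly (map_poly of_int q) z) = (\<Prod>z\<in>T. \<Sum>k<D. of_int (coeff q k) * z ^ k)"
    using q by (subst poly_eq_sum_lessThan[of _ D]) (auto simp: D_def coeff_map_poly)
  also have "\<dots> = (\<Sum>e\<in>PiE T (\<lambda>_. {..<D}). \<Prod>z\<in>T. of_int (coeff q (e z)) * z ^ e z)"
    using T by (simp add: prod_sum_PiE)
  finally have "N = (\<Sum>e\<in>PiE T (\<lambda>_. {..<D}). (\<Prod>z\<in>T. of_int (coeff q (e z))) * (c ^ (D - 1) * (\<Prod>z\<in>T. z ^ e z)))"
    by (simp add: N_def sum_distrib_left prod.distrib mult_ac)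
  moreover have "algebraic_int ((\<Prod>z\<in>T. of_int (coeff q (e z))) * (c ^ (D - 1) * (\<Prod>z\<in>T. z ^ e z)))"
    if "e \<in> PiE T (\<lambda>_. {..<D})" for e
    using that by (intro algebraic_int_mult[OF algebraic_int_prod mono]) auto
  ultimately have "algebraic_int N" by (simp add: algebraic_int_sum)
  moreover have "\<sigma> N = N" if \<sigma>: "\<sigma> \<in> abs_galois" for \<sigma>
  proof -
    have c: "c \<in> \<rat>" by (simp add: c_def)
    have alg: "algebraic (poly (map_poly of_int q) z)" if "z \<in> T" for z
      by (rule algebraic_poly) (use algT[OF that] in \<open>auto simp: coeff_map_poly\<close>)
    have "\<sigma> N = c ^ (D - 1) * \<sigma> (\<Prod>z\<in>T. poly (map_poly of_int q) z)"
      unfolding N_def using c alg galois_mult[OF \<sigma>] galois_Rats[OF \<sigma>]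
      by (simp add: algebraic_Rats algebraic_prod)
    also have "\<sigma> (\<Prod>z\<in>T. poly (map_poly of_int q) z) = (\<Prod>z\<in>T. \<sigma> (poly (map_poly of_int q) z))"
      by (rule galois_prod[OF \<sigma>]) (use alg in auto)
    also have "\<dots> = (\<Prod>z\<in>T. poly (map_poly of_int q) (\<sigma> z))"
      using algT by (intro prod.cong galois_poly[OF \<sigma>]) (auto simp: coeff_map_poly)
    also have "\<dots> = (\<Prod>z\<in>T. poly (map_poly of_int q) z)"
      unfolding T_def by (rule prod.reindex_bij_betw[OF galois_permutes_conjugates[OF x \<sigma>]])
    finally show ?thesis by (simp add: N_def)
  qed
  ultimately have "N \<in> \<int>" by (rule integer_if_galois_fixed)
  then show ?thesis by (simp add: N_def T_def c_def D_def)
qed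

text \<open>
  The product of the values of the derivative of the minimal polynomial at the conjugates is, after
  multiplication by a power of the leading coefficient, an integer; it is nonzero since the roots are
  simple. The exponent \<open>2 D - 1\<close> is one more than in the discriminant itself.
\<close>

lemma discriminant_ge_1:
  defines "c \<equiv> real_of_int (lead_coeff (min_int_poly x))"
  shows "1 \<le> c ^ (2 * alg_degree x - 1) * (\<Prod>z\<in>conjugates x. \<Prod>w\<in>conjugates x - {z}. cmod (z - w))"
proof -
  define T where "T = conjugates x"
  define P where "P = min_int_poly x"
  define D where "D = alg_degree x"
  have T: "finite T" by (simp add: T_def finite_conjugates[OF x])
  have D: "D > 0" "card T = D" by (simp_all add: D_def T_def alg_degree_pos[OF x] card_conjugates[OF x])
  have c: "c > 0" using lead_coeff_min_int_poly[OF x] by (simp add: c_def)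
  have deriv: "poly (map_poly of_int (pderiv P)) z = of_real c * (\<Prod>w\<in>T - {z}. z - w)" if "z \<in> T" for z
  proof -
    have "poly (map_poly of_int (pderiv P)) z = poly (pderiv (smult (of_real c) (\<Prod>w\<in>T. [:- w, 1:]))) z"
      using min_int_poly_factorization[OF x]
      by (simp add: P_def T_def c_def of_int_hom.map_poly_pderiv)
    also have "pderiv (smult (of_real c) (\<Prod>w\<in>T. [:- w, 1:])) =
        smult (of_real c) (\<Sum>v\<in>T. \<Prod>w\<in>T - {v}. [:- w, 1:])"
      by (simp add: pderiv_smult pderiv_prod pderiv_pCons)
    also have "poly \<dots> z = of_real c * (\<Sum>v\<in>T. \<Prod>w\<in>T - {v}. z - w)"
      by (simp add: poly_sum poly_prod)
    also have "(\<Sum>v\<in>T. \<Prod>w\<in>T - {v}. z - w) = (\<Prod>w\<in>T - {z}. z - w) + (\<Sum>v\<in>T - {z}. \<Prod>w\<in>T - {v}. z - w)"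
      using T that by (simp add: sum.remove)
    also have "(\<Sum>v\<in>T - {z}. \<Prod>w\<in>T - {v}. z - w) = 0"
      using T that by (intro sum.neutral ballI prod_zero) auto
    finally show ?thesis by simp
  qed
  define N where "N = of_int (lead_coeff P) ^ (D - 1) * (\<Prod>z\<in>T. poly (map_poly of_int (pderiv P)) z)"
  have N: "N = of_real c ^ (D - 1) * (\<Prod>z\<in>T. of_real c * (\<Prod>w\<in>T - {z}. z - w))"
    unfolding N_def using deriv by (simp add: c_def P_def)
  have "degree (pderiv P) < alg_degree x"
    using D by (simp add: P_def D_def alg_degree_def degree_pderiv)
  then have "N \<in> \<int>" using norm_integral by (simp add: N_def P_def D_def T_def)
  then obtain k where k: "N = of_int k" by (rule Ints_cases)
  have "N \<noteq> 0" unfolding N using c T by simp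
  then have "k \<noteq> 0" using k by auto
  then have "1 \<le> cmod N" using k by (simp add: of_int_leD)
  also have "cmod N = c ^ (D - 1) * (\<Prod>z\<in>T. c * (\<Prod>w\<in>T - {z}. cmod (z - w)))"
    unfolding N using c by (simp add: norm_mult norm_power prod_norm[symmetric])
  also have "\<dots> = c ^ (2 * D - 1) * (\<Prod>z\<in>T. \<Prod>w\<in>T - {z}. cmod (z - w))"
    using D by (simp add: prod.distrib power_add[symmetric] mult_2 flip: mult.assoc)
  finally show ?thesis by (simp add: T_def D_def)
qed

text \<open>
  The constant coefficient of the minimal polynomial is a nonzero integer. This is the part of the product
  formula that bounds the conjugates inside the unit disc by the leading coefficient.
\<close>

lemma sum_ln_conjugates:
  assumes "x \<noteq> 0"
  shows "0 \<le> ln (of_int (lead_coeff (min_int_poly x))) + (\<Sum>z\<in>conjugates x. ln (cmod z))"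
    and "0 \<notin> conjugates x"
proof -
  define T where "T = conjugates x"
  define c where "c = real_of_int (lead_coeff (min_int_poly x))"
  have T: "finite T" by (simp add: T_def finite_conjugates[OF x])
  have c: "c > 0" using lead_coeff_min_int_poly[OF x] by (simp add: c_def)
  show 0: "0 \<notin> conjugates x"
  proof
    assume "0 \<in> conjugates x"
    then obtain \<sigma> where "\<sigma> \<in> abs_galois" "\<sigma> x = 0" using galois_transitive[OF x] by blast
    then show False using galois_eq_0 x assms by blast
  qed
  have "coeff (map_poly of_int (min_int_poly x)) 0 = of_real c * (\<Prod>z\<in>T. - z)"
    by (subst min_int_poly_factorization[OF x])
      (simp add: poly_0_coeff_0[symmetric] poly_prod T_def c_def)
  then have eq: "of_int (coeff (min_int_poly x) 0) = of_real c * (\<Prod>z\<in>T. - z)"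
    by (simp add: coeff_map_poly)
  have "of_real c * (\<Prod>z\<in>T. - z) \<noteq> 0" using c 0 T by (auto simp: T_def)
  then have "coeff (min_int_poly x) 0 \<noteq> 0" using eq by auto
  then have "1 \<le> cmod (of_int (coeff (min_int_poly x) 0))" by (simp add: of_int_leD)
  then have "1 \<le> c * (\<Prod>z\<in>T. cmod z)" unfolding eq using c by (simp add: norm_mult prod_norm[symmetric])
  then have "0 \<le> ln (c * (\<Prod>z\<in>T. cmod z))" by simp
  also have "\<dots> = ln c + (\<Sum>z\<in>T. ln (cmod z))"
  proof -
    have pos: "0 < cmod z" if "z \<in> T" for z using 0 that by (auto simp: T_def)
    have "ln (\<Prod>z\<in>T. cmod z) = (\<Sum>z\<in>T. ln (cmod z))"
      by (rule ln_prod) (use pos T in auto)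
    moreover have "ln (c * (\<Prod>z\<in>T. cmod z)) = ln c + ln (\<Prod>z\<in>T. cmod z)"
      using c prod_pos[of T cmod] pos by (simp add: ln_mult_pos)
    ultimately show ?thesis by simp
  qed
  finally show "0 \<le> ln (of_int (lead_coeff (min_int_poly x))) + (\<Sum>z\<in>conjugates x. ln (cmod z))"
    by (simp add: T_def c_def)
qed

lemma weil_height_nonneg: "weil_height x \<ge> 0"
proof -
  have "0 \<le> ln (real_of_int (lead_coeff (min_int_poly x)))"
    using lead_coeff_min_int_poly[OF x] by simp
  moreover have "0 \<le> (\<Sum>z\<in>conjugates x. log_plus (cmod z))"
    by (intro sum_nonneg) (simp add: log_plus_def)
  ultimately have "0 \<le> real (alg_degree x) * weil_height x"
    unfolding weil_height_conjugates[OF x] by simp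
  then show ?thesis using alg_degree_pos[OF x] by (simp add: zero_le_mult_iff)
qed

lemma sum_abs_ln_conjugates:
  assumes "x \<noteq> 0"
  shows "(\<Sum>z\<in>conjugates x. \<bar>ln (cmod z)\<bar>) \<le> 2 * real (alg_degree x) * weil_height x"
proof -
  have "\<bar>ln (cmod z)\<bar> = 2 * log_plus (cmod z) - ln (cmod z)" if "z \<in> conjugates x" for z
    using that sum_ln_conjugates(2)[OF assms] by (auto simp: log_plus_def)
  then have "(\<Sum>z\<in>conjugates x. \<bar>ln (cmod z)\<bar>) =
      2 * (\<Sum>z\<in>conjugates x. log_plus (cmod z)) - (\<Sum>z\<in>conjugates x. ln (cmod z))"
    by (simp add: sum_subtractf sum_distrib_left)
  also have "\<dots> \<le> 2 * (ln (of_int (lead_coeff (min_int_poly x))) + (\<Sum>z\<in>conjugates x. log_plus (cmod z)))"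
    using sum_ln_conjugates(1)[OF assms] lead_coeff_min_int_poly[OF x] by (smt (verit) ln_ge_zero of_int_1_le_iff int_one_le_iff_zero_less)
  finally show ?thesis unfolding weil_height_conjugates[OF x, symmetric] by simp
qed

end

section \<open>Galois orbits in the torus\<close>

definition galois_act :: "(complex \<Rightarrow> complex) \<Rightarrow> complex ^ 'n \<Rightarrow> complex ^ 'n" where
  "galois_act \<sigma> \<alpha> = (\<chi> j. \<sigma> (\<alpha> $ j))"

lemma log_plus_inverse: "x > 0 \<Longrightarrow> log_plus (inverse x) = log_plus x - ln x"
  by (auto simp: log_plus_def ln_inverse)

lemma log_plus_mult_le: "x > 0 \<Longrightarrow> y > 0 \<Longrightarrow> log_plus (x * y) \<le> log_plus x + log_plus y"
  by (auto simp: log_plus_def ln_mult)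

lemma log_plus_prod_le:
  "(\<And>i. i \<in> S \<Longrightarrow> f i > 0) \<Longrightarrow> log_plus (prod f S) \<le> (\<Sum>i\<in>S. log_plus (f i))"
proof (induction S rule: infinite_finite_induct)
  case (insert i S)
  then have "log_plus (f i * prod f S) \<le> log_plus (f i) + log_plus (prod f S)"
    by (intro log_plus_mult_le prod_pos) auto
  then show ?case using insert by fastforce
qed (auto simp: log_plus_def)

lemma log_plus_power: "x > 0 \<Longrightarrow> log_plus (x ^ n) = real n * log_plus x"
  by (auto simp: log_plus_def ln_realpow max_def zero_le_mult_iff mult_le_0_iff)

lemma content_power: "content (p ^ n) = content (p :: int poly) ^ n"
  by (induction n) (auto simp: content_mult)

context
  fixes \<xi> :: "complex ^ 'n"
  assumes alg: "\<And>j. algebraic (\<xi> $ j)"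
begin

lemma orbit_algebraic: "\<alpha> \<in> galois_orbit \<xi> \<Longrightarrow> algebraic (\<alpha> $ j)"
  using alg galois_algebraic by (auto simp: galois_orbit_def)

lemma orbit_refl: "\<xi> \<in> galois_orbit \<xi>"
  unfolding galois_orbit_def using galois_id by (intro image_eqI[of _ _ "\<lambda>x. x"]) auto

lemma finite_orbit: "finite (galois_orbit \<xi>)"
proof (rule finite_subset)
  show "galois_orbit \<xi> \<subseteq> (\<lambda>f. \<chi> j. f j) ` (PiE UNIV (\<lambda>j. conjugates (\<xi> $ j)))"
    using galois_conjugates[OF alg] by (fastforce simp: galois_orbit_def)
  show "finite ((\<lambda>f. \<chi> j. f j) ` (PiE UNIV (\<lambda>j. conjugates (\<xi> $ j))) :: (complex ^ 'n) set)"
    using finite_conjugates[OF alg] by (intro finite_imageI finite_PiE) auto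
qed

lemma galois_act_orbit:
  assumes "\<sigma> \<in> abs_galois" "\<alpha> \<in> galois_orbit \<xi>"
  shows "galois_act \<sigma> \<alpha> \<in> galois_orbit \<xi>"
proof -
  obtain \<tau> where \<tau>: "\<tau> \<in> abs_galois" "\<alpha> = (\<chi> j. \<tau> (\<xi> $ j))"
    using assms(2) by (auto simp: galois_orbit_def)
  show ?thesis
    unfolding galois_orbit_def
    by (rule image_eqI[OF _ galois_comp[OF assms(1) \<tau>(1)]]) (simp add: galois_act_def \<tau>(2))
qed

lemma inj_on_galois_act:
  assumes "\<sigma> \<in> abs_galois"
  shows "inj_on (galois_act \<sigma>) (galois_orbit \<xi>)"
proof (rule inj_onI)
  fix \<alpha> \<beta> assume \<alpha>\<beta>: "\<alpha> \<in> galois_orbit \<xi>" "\<beta> \<in> galois_orbit \<xi>" "galois_act \<sigma> \<alpha> = galois_act \<sigma> \<beta>"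
  have "\<sigma> (\<alpha> $ j) = \<sigma> (\<beta> $ j)" for j
    using arg_cong[OF \<alpha>\<beta>(3), of "\<lambda>v. v $ j"] by (simp add: galois_act_def)
  then have "\<alpha> $ j = \<beta> $ j" for j
    using galois_inj[OF assms orbit_algebraic orbit_algebraic] \<alpha>\<beta>(1,2) by blast
  then show "\<alpha> = \<beta>" by (simp add: Finite_Cartesian_Product.vec_eq_iff)
qed

context
  fixes X :: "complex ^ 'n \<Rightarrow> complex"
  assumes X_alg: "\<And>\<alpha>. \<alpha> \<in> galois_orbit \<xi> \<Longrightarrow> algebraic (X \<alpha>)"
    and X_act: "\<And>\<sigma> \<alpha>. \<sigma> \<in> abs_galois \<Longrightarrow> \<alpha> \<in> galois_orbit \<xi> \<Longrightarrow> X (galois_act \<sigma> \<alpha>) = \<sigma> (X \<alpha>)"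
begin

lemma orbit_image: "X ` galois_orbit \<xi> = conjugates (X \<xi>)"
proof (intro equalityI subsetI)
  fix z assume "z \<in> X ` galois_orbit \<xi>"
  then obtain \<tau> where \<tau>: "\<tau> \<in> abs_galois" "z = X (galois_act \<tau> \<xi>)"
    by (auto simp: galois_orbit_def galois_act_def)
  then show "z \<in> conjugates (X \<xi>)"
    using X_act[OF \<tau>(1) orbit_refl] galois_conjugates[OF X_alg[OF orbit_refl]] by simp
next
  fix z assume "z \<in> conjugates (X \<xi>)"
  then obtain \<sigma> where \<sigma>: "\<sigma> \<in> abs_galois" "\<sigma> (X \<xi>) = z"
    using galois_transitive[OF X_alg[OF orbit_refl]] by blast
  then show "z \<in> X ` galois_orbit \<xi>"
    using X_act[OF \<sigma>(1) orbit_refl] galois_act_orbit[OF \<sigma>(1) orbit_refl] by (metis image_eqI)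
qed

definition fibre_card :: nat where
  "fibre_card = card (galois_orbit \<xi>) div alg_degree (X \<xi>)"

text \<open>
  The automorphisms act injectively on the orbit and move any fibre of the equivariant map \<open>X\<close> into any
  other, so the fibres have the same size.
\<close>

lemma fibre_card:
  shows "card (galois_orbit \<xi>) = fibre_card * alg_degree (X \<xi>)"
    and "z \<in> conjugates (X \<xi>) \<Longrightarrow> card {\<alpha>\<in>galois_orbit \<xi>. X \<alpha> = z} = fibre_card"
    and "fibre_card > 0"
proof -
  define fib where "fib = (\<lambda>z. {\<alpha>\<in>galois_orbit \<xi>. X \<alpha> = z})"
  have fin: "finite (fib z)" for z by (simp add: fib_def finite_orbit)
  note algX = X_alg[OF orbit_refl]
  have le: "card (fib z) \<le> card (fib w)" if zw: "z \<in> conjugates (X \<xi>)" "w \<in> conjugates (X \<xi>)" for z w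
  proof -
    have "w \<in> conjugates z" "algebraic z"
      using zw min_int_poly_conjugate[OF algX zw(1)] by (auto simp: conjugates_def)
    then obtain \<sigma> where \<sigma>: "\<sigma> \<in> abs_galois" "\<sigma> z = w" using galois_transitive by blast
    show ?thesis
    proof (rule card_inj_on_le)
      show "inj_on (galois_act \<sigma>) (fib z)"
        by (rule inj_on_subset[OF inj_on_galois_act[OF \<sigma>(1)]]) (auto simp: fib_def)
      show "galois_act \<sigma> ` fib z \<subseteq> fib w"
        using \<sigma> X_act galois_act_orbit by (auto simp: fib_def)
    qed (rule fin)
  qed
  have eq: "card (fib z) = card (fib (X \<xi>))" if "z \<in> conjugates (X \<xi>)" for z
    using le that conjugates_refl[OF algX] by (metis order_antisym)
  have "card (galois_orbit \<xi>) = (\<Sum>z\<in>conjugates (X \<xi>). card (fib z))"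
    using sum.group[OF finite_orbit finite_conjugates[OF algX], of X "\<lambda>_. 1::nat"] orbit_image
    by (simp add: fib_def)
  also have "\<dots> = card (fib (X \<xi>)) * alg_degree (X \<xi>)"
    using eq card_conjugates[OF algX] by simp
  finally have card: "card (galois_orbit \<xi>) = card (fib (X \<xi>)) * alg_degree (X \<xi>)" .
  then have m: "fibre_card = card (fib (X \<xi>))"
    using alg_degree_pos[OF algX] by (simp add: fibre_card_def)
  show "card (galois_orbit \<xi>) = fibre_card * alg_degree (X \<xi>)" using card m by simp
  show "z \<in> conjugates (X \<xi>) \<Longrightarrow> card {\<alpha>\<in>galois_orbit \<xi>. X \<alpha> = z} = fibre_card"
    using eq m by (simp add: fib_def)
  have "\<xi> \<in> fib (X \<xi>)" using orbit_refl by (simp add: fib_def)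
  then show "fibre_card > 0" unfolding m using fin card_gt_0_iff by blast
qed

lemma sum_orbit:
  fixes g :: "complex \<Rightarrow> 'a :: comm_semiring_1"
  shows "(\<Sum>\<alpha>\<in>galois_orbit \<xi>. g (X \<alpha>)) = of_nat fibre_card * (\<Sum>z\<in>conjugates (X \<xi>). g z)"
proof -
  have "(\<Sum>\<alpha>\<in>galois_orbit \<xi>. g (X \<alpha>)) =
      (\<Sum>z\<in>conjugates (X \<xi>). \<Sum>\<alpha>\<in>{\<alpha>\<in>galois_orbit \<xi>. X \<alpha> = z}. g (X \<alpha>))"
    by (rule sum.group[symmetric]) (auto simp: finite_orbit finite_conjugates X_alg orbit_refl simp flip: orbit_image)
  also have "\<dots> = (\<Sum>z\<in>conjugates (X \<xi>). of_nat fibre_card * g z)"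
  proof (rule sum.cong)
    fix z assume "z \<in> conjugates (X \<xi>)"
    then have "of_nat (card {\<alpha>\<in>galois_orbit \<xi>. X \<alpha> = z}) * g z = of_nat fibre_card * g z"
      by (simp only: fibre_card(2))
    then show "(\<Sum>\<alpha>\<in>{\<alpha>\<in>galois_orbit \<xi>. X \<alpha> = z}. g (X \<alpha>)) = of_nat fibre_card * g z"
      by simp
  qed simp
  finally show ?thesis by (simp add: sum_distrib_left)
qed

lemma prod_orbit:
  fixes g :: "complex \<Rightarrow> 'a :: comm_semiring_1"
  shows "(\<Prod>\<alpha>\<in>galois_orbit \<xi>. g (X \<alpha>)) = (\<Prod>z\<in>conjugates (X \<xi>). g z) ^ fibre_card"
proof -
  have "(\<Prod>\<alpha>\<in>galois_orbit \<xi>. g (X \<alpha>)) =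
      (\<Prod>z\<in>conjugates (X \<xi>). \<Prod>\<alpha>\<in>{\<alpha>\<in>galois_orbit \<xi>. X \<alpha> = z}. g (X \<alpha>))"
    by (rule prod.group[symmetric]) (auto simp: finite_orbit finite_conjugates X_alg orbit_refl simp flip: orbit_image)
  also have "\<dots> = (\<Prod>z\<in>conjugates (X \<xi>). g z ^ fibre_card)"
    by (rule prod.cong) (auto simp: fibre_card(2))
  finally show ?thesis by (simp add: prod_power_distrib)
qed

lemma orbit_poly:
  defines "P \<equiv> min_int_poly (X \<xi>)"
  shows "map_poly of_int (P ^ fibre_card) =
    smult (of_int (lead_coeff P ^ fibre_card)) (\<Prod>\<alpha>\<in>galois_orbit \<xi>. [:- X \<alpha>, 1:])"
proof -
  have "(\<Prod>\<alpha>\<in>galois_orbit \<xi>. [:- X \<alpha>, 1:]) = (\<Prod>z\<in>conjugates (X \<xi>). [:- z, 1:]) ^ fibre_card"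
    by (rule prod_orbit)
  moreover have "map_poly of_int (P ^ fibre_card) = (map_poly of_int P :: complex poly) ^ fibre_card"
    by (rule of_int_poly_hom.hom_power)
  ultimately show ?thesis
    using min_int_poly_factorization[OF X_alg[OF orbit_refl]] by (simp add: P_def smult_power)
qed

lemma orbit_height:
  "real (card (galois_orbit \<xi>)) * weil_height (X \<xi>) =
     real fibre_card * ln (of_int (lead_coeff (min_int_poly (X \<xi>)))) +
     (\<Sum>\<alpha>\<in>galois_orbit \<xi>. log_plus (cmod (X \<alpha>)))"
proof -
  have "real (card (galois_orbit \<xi>)) * weil_height (X \<xi>) =
      real fibre_card * (real (alg_degree (X \<xi>)) * weil_height (X \<xi>))"
    using fibre_card(1) by simp
  then show ?thesis
    unfolding weil_height_conjugates[OF X_alg[OF orbit_refl]]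
    by (simp add: sum_orbit[of "\<lambda>z. log_plus (cmod z)"] distrib_left)
qed

text \<open>
  By Gauss's lemma the powers of the minimal polynomial are primitive, so among the integer
  polynomials with the orbit as root multiset they have the smallest leading coefficient.
\<close>

lemma lead_coeff_power_le:
  fixes d :: complex
  assumes d: "d \<noteq> 0" and int: "\<And>I. I \<subseteq> galois_orbit \<xi> \<Longrightarrow> algebraic_int (d * (\<Prod>\<alpha>\<in>I. X \<alpha>))"
    and "d \<in> \<int>"
  shows "of_int (lead_coeff (min_int_poly (X \<xi>))) ^ fibre_card \<le> cmod d"
proof -
  define P where "P = min_int_poly (X \<xi>)"
  define C where "C = lead_coeff P ^ fibre_card"
  define R0 where "R0 = smult d (\<Prod>\<alpha>\<in>galois_orbit \<xi>. [:- X \<alpha>, 1:])"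
  note algX = X_alg[OF orbit_refl]
  have "lead_coeff P > 0" using lead_coeff_min_int_poly[OF algX] by (simp add: P_def)
  then have C: "C > 0" by (simp add: C_def)
  obtain d' where d': "d = of_int d'" using assms(3) by (rule Ints_cases)
  have R0: "smult (of_int C) R0 = smult d (map_poly of_int (P ^ fibre_card))"
    unfolding R0_def P_def orbit_poly C_def by (simp add: mult.commute)
  have "coeff R0 i \<in> \<int>" for i
  proof (rule rational_algebraic_int_is_int)
    show "algebraic_int (coeff R0 i)"
      using algebraic_int_elementary[OF finite_orbit, of "{}" d X i] int unfolding R0_def by simp
    have "of_int C * coeff R0 i = d * of_int (coeff (P ^ fibre_card) i)"
      using arg_cong[OF R0, of "\<lambda>p. coeff p i"] by (simp add: coeff_map_poly)
    then have "coeff R0 i = of_int (d' * coeff (P ^ fibre_card) i) / of_int C"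
      using C d' by (simp add: field_simps)
    then show "coeff R0 i \<in> \<rat>" by (metis Rats_divide Rats_of_int)
  qed
  then obtain R where R: "R0 = map_poly of_int R" by (rule intpolyE)
  have "map_poly of_int (smult C R) = (map_poly of_int (smult d' (P ^ fibre_card)) :: complex poly)"
    using R0 R d' by (simp add: of_int_hom.map_poly_hom_smult)
  then have "smult C R = smult d' (P ^ fibre_card)" by (metis of_int_poly_hom.injectivity)
  then have "content (smult C R) = content (smult d' (P ^ fibre_card))" by simp
  then have "C * content R = \<bar>d'\<bar>"
    using C content_min_int_poly[OF algX] by (simp add: content_smult content_power P_def)
  moreover have "d' \<noteq> 0" using d d' by simp
  ultimately have "C \<le> \<bar>d'\<bar>"
    using dvd_imp_le_int[of "\<bar>d'\<bar>" C] C by (metis abs_eq_0 abs_idempotent abs_of_pos dvd_triv_left)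
  then have "real_of_int C \<le> real_of_int \<bar>d'\<bar>" by (rule of_int_le_iff[THEN iffD2])
  then show ?thesis by (simp add: d' C_def P_def)
qed

end

end

section \<open>Heights of characters\<close>

lemma log_plus_powi:
  assumes "a > 0"
  shows "log_plus (a powi k) = real_of_int \<bar>k\<bar> * (log_plus a - (if k < 0 then ln a else 0))"
proof (cases "k < 0")
  case True
  then have "log_plus (a powi k) = log_plus (inverse a ^ nat \<bar>k\<bar>)" by (simp add: power_int_def)
  then show ?thesis using True assms by (simp add: log_plus_power log_plus_inverse)
next
  case False
  then have "log_plus (a powi k) = log_plus (a ^ nat \<bar>k\<bar>)" by (simp add: power_int_def)
  then show ?thesis using False assms by (simp add: log_plus_power)
qed

lemma coordinate_galois_act: "galois_act \<sigma> \<alpha> $ j = \<sigma> (\<alpha> $ j)"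
  by (simp add: galois_act_def)

context
  fixes \<xi> :: "complex ^ 'n"
  assumes alg: "\<And>j. algebraic (\<xi> $ j)" and nz: "\<And>j. \<xi> $ j \<noteq> 0"
begin

lemma orbit_nonzero: "\<alpha> \<in> galois_orbit \<xi> \<Longrightarrow> \<alpha> $ j \<noteq> 0"
  using alg nz galois_eq_0 by (auto simp: galois_orbit_def)

lemma character_algebraic: "\<alpha> \<in> galois_orbit \<xi> \<Longrightarrow> algebraic (character n \<alpha>)"
  by (auto simp: character_def intro!: algebraic_prod algebraic_powi orbit_algebraic[OF alg])

lemma character_galois_act:
  assumes "\<sigma> \<in> abs_galois" "\<alpha> \<in> galois_orbit \<xi>"
  shows "character n (galois_act \<sigma> \<alpha>) = \<sigma> (character n \<alpha>)"
  using orbit_algebraic[OF alg assms(2)]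
  by (simp add: character_def galois_act_def galois_prod[OF assms(1)] galois_powi[OF assms(1)] algebraic_powi)

lemma character_nonzero: "\<alpha> \<in> galois_orbit \<xi> \<Longrightarrow> character n \<alpha> \<noteq> 0"
  using orbit_nonzero by (simp add: character_def)

lemma orbit_abs_ln_le:
  "(\<Sum>\<alpha>\<in>galois_orbit \<xi>. \<bar>ln (cmod (\<alpha> $ j))\<bar>) \<le> 2 * real (card (galois_orbit \<xi>)) * weil_height (\<xi> $ j)"
proof -
  note coord = orbit_algebraic[OF alg, where j = j] coordinate_galois_act[where j = j]
  let ?m = "fibre_card \<xi> (\<lambda>\<alpha>. \<alpha> $ j)"
  have "(\<Sum>\<alpha>\<in>galois_orbit \<xi>. \<bar>ln (cmod (\<alpha> $ j))\<bar>) = real ?m * (\<Sum>z\<in>conjugates (\<xi> $ j). \<bar>ln (cmod z)\<bar>)"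
    by (rule sum_orbit[where X = "\<lambda>\<alpha>. \<alpha> $ j", OF alg coord])
  also have "\<dots> \<le> real ?m * (2 * real (alg_degree (\<xi> $ j)) * weil_height (\<xi> $ j))"
    by (intro mult_left_mono sum_abs_ln_conjugates alg nz) auto
  also have "\<dots> = 2 * real (card (galois_orbit \<xi>)) * weil_height (\<xi> $ j)"
    using fibre_card(1)[where X = "\<lambda>\<alpha>. \<alpha> $ j", OF alg coord] by simp
  finally show ?thesis .
qed

text \<open>
  A denominator of the character over the whole orbit is assembled from the leading coefficients of
  the coordinates' orbit polynomials, and from their constant terms where the exponent is negative.
\<close>

lemma weil_height_character:
  "weil_height (character n \<xi>) \<le> (\<Sum>j\<in>UNIV. real_of_int \<bar>n $ j\<bar> * weil_height (\<xi> $ j))"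
proof -
  define S where "S = galois_orbit \<xi>"
  define X where "X = (character n :: complex ^ 'n \<Rightarrow> complex)"
  define m where "m = (\<lambda>j. fibre_card \<xi> (\<lambda>\<alpha>. \<alpha> $ j))"
  define A where "A = (\<lambda>j. real_of_int (lead_coeff (min_int_poly (\<xi> $ j)) ^ m j))"
  have S: "finite S" "S \<noteq> {}" using finite_orbit[OF alg] orbit_refl[OF alg] by (auto simp: S_def)
  note coord = orbit_algebraic[OF alg] coordinate_galois_act
  note char = character_algebraic character_galois_act
  have A: "A j > 0" for j using lead_coeff_min_int_poly[OF alg] by (simp add: A_def)
  have A_poly: "map_poly of_int (min_int_poly (\<xi> $ j) ^ m j) = smult (of_real (A j)) (\<Prod>\<alpha>\<in>S. [:- (\<alpha> $ j), 1:])" for j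
    using orbit_poly[where X = "\<lambda>\<alpha>. \<alpha> $ j", OF alg coord] by (simp add: A_def S_def m_def)
  have A_int: "algebraic_int (of_real (A j) * (\<Prod>\<alpha>\<in>I. \<alpha> $ j))" if "I \<subseteq> S" for I j
    using S(1) that
  proof (rule algebraic_int_lead_times_roots)
    show "algebraic_int (coeff (smult (of_real (A j)) (\<Prod>\<alpha>\<in>S. [:- (\<alpha> $ j), 1:])) i)" for i
      unfolding A_poly[symmetric] by (simp add: coeff_map_poly)
  qed
  have B_int: "of_real (A j) * (\<Prod>\<alpha>\<in>S. \<alpha> $ j) \<in> (\<int> :: complex set)" for j
  proof -
    have "of_int (coeff (min_int_poly (\<xi> $ j) ^ m j) 0) = of_real (A j) * (\<Prod>\<alpha>\<in>S. - (\<alpha> $ j))"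
      using arg_cong[OF A_poly, of "\<lambda>p. coeff p 0"]
      by (simp add: coeff_map_poly poly_0_coeff_0[symmetric] poly_prod)
    also have "\<dots> = (-1) ^ card S * (of_real (A j) * (\<Prod>\<alpha>\<in>S. \<alpha> $ j))"
      by (simp add: prod_uminus)
    finally have "(-1) ^ card S * of_int (coeff (min_int_poly (\<xi> $ j) ^ m j) 0) =
        ((-1) ^ card S * (-1) ^ card S) * (of_real (A j) * (\<Prod>\<alpha>\<in>S. \<alpha> $ j))"
      by (simp only: mult.assoc)
    also have "(-1) ^ card S * (-1) ^ card S = (1 :: complex)" by (simp flip: power_mult_distrib)
    finally have "of_real (A j) * (\<Prod>\<alpha>\<in>S. \<alpha> $ j) = (-1) ^ card S * of_int (coeff (min_int_poly (\<xi> $ j) ^ m j) 0)"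
      by simp
    then show ?thesis by (simp only: Ints_mult Ints_power Ints_minus Ints_1 Ints_of_int)
  qed
  define d where "d = (\<lambda>j. if n $ j \<ge> 0 then of_real (A j) ^ nat \<bar>n $ j\<bar>
      else (of_real (A j) * (\<Prod>\<alpha>\<in>S. \<alpha> $ j)) ^ nat \<bar>n $ j\<bar> :: complex)"
  define dd where "dd = (\<Prod>j\<in>UNIV. d j)"
  have prod_nz: "(\<Prod>\<alpha>\<in>S. \<alpha> $ j) \<noteq> 0" for j using S orbit_nonzero by (simp add: S_def)
  have d_nz: "d j \<noteq> 0" for j using A[of j] prod_nz by (simp add: d_def)
  have d_int: "d j \<in> \<int>" for j
    using B_int by (auto simp: d_def A_def intro!: Ints_power)
  have d_alg: "algebraic_int (d j * (\<Prod>\<alpha>\<in>I. (\<alpha> $ j) powi (n $ j)))" if I: "I \<subseteq> S" for I j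
  proof (cases "n $ j \<ge> 0")
    case True
    then have "d j * (\<Prod>\<alpha>\<in>I. (\<alpha> $ j) powi (n $ j)) = (of_real (A j) * (\<Prod>\<alpha>\<in>I. \<alpha> $ j)) ^ nat \<bar>n $ j\<bar>"
      by (simp add: d_def power_int_def power_mult_distrib prod_power_distrib)
    then show ?thesis using algebraic_int_power[OF A_int[OF I]] by simp
  next
    case False
    have "(\<Prod>\<alpha>\<in>S. \<alpha> $ j) = (\<Prod>\<alpha>\<in>S - I. \<alpha> $ j) * (\<Prod>\<alpha>\<in>I. \<alpha> $ j)"
      using S I by (simp add: prod.subset_diff)
    moreover have "(\<Prod>\<alpha>\<in>I. \<alpha> $ j) \<noteq> 0"
      using I S orbit_nonzero finite_subset[OF I] by (auto simp: S_def)
    moreover have inv: "(\<Prod>\<alpha>\<in>I. (\<alpha> $ j) powi (n $ j)) = inverse (\<Prod>\<alpha>\<in>I. \<alpha> $ j) ^ nat \<bar>n $ j\<bar>"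
      using False by (simp add: power_int_def prod_power_distrib prod_inversef[unfolded comp_def, symmetric])
    ultimately have "d j * (\<Prod>\<alpha>\<in>I. (\<alpha> $ j) powi (n $ j)) = (of_real (A j) * (\<Prod>\<alpha>\<in>S - I. \<alpha> $ j)) ^ nat \<bar>n $ j\<bar>"
      using False unfolding d_def inv by (simp add: field_simps flip: power_mult_distrib)
    then show ?thesis using algebraic_int_power[OF A_int[of "S - I" j]] by simp
  qed
  have dd_alg: "algebraic_int (dd * (\<Prod>\<alpha>\<in>I. X \<alpha>))" if "I \<subseteq> S" for I
  proof -
    have "dd * (\<Prod>\<alpha>\<in>I. X \<alpha>) = (\<Prod>j\<in>UNIV. d j * (\<Prod>\<alpha>\<in>I. (\<alpha> $ j) powi (n $ j)))"
      unfolding dd_def X_def character_def by (subst prod.swap) (simp add: prod.distrib)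
    then show ?thesis using d_alg[OF that] by (simp add: algebraic_int_prod)
  qed
  have le: "of_int (lead_coeff (min_int_poly (X \<xi>))) ^ fibre_card \<xi> X \<le> cmod dd"
    unfolding X_def
  proof (rule lead_coeff_power_le[OF alg char])
    show "dd \<noteq> 0" "dd \<in> \<int>" using d_nz d_int by (auto simp: dd_def intro: Ints_prod)
    show "algebraic_int (dd * (\<Prod>\<alpha>\<in>I. character n \<alpha>))" if "I \<subseteq> galois_orbit \<xi>" for I
      using dd_alg that by (simp add: X_def S_def)
  qed
  have lead_pos: "0 < lead_coeff (min_int_poly (X \<xi>))"
    unfolding X_def by (intro lead_coeff_min_int_poly char orbit_refl alg)
  have "real (card S) * weil_height (X \<xi>) =
      ln (of_int (lead_coeff (min_int_poly (X \<xi>))) ^ fibre_card \<xi> X) + (\<Sum>\<alpha>\<in>S. log_plus (cmod (X \<alpha>)))"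
    using orbit_height[where X = "character n", OF alg char] lead_pos by (simp add: X_def S_def ln_realpow)
  also have "\<dots> \<le> ln (cmod dd) + (\<Sum>\<alpha>\<in>S. log_plus (cmod (X \<alpha>)))"
    using le lead_pos by (intro add_right_mono ln_mono) auto
  also have "ln (cmod dd) = (\<Sum>j\<in>UNIV. ln (cmod (d j)))"
    unfolding dd_def prod_norm[symmetric] by (rule ln_prod) (use d_nz in auto)
  also have "(\<Sum>\<alpha>\<in>S. log_plus (cmod (X \<alpha>))) \<le> (\<Sum>\<alpha>\<in>S. \<Sum>j\<in>UNIV. log_plus (cmod (\<alpha> $ j) powi (n $ j)))"
  proof (rule sum_mono)
    fix \<alpha> assume "\<alpha> \<in> S"
    then have "cmod (X \<alpha>) = (\<Prod>j\<in>UNIV. cmod (\<alpha> $ j) powi (n $ j))"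
      by (simp add: X_def character_def prod_norm[symmetric] norm_power_int)
    then show "log_plus (cmod (X \<alpha>)) \<le> (\<Sum>j\<in>UNIV. log_plus (cmod (\<alpha> $ j) powi (n $ j)))"
      using orbit_nonzero \<open>\<alpha> \<in> S\<close> by (auto simp: S_def intro!: log_plus_prod_le)
  qed
  also have "\<dots> = (\<Sum>j\<in>UNIV. \<Sum>\<alpha>\<in>S. log_plus (cmod (\<alpha> $ j) powi (n $ j)))" by (rule sum.swap)
  also have "(\<Sum>j\<in>UNIV. ln (cmod (d j))) + (\<Sum>j\<in>UNIV. \<Sum>\<alpha>\<in>S. log_plus (cmod (\<alpha> $ j) powi (n $ j))) =
      (\<Sum>j\<in>UNIV. ln (cmod (d j)) + (\<Sum>\<alpha>\<in>S. log_plus (cmod (\<alpha> $ j) powi (n $ j))))"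
    by (simp add: sum.distrib)
  also have "\<dots> = (\<Sum>j\<in>UNIV. real_of_int \<bar>n $ j\<bar> * (real (card S) * weil_height (\<xi> $ j)))"
  proof (rule sum.cong[OF refl])
    fix j
    have pos: "cmod (\<alpha> $ j) > 0" if "\<alpha> \<in> S" for \<alpha> using orbit_nonzero that by (simp add: S_def)
    have h: "real (card S) * weil_height (\<xi> $ j) = ln (A j) + (\<Sum>\<alpha>\<in>S. log_plus (cmod (\<alpha> $ j)))"
      using orbit_height[where X = "\<lambda>\<alpha>. \<alpha> $ j", OF alg coord] lead_coeff_min_int_poly[OF alg, of j]
      by (simp add: A_def S_def m_def ln_realpow)
    have "ln (cmod (d j)) = real_of_int \<bar>n $ j\<bar> * (ln (A j) + (if n $ j < 0 then \<Sum>\<alpha>\<in>S. ln (cmod (\<alpha> $ j)) else 0))"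
    proof -
      have "ln (\<Prod>\<alpha>\<in>S. cmod (\<alpha> $ j)) = (\<Sum>\<alpha>\<in>S. ln (cmod (\<alpha> $ j)))"
        by (rule ln_prod) (use S pos in auto)
      moreover have "(\<Prod>\<alpha>\<in>S. cmod (\<alpha> $ j)) > 0" using pos by (rule prod_pos)
      ultimately show ?thesis
        using A[of j] by (auto simp: d_def norm_power norm_mult ln_realpow ln_mult_pos prod_norm[symmetric])
    qed
    moreover have "(\<Sum>\<alpha>\<in>S. log_plus (cmod (\<alpha> $ j) powi (n $ j))) =
        real_of_int \<bar>n $ j\<bar> * ((\<Sum>\<alpha>\<in>S. log_plus (cmod (\<alpha> $ j))) - (if n $ j < 0 then \<Sum>\<alpha>\<in>S. ln (cmod (\<alpha> $ j)) else 0))"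
      using pos by (simp add: log_plus_powi sum_distrib_left[symmetric] sum_subtractf)
    ultimately show "ln (cmod (d j)) + (\<Sum>\<alpha>\<in>S. log_plus (cmod (\<alpha> $ j) powi (n $ j))) =
        real_of_int \<bar>n $ j\<bar> * (real (card S) * weil_height (\<xi> $ j))"
      unfolding h by (simp add: algebra_simps)
  qed
  also have "\<dots> = real (card S) * (\<Sum>j\<in>UNIV. real_of_int \<bar>n $ j\<bar> * weil_height (\<xi> $ j))"
    by (simp add: sum_distrib_left mult_ac)
  finally have "real (card S) * weil_height (X \<xi>) \<le> \<dots>" by simp
  moreover have "card S > 0" using S by (simp add: card_gt_0_iff)
  ultimately show ?thesis by (simp add: X_def)
qed

lemma height_nonneg: "height \<xi> \<ge> 0"
  by (simp add: height_def sum_nonneg weil_height_nonneg alg)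

lemma weil_height_character_l1norm: "weil_height (character n \<xi>) \<le> real (l1norm n) * height \<xi>"
proof -
  have "weil_height (character n \<xi>) \<le> (\<Sum>j\<in>UNIV. real_of_int \<bar>n $ j\<bar> * weil_height (\<xi> $ j))"
    by (rule weil_height_character)
  also have "\<dots> \<le> (\<Sum>j\<in>UNIV. real_of_int \<bar>n $ j\<bar> * height \<xi>)"
    by (intro sum_mono mult_left_mono)
      (auto simp: height_def intro!: member_le_sum weil_height_nonneg alg)
  also have "\<dots> = real (l1norm n) * height \<xi>"
    by (simp add: l1norm_def sum_distrib_right)
  finally show ?thesis .
qed

end

section \<open>Angular equidistribution by an energy argument\<close>

text \<open>
  The reflection keeps arguments, differs from \<open>z / \<bar>z\<bar>\<close> by at most \<open>\<bar>ln \<bar>z\<bar>\<bar>\<close>, and moves all points to the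
  closed disc, where the kernel of the energy argument is of positive type.
\<close>

definition disc_reflect :: "complex \<Rightarrow> complex" where
  "disc_reflect z = (if cmod z \<le> 1 then z else inverse (cnj z))"

lemma cmod_disc_reflect_le: "cmod (disc_reflect z) \<le> 1"
  by (auto simp: disc_reflect_def norm_inverse inverse_le_1_iff)

lemma cmod_one_minus_mult_cnj:
  "(cmod (1 - z * cnj w))\<^sup>2 = (cmod (z - w))\<^sup>2 + (1 - (cmod z)\<^sup>2) * (1 - (cmod w)\<^sup>2)"
  unfolding cmod_power2 by (simp add: algebra_simps power2_eq_square)

text \<open>
  For points on different sides of the circle both sides agree. For points on the same side the
  inequality comes from \<open>cmod_one_minus_mult_cnj\<close>, in which the last product is then nonnegative.
\<close>

lemma cmod_diff_le_disc_reflect: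
  "cmod (z - w) \<le> max 1 (cmod z) * max 1 (cmod w) * cmod (1 - disc_reflect z * cnj (disc_reflect w))"
proof -
  have le: "cmod (z - w) \<le> cmod (1 - z * cnj w)" if "0 \<le> (1 - (cmod z)\<^sup>2) * (1 - (cmod w)\<^sup>2)"
  proof (rule power2_le_imp_le)
    show "(cmod (z - w))\<^sup>2 \<le> (cmod (1 - z * cnj w))\<^sup>2"
      using cmod_one_minus_mult_cnj[of z w] that by linarith
  qed simp
  consider "cmod z \<le> 1" "cmod w \<le> 1" | "cmod z \<le> 1" "cmod w > 1" | "cmod z > 1" "cmod w \<le> 1" | "cmod z > 1" "cmod w > 1"
    by linarith
  then show ?thesis
  proof cases
    case 1
    then have "0 \<le> (1 - (cmod z)\<^sup>2) * (1 - (cmod w)\<^sup>2)" by (simp add: power_le_one)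
    then show ?thesis using le 1 by (simp add: disc_reflect_def max_def)
  next
    case 2
    then have "w \<noteq> 0" by auto
    then have "w * (1 - z * inverse w) = w - z" by (simp add: field_simps)
    then have "cmod w * cmod (1 - z * inverse w) = cmod (w - z)"
      by (metis norm_mult)
    then show ?thesis using 2 by (simp add: disc_reflect_def max_def norm_minus_commute)
  next
    case 3
    then have "z \<noteq> 0" by auto
    then have "cnj z * (1 - inverse (cnj z) * cnj w) = cnj z - cnj w" by (simp add: field_simps)
    then have "cmod z * cmod (1 - inverse (cnj z) * cnj w) = cmod (cnj z - cnj w)"
      by (metis norm_mult complex_mod_cnj)
    also have "\<dots> = cmod (z - w)" by (simp flip: complex_cnj_diff)
    finally show ?thesis using 3 by (simp add: disc_reflect_def max_def)
  next
    case 4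
    then have nz: "z \<noteq> 0" "w \<noteq> 0" by auto
    have "1 \<le> (cmod z)\<^sup>2" "1 \<le> (cmod w)\<^sup>2" using 4 by (simp_all add: one_le_power)
    then have "0 \<le> (1 - (cmod z)\<^sup>2) * (1 - (cmod w)\<^sup>2)" by (simp add: mult_nonpos_nonpos)
    then have "cmod (z - w) \<le> cmod (1 - z * cnj w)" by (rule le)
    also have "\<dots> = cmod (cnj (1 - z * cnj w))" by (simp only: complex_mod_cnj)
    also have "cnj (1 - z * cnj w) = cnj z * w * (inverse (cnj z) * inverse w - 1)"
      using nz by (simp add: field_simps)
    also have "cmod \<dots> = cmod z * cmod w * cmod (1 - inverse (cnj z) * inverse w)"
      by (simp add: norm_mult norm_minus_commute)
    finally show ?thesis using 4 by (simp add: disc_reflect_def max_def)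
  qed
qed

text \<open>Shrinking \<open>z\<close> to \<open>r z\<close> makes the logarithmic kernel smooth at a cost independent of \<open>z\<close>.\<close>

lemma cmod_one_minus_shrink:
  assumes "cmod z \<le> 1" "0 < r" "r < 1"
  shows "(1 + r) * cmod (1 - z) \<le> 2 * cmod (1 - of_real r * z)"
proof (rule power2_le_imp_le)
  define \<rho> where "\<rho> = (cmod z)\<^sup>2"
  have \<rho>: "0 \<le> \<rho>" "\<rho> \<le> 1" using assms by (simp_all add: \<rho>_def power_le_one)
  have x: "- 1 - \<rho> \<le> 2 * Re z"
  proof -
    have "0 \<le> (1 + Re z)\<^sup>2 + (Im z)\<^sup>2" by simp
    then show ?thesis unfolding \<rho>_def cmod_power2 by (simp add: power2_eq_square algebra_simps)
  qed
  have "(1 - r)\<^sup>2 * (- 1 - \<rho>) \<le> (1 - r)\<^sup>2 * (2 * Re z)"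
    using x by (intro mult_left_mono) auto
  moreover have "0 \<le> (1 - r) * (2 + 2 * r) * (1 - \<rho>)" using assms \<rho> by simp
  moreover have "(2 * cmod (1 - of_real r * z))\<^sup>2 - ((1 + r) * cmod (1 - z))\<^sup>2 =
      (1 - r) * (3 + r) + (1 - r)\<^sup>2 * (2 * Re z) - (1 - r) * (3 * r + 1) * \<rho>"
    unfolding power_mult_distrib cmod_power2 \<rho>_def by (simp add: power2_eq_square algebra_simps)
  moreover have "(1 - r) * (3 + r) + (1 - r)\<^sup>2 * (- 1 - \<rho>) - (1 - r) * (3 * r + 1) * \<rho> =
      (1 - r) * (2 + 2 * r) * (1 - \<rho>)"
    by (simp add: power2_eq_square algebra_simps)
  ultimately show "((1 + r) * cmod (1 - z))\<^sup>2 \<le> (2 * cmod (1 - of_real r * z))\<^sup>2" by linarith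
qed simp

text \<open>
  The kernel \<open>- ln \<bar>1 - r z cnj w\<bar>\<close> is a positive combination of the kernels \<open>(z cnj w)\<^sup>k\<close>; keeping
  only \<open>k = 1\<close> bounds the sum of the points by their energy.
\<close>

lemma sum_ln_kernel_le:
  fixes w :: "'i \<Rightarrow> complex"
  assumes w: "\<And>i. i \<in> S \<Longrightarrow> cmod (w i) \<le> 1" and r: "0 < r" "r < 1"
  shows "(\<Sum>i\<in>S. \<Sum>j\<in>S. ln (cmod (1 - of_real r * (w i * cnj (w j))))) \<le> - r * (cmod (\<Sum>i\<in>S. w i))\<^sup>2"
proof -
  define \<zeta> where "\<zeta> = (\<lambda>i j. of_real r * (w i * cnj (w j)))"
  have norm: "cmod (\<zeta> i j) < 1" if "i \<in> S" "j \<in> S" for i j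
  proof -
    have "cmod (w i) * cmod (w j) \<le> 1" using w that by (intro mult_le_one) auto
    then have "r * (cmod (w i) * cmod (w j)) \<le> r * 1" using r by (intro mult_left_mono) auto
    moreover have "cmod (\<zeta> i j) = r * (cmod (w i) * cmod (w j))" using r by (simp add: \<zeta>_def norm_mult)
    ultimately show ?thesis using r by linarith
  qed
  have "(\<lambda>k. Re (- (\<zeta> i j ^ k) / of_nat k)) sums ln (cmod (1 - \<zeta> i j))" if "i \<in> S" "j \<in> S" for i j
  proof -
    have n: "cmod (- \<zeta> i j) < 1" using norm[OF that] by simp
    have "1 - \<zeta> i j \<noteq> 0" using norm[OF that] by auto
    then have "Re (Ln (1 - \<zeta> i j)) = ln (cmod (1 - \<zeta> i j))" by simp
    moreover have *: "(-1) ^ Suc k / of_nat k * (- \<zeta> i j) ^ k = - (\<zeta> i j ^ k) / of_nat k" for k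
    proof -
      have "(-1) ^ k * (- \<zeta> i j) ^ k = \<zeta> i j ^ k" by (simp flip: power_mult_distrib)
      then show ?thesis by simp
    qed
    ultimately show ?thesis
      using sums_Re[OF Ln_series[OF n, unfolded *]] by simp
  qed
  then have "(\<lambda>k. \<Sum>i\<in>S. \<Sum>j\<in>S. Re (- (\<zeta> i j ^ k) / of_nat k)) sums (\<Sum>i\<in>S. \<Sum>j\<in>S. ln (cmod (1 - \<zeta> i j)))"
    by (intro sums_sum)
  moreover have "(\<Sum>i\<in>S. \<Sum>j\<in>S. Re (- (\<zeta> i j ^ k) / of_nat k)) = - (r ^ k * (cmod (\<Sum>i\<in>S. w i ^ k))\<^sup>2 / real k)" for k
  proof -
    have "(\<Sum>i\<in>S. \<Sum>j\<in>S. - (\<zeta> i j ^ k) / of_nat k) = - (of_real (r ^ k) * ((\<Sum>i\<in>S. w i ^ k) * cnj (\<Sum>j\<in>S. w j ^ k)) / of_nat k)"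
    proof -
      have "(\<Sum>i\<in>S. w i ^ k) * cnj (\<Sum>j\<in>S. w j ^ k) = (\<Sum>i\<in>S. \<Sum>j\<in>S. w i ^ k * cnj (w j) ^ k)"
        by (simp only: cnj_sum complex_cnj_power sum_product)
      then show ?thesis
        by (simp only: \<zeta>_def) (simp add: power_mult_distrib sum_distrib_left sum_negf sum_divide_distrib)
    qed
    then have "Re (\<Sum>i\<in>S. \<Sum>j\<in>S. - (\<zeta> i j ^ k) / of_nat k) = Re (- of_real (r ^ k * (cmod (\<Sum>i\<in>S. w i ^ k))\<^sup>2 / real k))"
      by (simp only: complex_norm_square[symmetric]) simp
    then show ?thesis by (simp del: Re_divide_of_nat)
  qed
  ultimately have "(\<lambda>k. - (r ^ k * (cmod (\<Sum>i\<in>S. w i ^ k))\<^sup>2 / real k)) sums (\<Sum>i\<in>S. \<Sum>j\<in>S. ln (cmod (1 - \<zeta> i j)))"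
    by simp
  moreover have "(\<lambda>k. if k = 1 then - r * (cmod (\<Sum>i\<in>S. w i))\<^sup>2 else 0) sums (- r * (cmod (\<Sum>i\<in>S. w i))\<^sup>2)"
    using sums_single[of 1 "\<lambda>_. - r * (cmod (\<Sum>i\<in>S. w i))\<^sup>2"] by simp
  ultimately show ?thesis
    unfolding \<zeta>_def using r by (elim sums_le[rotated]) (auto split: if_splits)
qed

lemma ln_2_ge_half: "1 / 2 \<le> ln (2::real)"
  using ln_le_minus_one[of "1/2::real"] by (simp add: ln_div)

context
  fixes x :: complex assumes x: "algebraic x"
begin

text \<open>
  The logarithm of the discriminant bound is estimated from above: the leading coefficient and the
  reflection together cost at most \<open>2 D\<^sup>2\<close> times the height, shrinking by \<open>r\<close> costs \<open>ln (2 / (1 + r))\<close> per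
  pair, and each diagonal term, which the discriminant lacks, costs at most \<open>- ln (1 - r)\<close>. With \<open>r = 1 - 1 / D\<close> the last two costs together are at most
  \<open>D ln (2 D)\<close>.
\<close>

lemma energy_bound:
  fixes D :: nat
  defines "D \<equiv> alg_degree x"
  assumes D2: "D \<ge> 2"
  shows "(cmod (\<Sum>z\<in>conjugates x. disc_reflect z))\<^sup>2 \<le>
    (real D)\<^sup>2 * (4 * weil_height x + 2 * ln (2 * real D) / real D)"
proof -
  define T where "T = conjugates x"
  define c where "c = real_of_int (lead_coeff (min_int_poly x))"
  define h where "h = weil_height x"
  define w where "w = disc_reflect"
  define W where "W = (\<Sum>z\<in>T. w z)"
  define lp where "lp = (\<lambda>z. log_plus (cmod z))"
  define L where "L = (\<Sum>z\<in>T. lp z)"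
  define r where "r = 1 - 1 / real D"
  define off where "off = (\<lambda>g. \<Sum>z\<in>T. \<Sum>v\<in>T - {z}. g z v :: real)"
  have T: "finite T" "card T = D" by (simp_all add: T_def D_def finite_conjugates[OF x] card_conjugates[OF x])
  have r: "0 < r" "r < 1" "1 / 2 \<le> r" using D2 by (simp_all add: r_def field_simps)
  have c: "c \<ge> 1" using lead_coeff_min_int_poly[OF x] by (simp add: c_def)
  have h: "real D * h = ln c + L"
    using weil_height_conjugates[OF x] by (simp add: D_def h_def c_def L_def lp_def T_def)
  have lp0: "lp z \<ge> 0" for z by (simp add: lp_def log_plus_def)
  have lp_max: "ln (max 1 (cmod z)) = lp z" for z
    by (auto simp: lp_def log_plus_def max_def)
  have off_mono: "off f \<le> off g" if "\<And>z v. z \<in> T \<Longrightarrow> v \<in> T \<Longrightarrow> v \<noteq> z \<Longrightarrow> f z v \<le> g z v" for f g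
    unfolding off_def using that by (intro sum_mono) auto
  have off_add: "off (\<lambda>z v. f z v + g z v) = off f + off g" for f g
    by (simp add: off_def sum.distrib)
  have card_off: "card (T - {z}) = D - 1" if "z \<in> T" for z using T that by simp
  have off_const: "off (\<lambda>_ _. k) = real D * real (D - 1) * k" for k
    using T by (simp add: off_def card_off)
  have off_fst: "off (\<lambda>z _. lp z) = real (D - 1) * L"
    using T by (simp add: off_def card_off L_def sum_distrib_left)
  have off_all: "off g = (\<Sum>z\<in>T. \<Sum>v\<in>T. g z v) - (\<Sum>z\<in>T. g z z)" for g
    using T by (simp add: off_def sum_diff1 sum_subtractf)
  have off_snd: "off (\<lambda>_ z. lp z) = real (D - 1) * L"
    unfolding off_all using T D2 by (simp add: L_def[symmetric] of_nat_diff algebra_simps)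
  \<comment> \<open>The discriminant bound, compared pair by pair with the kernel at the reflected points.\<close>
  have "0 \<le> ln (c ^ (2 * D - 1) * (\<Prod>z\<in>T. \<Prod>v\<in>T - {z}. cmod (z - v)))"
    using discriminant_ge_1[OF x] by (simp add: c_def T_def D_def)
  also have "\<dots> = real (2 * D - 1) * ln c + off (\<lambda>z v. ln (cmod (z - v)))"
  proof -
    have pos: "(\<Prod>v\<in>T - {z}. cmod (z - v)) > 0" for z by (intro prod_pos) auto
    have "ln (\<Prod>z\<in>T. \<Prod>v\<in>T - {z}. cmod (z - v)) = off (\<lambda>z v. ln (cmod (z - v)))"
      unfolding off_def using T pos by (subst ln_prod) (auto intro!: sum.cong ln_prod)
    moreover have "(\<Prod>z\<in>T. \<Prod>v\<in>T - {z}. cmod (z - v)) > 0" using pos by (intro prod_pos) auto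
    ultimately show ?thesis using c by (simp add: ln_mult_pos ln_realpow)
  qed
  also have "off (\<lambda>z v. ln (cmod (z - v))) \<le>
      off (\<lambda>z v. lp z + (lp v + (ln (2 / (1 + r)) + ln (cmod (1 - of_real r * (w z * cnj (w v)))))))"
  proof (rule off_mono)
    fix z v assume zv: "z \<in> T" "v \<in> T" "v \<noteq> z"
    define \<zeta> where "\<zeta> = w z * cnj (w v)"
    have \<zeta>: "cmod \<zeta> \<le> 1"
      unfolding \<zeta>_def norm_mult w_def complex_mod_cnj using cmod_disc_reflect_le by (intro mult_le_one) auto
    have shrink: "cmod (1 - \<zeta>) \<le> 2 / (1 + r) * cmod (1 - of_real r * \<zeta>)"
      using cmod_one_minus_shrink[OF \<zeta> r(1,2)] r by (simp add: field_simps)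
    have "r * cmod \<zeta> \<le> r * 1" using \<zeta> r by (intro mult_left_mono) auto
    moreover have "cmod (of_real r * \<zeta>) = r * cmod \<zeta>" using r by (simp add: norm_mult)
    ultimately have "cmod (of_real r * \<zeta>) < 1" using r by linarith
    then have pos: "cmod (1 - of_real r * \<zeta>) > 0" by auto
    have "cmod (z - v) \<le> max 1 (cmod z) * max 1 (cmod v) * cmod (1 - \<zeta>)"
      unfolding \<zeta>_def w_def by (rule cmod_diff_le_disc_reflect)
    also have "\<dots> \<le> max 1 (cmod z) * max 1 (cmod v) * (2 / (1 + r) * cmod (1 - of_real r * \<zeta>))"
      using shrink by (intro mult_left_mono) auto
    finally have "ln (cmod (z - v)) \<le> ln (max 1 (cmod z) * max 1 (cmod v) * (2 / (1 + r) * cmod (1 - of_real r * \<zeta>)))"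
      using zv by (intro ln_mono) auto
    also have "\<dots> = lp z + (lp v + (ln (2 / (1 + r)) + ln (cmod (1 - of_real r * \<zeta>))))"
    proof -
      have p: "0 < max 1 (cmod z)" "0 < max 1 (cmod v)" "0 < 2 / (1 + r)" using r by auto
      show ?thesis
        using ln_mult_pos[OF mult_pos_pos[OF p(1,2)] mult_pos_pos[OF p(3) pos]]
          ln_mult_pos[OF p(1,2)] ln_mult_pos[OF p(3) pos] by (simp only: lp_max)
    qed
    finally show "ln (cmod (z - v)) \<le> lp z + (lp v + (ln (2 / (1 + r)) + ln (cmod (1 - of_real r * (w z * cnj (w v))))))"
      by (simp add: \<zeta>_def)
  qed
  also have "\<dots> = 2 * real (D - 1) * L + real D * real (D - 1) * ln (2 / (1 + r)) +
      off (\<lambda>z v. ln (cmod (1 - of_real r * (w z * cnj (w v)))))"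
    by (simp only: off_add off_fst off_snd off_const)
  also have "off (\<lambda>z v. ln (cmod (1 - of_real r * (w z * cnj (w v))))) \<le> - r * (cmod W)\<^sup>2 + real D * ln (real D)"
  proof -
    have "(\<Sum>z\<in>T. \<Sum>v\<in>T. ln (cmod (1 - of_real r * (w z * cnj (w v))))) \<le> - r * (cmod W)\<^sup>2"
      unfolding W_def by (rule sum_ln_kernel_le) (use r in \<open>auto simp: w_def cmod_disc_reflect_le\<close>)
    moreover have "- real D * ln (real D) \<le> (\<Sum>z\<in>T. ln (cmod (1 - of_real r * (w z * cnj (w z)))))"
    proof -
      have "- ln (real D) \<le> ln (cmod (1 - of_real r * (w z * cnj (w z))))" for z
      proof -
        have "(cmod (w z))\<^sup>2 \<le> 1" using cmod_disc_reflect_le by (simp add: w_def power_le_one)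
        then have "r * (cmod (w z))\<^sup>2 \<le> r" using r by (simp add: mult_left_le)
        then have "1 / real D \<le> 1 - r * (cmod (w z))\<^sup>2" by (simp add: r_def)
        also have "\<dots> \<le> cmod (of_real (1 - r * (cmod (w z))\<^sup>2))" unfolding norm_of_real by (rule abs_ge_self)
        also have "of_real (1 - r * (cmod (w z))\<^sup>2) = 1 - of_real r * (w z * cnj (w z))"
          by (simp only: complex_norm_square[symmetric]) simp
        finally have "ln (1 / real D) \<le> ln (cmod (1 - of_real r * (w z * cnj (w z))))"
          using D2 by (intro ln_mono) auto
        then show ?thesis using D2 by (simp add: ln_div)
      qed
      then have "(\<Sum>z\<in>T. - ln (real D)) \<le> (\<Sum>z\<in>T. ln (cmod (1 - of_real r * (w z * cnj (w z)))))"
        by (intro sum_mono)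
      then show ?thesis using T by simp
    qed
    ultimately show ?thesis unfolding off_all by simp
  qed
  finally have main: "r * (cmod W)\<^sup>2 \<le> real (2 * D - 1) * ln c + 2 * real (D - 1) * L +
      real D * real (D - 1) * ln (2 / (1 + r)) + real D * ln (real D)" by linarith
  have "real (2 * D - 1) * ln c + 2 * real (D - 1) * L \<le> 2 * real D * ln c + 2 * real D * L"
    using c lp0 by (intro add_mono mult_right_mono) (auto simp: L_def sum_nonneg)
  moreover have "2 * real D * ln c + 2 * real D * L = 2 * (real D)\<^sup>2 * h"
  proof -
    have "2 * real D * ln c + 2 * real D * L = 2 * real D * (ln c + L)" by (simp only: distrib_left)
    also have "\<dots> = 2 * (real D)\<^sup>2 * h" by (simp add: h[symmetric] power2_eq_square)
    finally show ?thesis .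
  qed
  moreover have "real D * real (D - 1) * ln (2 / (1 + r)) \<le> real D * ln 2"
  proof -
    have "ln (2 / (1 + r)) \<le> 2 / (1 + r) - 1" using r by (intro ln_le_minus_one) auto
    also have "\<dots> = 1 / (2 * real D - 1)" using D2 by (simp add: r_def field_simps)
    finally have "real (D - 1) * ln (2 / (1 + r)) \<le> real (D - 1) * (1 / (2 * real D - 1))"
      by (rule mult_left_mono) simp
    also have "\<dots> \<le> 1 / 2" using D2 by (simp add: of_nat_diff field_simps)
    also have "\<dots> \<le> ln 2" by (rule ln_2_ge_half)
    finally show ?thesis by (simp add: mult.assoc mult_left_mono)
  qed
  moreover have "real D * ln 2 + real D * ln (real D) = real D * ln (2 * real D)"
    using D2 by (simp add: ln_mult_pos distrib_left)
  ultimately have "r * (cmod W)\<^sup>2 \<le> 2 * (real D)\<^sup>2 * h + real D * ln (2 * real D)" using main by linarith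
  moreover have "1 / 2 * (cmod W)\<^sup>2 \<le> r * (cmod W)\<^sup>2" using r by (intro mult_right_mono) auto
  ultimately have "(cmod W)\<^sup>2 \<le> 4 * (real D)\<^sup>2 * h + 2 * (real D * ln (2 * real D))" by linarith
  also have "\<dots> = (real D)\<^sup>2 * (4 * h + 2 * ln (2 * real D) / real D)"
    using D2 by (simp add: field_simps power2_eq_square)
  finally show ?thesis by (simp add: W_def w_def T_def h_def)
qed

text \<open>
  If the right-hand side is at least \<open>D\<close> the bound is trivial. Otherwise the height is less than \<open>1 / 24\<close>,
  and replacing \<open>z / \<bar>z\<bar>\<close> by the reflected points costs \<open>2 h\<close> on average, which is small against the square
  root of \<open>h\<close>.
\<close>

lemma angular_sum_bound:
  fixes D :: nat
  assumes x0: "x \<noteq> 0"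
  defines "D \<equiv> alg_degree x"
  shows "cmod (\<Sum>z\<in>conjugates x. z / of_real (cmod z)) \<le>
    real D * sqrt (24 * (weil_height x + ln (2 * real D) / (3 * real D)))"
proof -
  define T where "T = conjugates x"
  define h where "h = weil_height x"
  define l where "l = ln (2 * real D) / real D"
  define U where "U = cmod (\<Sum>z\<in>T. z / of_real (cmod z))"
  define W where "W = cmod (\<Sum>z\<in>T. disc_reflect z)"
  have T: "finite T" "card T = D" by (simp_all add: T_def D_def finite_conjugates[OF x] card_conjugates[OF x])
  have D: "D > 0" by (simp add: D_def alg_degree_pos[OF x])
  have h: "h \<ge> 0" by (simp add: h_def weil_height_nonneg[OF x])
  have T0: "z \<noteq> 0" if "z \<in> T" for z using sum_ln_conjugates(2)[OF x x0] that by (auto simp: T_def)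
  have E: "24 * (h + ln (2 * real D) / (3 * real D)) = 24 * h + 8 * l" by (simp add: l_def)
  have "U \<le> real D * sqrt (24 * h + 8 * l)"
  proof (cases "24 * h + 8 * l \<ge> 1")
    case True
    have "U \<le> (\<Sum>z\<in>T. 1)"
      unfolding U_def by (rule sum_norm_le) (use T0 in \<open>auto simp: norm_divide\<close>)
    also have "\<dots> = real D * 1" using T by simp
    also have "\<dots> \<le> real D * sqrt (24 * h + 8 * l)" using True by (intro mult_left_mono) auto
    finally show ?thesis .
  next
    case False
    have "D \<ge> 2"
    proof (rule ccontr)
      assume "\<not> D \<ge> 2"
      then have "D = 1" using D by linarith
      then show False using False h ln_2_ge_half by (simp add: l_def)
    qed
    then have W: "W\<^sup>2 \<le> (real D)\<^sup>2 * (4 * h + 2 * l)"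
      using energy_bound by (simp add: W_def T_def h_def l_def D_def)
    have diff: "cmod (z / of_real (cmod z) - disc_reflect z) \<le> \<bar>ln (cmod z)\<bar>" if "z \<in> T" for z
    proof -
      define a where "a = cmod z"
      define u where "u = z / of_real a"
      have a: "a > 0" and u: "cmod u = 1" and z: "z = of_real a * u"
        using T0[OF that] by (auto simp: a_def u_def norm_divide)
      have "u * cnj u = 1" using u by (simp only: complex_norm_square[symmetric]) simp
      then have inv: "inverse (cnj u) = u" by (metis inverse_unique mult.commute)
      show ?thesis
      proof (cases "a \<le> 1")
        case True
        then have "z / of_real (cmod z) - disc_reflect z = of_real (1 - a) * u"
          using a by (simp add: disc_reflect_def a_def[symmetric] u_def field_simps)
        then have "cmod (z / of_real (cmod z) - disc_reflect z) = 1 - a"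
          using True u by (simp add: norm_mult del: of_real_diff)
        also have "\<dots> \<le> \<bar>ln a\<bar>" using ln_le_minus_one[OF a] by linarith
        finally show ?thesis by (simp add: a_def)
      next
        case False
        have "z / of_real (cmod z) - disc_reflect z = u - inverse (of_real a * cnj u)"
          using False by (simp add: disc_reflect_def a_def[symmetric] u_def[symmetric]) (simp add: z)
        also have "inverse (of_real a * cnj u) = u / of_real a"
          by (simp add: inv divide_inverse mult.commute)
        also have "u - u / of_real a = of_real (1 - 1 / a) * u" using a by (simp add: field_simps)
        finally have "cmod (z / of_real (cmod z) - disc_reflect z) = 1 - 1 / a"
          using False u a by (simp add: norm_mult del: of_real_diff)
        also have "\<dots> \<le> \<bar>ln a\<bar>" using ln_le_minus_one[of "1 / a"] a by (simp add: ln_div)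
        finally show ?thesis by (simp add: a_def)
      qed
    qed
    have "U = cmod ((\<Sum>z\<in>T. disc_reflect z) + (\<Sum>z\<in>T. z / of_real (cmod z) - disc_reflect z))"
      by (simp add: U_def sum_subtractf)
    also have "\<dots> \<le> W + (\<Sum>z\<in>T. \<bar>ln (cmod z)\<bar>)"
      unfolding W_def using diff by (intro norm_triangle_le add_left_mono sum_norm_le)
    also have "\<dots> \<le> W + 2 * real D * h"
      using sum_abs_ln_conjugates[OF x x0] by (simp add: T_def D_def h_def)
    finally have "U\<^sup>2 \<le> (W + 2 * real D * h)\<^sup>2" by (intro power_mono) (auto simp: U_def)
    also have "\<dots> \<le> 2 * W\<^sup>2 + 8 * (real D)\<^sup>2 * (h * h)"
    proof -
      have "0 \<le> (W - 2 * real D * h)\<^sup>2" by simp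
      then show ?thesis by (simp add: power2_eq_square algebra_simps)
    qed
    also have "\<dots> \<le> 2 * ((real D)\<^sup>2 * (4 * h + 2 * l)) + 8 * (real D)\<^sup>2 * (h * 1)"
    proof -
      have "l \<ge> 0" using D by (simp add: l_def)
      then have "h \<le> 1" using False h by linarith
      then have "h * h \<le> h * 1" using h by (rule mult_left_mono)
      then have "8 * (real D)\<^sup>2 * (h * h) \<le> 8 * (real D)\<^sup>2 * (h * 1)" by (rule mult_left_mono) simp
      then show ?thesis using W by linarith
    qed
    also have "\<dots> \<le> (real D)\<^sup>2 * (24 * h + 8 * l)"
    proof -
      have "l \<ge> 0" using D by (simp add: l_def)
      then have "0 \<le> (real D)\<^sup>2 * (8 * h + 4 * l)" using h by simp
      then show ?thesis by (simp add: algebra_simps)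
    qed
    finally have "sqrt (U\<^sup>2) \<le> sqrt ((real D)\<^sup>2 * (24 * h + 8 * l))" by (rule real_sqrt_le_mono)
    then show ?thesis by (simp add: real_sqrt_mult U_def)
  qed
  then show ?thesis by (simp only: U_def T_def h_def E[unfolded h_def])
qed

end

text \<open>
  For real arguments the function decreases only from \<open>exp 1 / 2\<close> on; on the positive integers its first
  two values are equal.
\<close>

lemma ln_double_div_antimono:
  assumes "0 < a" "a \<le> b"
  shows "ln (2 * real b) / real b \<le> ln (2 * real a) / real a"
proof -
  define f where "f = (\<lambda>k. ln (2 * real (Suc k)) / real (Suc k))"
  have step: "f (Suc k) \<le> f k" for k
  proof -
    define n where "n = Suc k"
    have "real n * ln (1 + 1 / real n) \<le> ln (2 * real n)"
    proof (cases "n = 1")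
      case False
      then have n: "n \<ge> 2" by (simp add: n_def)
      have "real n * ln (1 + 1 / real n) \<le> real n * (1 / real n)"
        using n by (intro mult_left_mono ln_add_one_self_le_self) auto
      also have "\<dots> \<le> ln 2 + ln 2" using ln_2_ge_half n by simp
      also have "\<dots> \<le> ln 2 + ln (real n)" using n by simp
      finally show ?thesis using n by (simp add: ln_mult_pos)
    qed simp
    moreover have "ln (2 * real (Suc n)) = ln (2 * real n) + ln (1 + 1 / real n)"
    proof -
      have "2 * real (Suc n) = (2 * real n) * (1 + 1 / real n)" by (simp add: n_def field_simps)
      moreover have "0 < 2 * real n" "0 < 1 + 1 / real n" by (simp_all add: n_def add_pos_nonneg)
      ultimately show ?thesis by (metis ln_mult_pos)
    qed
    ultimately have "real n * ln (2 * real (Suc n)) \<le> real (Suc n) * ln (2 * real n)"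
      by (simp add: algebra_simps)
    moreover have "0 < real n" "0 < real (Suc n)" by (simp_all add: n_def)
    moreover have "a / b \<le> c / d" if "d * a \<le> b * c" "0 < d" "0 < b" for a b c d :: real
      using that by (simp add: field_simps)
    ultimately have "ln (2 * real (Suc n)) / real (Suc n) \<le> ln (2 * real n) / real n" by blast
    then show ?thesis by (simp only: f_def n_def)
  qed
  have "f (b - 1) \<le> f (a - 1)"
    by (rule lift_Suc_antimono_le[of f, OF step]) (use assms in simp)
  then show ?thesis using assms by (simp add: f_def)
qed

section \<open>Characters and Gaussians\<close>

text \<open>
  Fubini's theorem in coordinates; it reduces the integrals of characters and of Gaussians to one variable.
\<close>

lemma product_integral_vec:
  fixes g :: "'n::finite \<Rightarrow> real \<Rightarrow> complex"
  assumes g: "\<And>j. integrable lborel (g j)"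
  shows "integrable lborel (\<lambda>x :: real ^ 'n. \<Prod>j\<in>UNIV. g j (x $ j))" (is ?int)
    and "(LINT x|lborel. (\<Prod>j\<in>UNIV. g j ((x :: real ^ 'n) $ j))) = (\<Prod>j\<in>UNIV. (LINT x|lborel. g j x))" (is ?eq)
proof -
  define ax where "ax = (\<lambda>j::'n. axis j (1::real))"
  have inj: "inj ax" by (auto simp: inj_def ax_def axis_eq_axis)
  have Basis: "Basis = range ax" by (auto simp: Basis_vec_def ax_def)
  define h where "h = (\<lambda>b. g (inv_into UNIV ax b))"
  interpret product_sigma_finite "\<lambda>b :: real ^ 'n. lborel :: real measure"
    by standard
  have h: "integrable lborel (h b)" for b by (simp add: h_def g)
  define S where "S = (\<lambda>f :: real ^ 'n \<Rightarrow> real. \<Sum>b\<in>Basis. f b *\<^sub>R b)"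
  have S: "S \<in> measurable (\<Pi>\<^sub>M b\<in>Basis. lborel) borel" unfolding S_def by measurable
  have coord: "S f $ j = f (ax j)" for f j
  proof -
    have "S f $ j = S f \<bullet> axis j 1" by (simp add: inner_axis)
    also have "\<dots> = f (axis j 1)"
      unfolding S_def by (simp add: inner_sum_left inner_Basis if_distrib cong: if_cong)
    finally show ?thesis by (simp add: ax_def)
  qed
  have prod: "(\<Prod>j\<in>UNIV. g j (S f $ j)) = (\<Prod>b\<in>Basis. h b (f b))" for f
    unfolding Basis coord using inj by (subst prod.reindex) (auto simp: h_def)
  have meas: "(\<lambda>x :: real ^ 'n. \<Prod>j\<in>UNIV. g j (x $ j)) \<in> borel_measurable borel"
  proof (intro borel_measurable_prod)
    fix j
    have "g j \<in> borel_measurable borel" using g[of j] by auto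
    then show "(\<lambda>x :: real ^ 'n. g j (x $ j)) \<in> borel_measurable borel"
      by (rule measurable_compose[rotated]) (auto intro!: borel_measurable_continuous_onI continuous_intros)
  qed
  have lb: "(lborel :: (real ^ 'n) measure) = distr (\<Pi>\<^sub>M b\<in>Basis. lborel) borel S"
    unfolding S_def by (rule lborel_eq)
  show ?int
    unfolding lb using S meas by (subst integrable_distr_eq) (auto simp: prod intro!: product_integrable_prod h)
  have "(LINT x|lborel. (\<Prod>j\<in>UNIV. g j ((x :: real ^ 'n) $ j))) =
      (LINT f|(\<Pi>\<^sub>M b\<in>(Basis :: (real ^ 'n) set). lborel). (\<Prod>b\<in>Basis. h b (f b)))"
    unfolding lb using S meas by (subst integral_distr) (auto simp: prod)
  also have "\<dots> = (\<Prod>b\<in>Basis. (LINT x|lborel. h b x))"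
    by (rule product_integral_prod) (auto intro: h)
  also have "\<dots> = (\<Prod>j\<in>UNIV. (LINT x|lborel. g j x))"
    unfolding Basis using inj by (subst prod.reindex) (auto simp: h_def)
  finally show ?eq .
qed

lemma cis_sum: "cis (\<Sum>i\<in>S. f i) = (\<Prod>i\<in>S. cis (f i))"
  by (induction S rule: infinite_finite_induct) (auto simp: cis_mult[symmetric])

lemma torus_char_prod: "torus_char n \<theta> = (\<Prod>j\<in>UNIV. cis (- 2 * pi * of_int (n $ j) * \<theta> $ j))"
  by (simp add: torus_char_def cis_sum[symmetric] sum_distrib_left mult.assoc)

lemma norm_torus_char [simp]: "cmod (torus_char n \<theta>) = 1"
  by (simp add: torus_char_def)

lemma torus_char_0 [simp]: "torus_char 0 \<theta> = 1"
  by (simp add: torus_char_def)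

lemma torus_char_add: "torus_char (m + n) \<theta> = torus_char m \<theta> * torus_char n \<theta>"
  by (simp add: torus_char_def cis_mult sum.distrib algebra_simps)

lemma cnj_torus_char: "cnj (torus_char n \<theta>) = torus_char (- n) \<theta>"
  by (simp add: torus_char_def cis_cnj sum_negf)

lemma torus_char_periodic: "torus_char n (\<theta> + (\<chi> j. of_int (k $ j))) = torus_char n \<theta>"
proof -
  have "cis (- 2 * pi * (\<Sum>j\<in>UNIV. of_int (n $ j) * of_int (k $ j))) = cis (2 * pi * of_int (- (\<Sum>j\<in>UNIV. n $ j * k $ j)))"
    by simp
  also have "\<dots> = 1" by (intro cis_multiple_2pi Ints_of_int)
  finally have one: "cis (- 2 * pi * (\<Sum>j\<in>UNIV. of_int (n $ j) * of_int (k $ j))) = 1" .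
  have "- 2 * pi * (\<Sum>j\<in>UNIV. of_int (n $ j) * (\<theta> + (\<chi> j. of_int (k $ j))) $ j) =
      - 2 * pi * (\<Sum>j\<in>UNIV. of_int (n $ j) * \<theta> $ j) + - 2 * pi * (\<Sum>j\<in>UNIV. of_int (n $ j) * of_int (k $ j))"
    by (simp add: sum.distrib algebra_simps)
  then show ?thesis
    unfolding torus_char_def by (simp only: cis_mult[symmetric] one mult_1_right)
qed

lemma continuous_on_torus_char [continuous_intros]:
  "continuous_on A f \<Longrightarrow> continuous_on A (\<lambda>x. torus_char n (f x))"
  unfolding torus_char_def by (intro continuous_intros)

lemma torus_char_measurable [measurable]: "torus_char n \<in> borel_measurable borel"
  by (intro borel_measurable_continuous_onI continuous_intros)

lemma space_torus: "space torus_measure = cbox 0 (vec 1)"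
  by (simp add: torus_measure_def space_restrict_space)

lemma torus_borel [measurable]: "(\<lambda>x. x) \<in> measurable torus_measure borel"
  unfolding torus_measure_def by (intro measurable_restrict_space1) auto

lemma prob_torus: "prob_space (torus_measure :: (real ^ 'n) measure)"
proof
  have "emeasure torus_measure (space (torus_measure :: (real ^ 'n) measure)) = emeasure lborel (cbox 0 (vec 1 :: real ^ 'n))"
    unfolding space_torus unfolding torus_measure_def by (subst emeasure_restrict_space) auto
  also have "\<dots> = 1" by (subst emeasure_lborel_cbox) (auto simp: Basis_vec_def inner_axis intro!: prod.neutral)
  finally show "emeasure torus_measure (space (torus_measure :: (real ^ 'n) measure)) = 1" .
qed

lemma integral_cis_unit_interval:
  fixes k :: int
  shows "integrable lborel (\<lambda>\<theta>. indicator {0..1} \<theta> *\<^sub>R cis (- 2 * pi * of_int k * \<theta>))"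
    and "(LINT \<theta>|lborel. indicator {0..1} \<theta> *\<^sub>R cis (- 2 * pi * of_int k * \<theta>)) = (if k = 0 then 1 else 0)"
proof -
  have *: "has_bochner_integral lborel (\<lambda>\<theta>. indicator {0..1} \<theta> *\<^sub>R cis (- 2 * pi * of_int k * \<theta>))
    (if k = 0 then 1 else 0)"
  proof (cases "k = 0")
    case True
    have "has_bochner_integral lborel (indicat_real {0..1::real}) (measure lborel {0..1::real})"
      by (rule has_bochner_integral_real_indicator) auto
    from has_bochner_integral_scaleR_left[OF this, of "1::complex"] show ?thesis using True by simp
  next
    case False
    define c where "c = - 2 * pi * of_int k"
    have c: "c \<noteq> 0" using False by (simp add: c_def)
    have "has_bochner_integral lborel (\<lambda>x. indicat_real {0..1} x *\<^sub>R cis (c * x))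
      (cis (c * 1) / (\<i> * of_real c) - cis (c * 0) / (\<i> * of_real c))"
    proof (rule has_bochner_integral_FTC_Icc)
      fix x :: real
      show "((\<lambda>x. cis (c * x) / (\<i> * of_real c)) has_vector_derivative cis (c * x)) (at x within {0..1})"
        unfolding cis_conv_exp using c
        by (auto intro!: derivative_eq_intros has_vector_derivative_real_field simp: field_simps)
    qed (auto intro!: continuous_intros)
    moreover have "cis (c * 1) = 1"
    proof -
      have "c * 1 = 2 * pi * of_int (- k)" by (simp add: c_def)
      then show ?thesis using cis_multiple_2pi[of "of_int (- k)"] by simp
    qed
    ultimately show ?thesis using False by (simp add: c_def)
  qed
  show "integrable lborel (\<lambda>\<theta>. indicator {0..1} \<theta> *\<^sub>R cis (- 2 * pi * of_int k * \<theta>))"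
    and "(LINT \<theta>|lborel. indicator {0..1} \<theta> *\<^sub>R cis (- 2 * pi * of_int k * \<theta>)) = (if k = 0 then 1 else 0)"
    using has_bochner_integral_iff[THEN iffD1, OF *] by auto
qed

lemma integral_torus_char: "(LINT \<theta>|torus_measure. torus_char n \<theta>) = (if n = 0 then 1 else 0)"
proof -
  have ind: "indicator (cbox 0 (vec 1)) \<theta> *\<^sub>R torus_char n \<theta> =
      (\<Prod>j\<in>UNIV. indicator {0..1} (\<theta> $ j) *\<^sub>R cis (- 2 * pi * of_int (n $ j) * \<theta> $ j))" for \<theta>
  proof (cases "\<theta> \<in> cbox 0 (vec 1)")
    case True
    then show ?thesis by (simp add: torus_char_prod mem_box_cart)
  next
    case False
    then obtain j where "\<theta> $ j \<notin> {0..1}" by (auto simp: mem_box_cart)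
    then show ?thesis using False by (auto intro!: prod_zero bexI[of _ j] simp: indicator_def)
  qed
  have "(LINT \<theta>|torus_measure. torus_char n \<theta>) =
      (LINT \<theta>|lborel. indicator (cbox 0 (vec 1)) \<theta> *\<^sub>R torus_char n \<theta>)"
    unfolding torus_measure_def by (subst integral_restrict_space) auto
  also have "\<dots> = (\<Prod>j\<in>UNIV. if n $ j = 0 then 1 else 0)"
    unfolding ind using integral_cis_unit_interval by (subst product_integral_vec(2)) simp_all
  also have "\<dots> = (if n = 0 then 1 else 0)"
  proof (cases "n = 0")
    case False
    then obtain j where "n $ j \<noteq> 0" by (auto simp: Finite_Cartesian_Product.vec_eq_iff)
    then show ?thesis using False by (auto intro!: prod_zero bexI[of _ j])
  qed simp
  finally show ?thesis .
qed

definition gaussian :: "real \<Rightarrow> 'a::euclidean_space \<Rightarrow> real" where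
  "gaussian p s = exp (- pi * p * (norm s)\<^sup>2)"

lemma gaussian_pos: "gaussian p s > 0"
  and gaussian_le_1: "p \<ge> 0 \<Longrightarrow> gaussian p s \<le> 1"
  by (auto simp: gaussian_def)

lemma continuous_on_gaussian [continuous_intros]:
  "continuous_on A f \<Longrightarrow> continuous_on A (\<lambda>x. gaussian p (f x))"
  unfolding gaussian_def by (intro continuous_intros)

lemma gaussian_measurable [measurable]: "gaussian p \<in> borel_measurable borel"
  by (intro borel_measurable_continuous_onI continuous_intros)

lemma gaussian_real:
  fixes t :: real
  assumes p: "p > 0"
  shows "integrable lborel (\<lambda>s. of_real (gaussian p s) * cis (2 * pi * t * s))"
    and "(LINT s|lborel. of_real (gaussian p s) * cis (2 * pi * t * s)) = of_real (1 / sqrt p * gaussian (1 / p) t)"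
proof -
  define c where "c = sqrt (2 * pi * p)"
  have c: "c > 0" "c\<^sup>2 = 2 * pi * p" using p by (simp_all add: c_def)
  define u where "u = 2 * pi * t / c"
  have uc: "u * c = 2 * pi * t" using c by (simp add: u_def)
  have "of_real (exp (- (u\<^sup>2) / 2)) = (LINT x|std_normal_distribution. iexp (u * x))"
    using fun_cong[OF char_std_normal_distribution, of u] by (simp add: char_def)
  also have "\<dots> = (LINT x|lborel. std_normal_density x *\<^sub>R iexp (u * x))"
    by (subst integral_density) auto
  also have "\<dots> = \<bar>c\<bar> *\<^sub>R (LINT s|lborel. std_normal_density (0 + c * s) *\<^sub>R iexp (u * (0 + c * s)))"
    by (rule lborel_integral_real_affine) (use c in auto)
  also have "(\<lambda>s. std_normal_density (0 + c * s) *\<^sub>R iexp (u * (0 + c * s))) =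
      (\<lambda>s. of_real (1 / sqrt (2 * pi)) * (of_real (gaussian p s) * cis (2 * pi * t * s)))"
  proof
    fix s
    have "(c * s)\<^sup>2 / 2 = pi * p * s\<^sup>2" using c(2) by (simp add: power_mult_distrib)
    then have "std_normal_density (c * s) = 1 / sqrt (2 * pi) * gaussian p s"
      by (simp add: std_normal_density_def gaussian_def)
    moreover have "iexp (u * (c * s)) = cis (2 * pi * t * s)"
      by (simp add: cis_conv_exp flip: uc) (simp add: mult_ac)
    ultimately show "std_normal_density (0 + c * s) *\<^sub>R iexp (u * (0 + c * s)) =
        of_real (1 / sqrt (2 * pi)) * (of_real (gaussian p s) * cis (2 * pi * t * s))"
      by (simp add: scaleR_conv_of_real)
  qed
  also have "\<bar>c\<bar> *\<^sub>R (LINT s|lborel. of_real (1 / sqrt (2 * pi)) * (of_real (gaussian p s) * cis (2 * pi * t * s))) =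
      of_real (sqrt p) * (LINT s|lborel. of_real (gaussian p s) * cis (2 * pi * t * s))"
    using c p by (simp add: c_def real_sqrt_mult scaleR_conv_of_real)
  finally have eq: "of_real (exp (- (u\<^sup>2) / 2)) =
    of_real (sqrt p) * (LINT s|lborel. of_real (gaussian p s) * cis (2 * pi * t * s))" .
  have "u\<^sup>2 / 2 = pi * (1 / p) * t\<^sup>2"
    unfolding u_def power_divide c(2) using p by (simp add: power2_eq_square field_simps)
  then have "exp (- (u\<^sup>2) / 2) = gaussian (1 / p) t" by (simp add: gaussian_def)
  then show "(LINT s|lborel. of_real (gaussian p s) * cis (2 * pi * t * s)) = of_real (1 / sqrt p * gaussian (1 / p) t)"
    using eq p by (simp add: field_simps)
  \<comment> \<open>A function that is not integrable has integral 0.\<close>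
  show "integrable lborel (\<lambda>s. of_real (gaussian p s) * cis (2 * pi * t * s))"
  proof (rule ccontr)
    assume "\<not> ?thesis"
    then have "(LINT s|lborel. of_real (gaussian p s) * cis (2 * pi * t * s)) = 0"
      by (rule not_integrable_integral_eq)
    then show False using eq by simp
  qed
qed

lemma gaussian_vec:
  fixes t :: "real ^ 'n"
  assumes p: "p > 0"
  shows "integrable lborel (\<lambda>s. of_real (gaussian p s) * cis (2 * pi * (t \<bullet> s)))"
    and "(LINT s|lborel. of_real (gaussian p s) * cis (2 * pi * (t \<bullet> s))) =
      of_real ((1 / sqrt p) ^ CARD('n) * gaussian (1 / p) t)"
proof -
  have g: "gaussian q s = (\<Prod>j\<in>UNIV. gaussian q (s $ j))" for q and s :: "real ^ 'n"
  proof -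
    have "(norm s)\<^sup>2 = (\<Sum>j\<in>UNIV. (norm (s $ j))\<^sup>2)"
      by (simp only: power2_norm_eq_inner inner_vec_def)
    then show ?thesis
      unfolding gaussian_def by (simp only: sum_distrib_left exp_sum finite)
  qed
  have "of_real (gaussian p s) * cis (2 * pi * (t \<bullet> s)) =
      (\<Prod>j\<in>UNIV. of_real (gaussian p (s $ j)) * cis (2 * pi * t $ j * s $ j))" for s
    by (simp add: g inner_vec_def sum_distrib_left cis_sum prod.distrib mult.assoc)
  then show "integrable lborel (\<lambda>s. of_real (gaussian p s) * cis (2 * pi * (t \<bullet> s)))"
    and "(LINT s|lborel. of_real (gaussian p s) * cis (2 * pi * (t \<bullet> s))) =
      of_real ((1 / sqrt p) ^ CARD('n) * gaussian (1 / p) t)"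
    using product_integral_vec[of "\<lambda>j s. of_real (gaussian p s) * cis (2 * pi * t $ j * s)"]
      gaussian_real[OF p] by (simp_all add: g[of "1 / p"] prod.distrib power_divide prod_dividef)
qed

section \<open>Fourier inversion on the class of test functions\<close>

lemma integrable_prod:
  fixes f :: "'a \<Rightarrow> complex" and g :: "'b \<Rightarrow> complex"
  assumes "sigma_finite_measure M" "sigma_finite_measure N" "integrable M f" "integrable N g"
  shows "integrable (M \<Otimes>\<^sub>M N) (\<lambda>x. f (fst x) * g (snd x))"
    and "(LINT x|(M \<Otimes>\<^sub>M N). f (fst x) * g (snd x)) = (LINT x|M. f x) * (LINT y|N. g y)"
proof -
  interpret pair_sigma_finite M N using assms by (simp add: pair_sigma_finite_def)
  have [measurable]: "f \<in> borel_measurable M" "g \<in> borel_measurable N" using assms by auto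
  show int: "integrable (M \<Otimes>\<^sub>M N) (\<lambda>x. f (fst x) * g (snd x))"
    using assms(3,4) by (intro Fubini_integrable) (auto simp: norm_mult)
  show "(LINT x|(M \<Otimes>\<^sub>M N). f (fst x) * g (snd x)) = (LINT x|M. f x) * (LINT y|N. g y)"
    using integral_fst'[OF int] by simp
qed

lemma kernel_Fubini:
  fixes K :: "'a \<Rightarrow> 'b \<Rightarrow> complex"
  assumes "sigma_finite_measure M" "sigma_finite_measure N"
    and K [measurable]: "(\<lambda>(x, y). K x y) \<in> borel_measurable (M \<Otimes>\<^sub>M N)" and K1: "\<And>x y. cmod (K x y) \<le> 1"
    and f: "integrable M f" and g: "integrable N g"
  shows "integrable M (\<lambda>x. f x * (LINT y|N. K x y * g y))"
    and "integrable N (\<lambda>y. (LINT x|M. f x * K x y) * g y)"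
    and "(LINT y|N. (LINT x|M. f x * K x y) * g y) = (LINT x|M. f x * (LINT y|N. K x y * g y))"
proof -
  interpret pair_sigma_finite M N using assms by (simp add: pair_sigma_finite_def)
  have [measurable]: "f \<in> borel_measurable M" "g \<in> borel_measurable N" using f g by auto
  have K': "(\<lambda>x. K (fst x) (snd x)) \<in> borel_measurable (M \<Otimes>\<^sub>M N)" using K by (simp add: case_prod_beta)
  have int: "integrable (M \<Otimes>\<^sub>M N) (\<lambda>(x, y). f x * K x y * g y)"
  proof (rule Bochner_Integration.integrable_bound)
    show "integrable (M \<Otimes>\<^sub>M N) (\<lambda>x. f (fst x) * g (snd x))"
      by (rule integrable_prod) (use assms in auto)
    show "AE x in M \<Otimes>\<^sub>M N. norm (case x of (x, y) \<Rightarrow> f x * K x y * g y) \<le> norm (f (fst x) * g (snd x))"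
    proof (rule AE_I2)
      fix x
      have "norm (f (fst x) * g (snd x)) * cmod (K (fst x) (snd x)) \<le> norm (f (fst x) * g (snd x)) * 1"
        using K1 by (intro mult_left_mono) auto
      then show "norm (case x of (x, y) \<Rightarrow> f x * K x y * g y) \<le> norm (f (fst x) * g (snd x))"
        by (simp add: case_prod_beta norm_mult mult_ac)
    qed
  qed (use K' in \<open>simp add: case_prod_beta\<close>)
  show "integrable M (\<lambda>x. f x * (LINT y|N. K x y * g y))"
    using integrable_fst[OF int] by (simp add: mult.assoc)
  show "integrable N (\<lambda>y. (LINT x|M. f x * K x y) * g y)"
    using integrable_snd[OF int] by simp
  show "(LINT y|N. (LINT x|M. f x * K x y) * g y) = (LINT x|M. f x * (LINT y|N. K x y * g y))"
  proof -
    have "(LINT y|N. (LINT x|M. f x * K x y) * g y) = (LINT y|N. (LINT x|M. f x * K x y * g y))" by simp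
    also have "\<dots> = (LINT x|M. (LINT y|N. f x * K x y * g y))" by (rule Fubini_integral[OF int])
    also have "\<dots> = (LINT x|M. f x * (LINT y|N. K x y * g y))" by (simp add: mult.assoc)
    finally show ?thesis .
  qed
qed

lemma square_integrable_mult:
  assumes "square_integrable M f" "square_integrable M g"
  shows "integrable M (\<lambda>x. f x * g x)"
proof (rule Bochner_Integration.integrable_bound)
  show "integrable M (\<lambda>x. (cmod (f x))\<^sup>2 + (cmod (g x))\<^sup>2)"
    using assms by (auto simp: square_integrable_def)
  show "AE x in M. norm (f x * g x) \<le> norm ((cmod (f x))\<^sup>2 + (cmod (g x))\<^sup>2)"
  proof (rule AE_I2)
    fix x
    have "2 * (cmod (f x) * cmod (g x)) \<le> (cmod (f x))\<^sup>2 + (cmod (g x))\<^sup>2"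
      using sum_squares_bound[of "cmod (f x)" "cmod (g x)"] by simp
    moreover have "0 \<le> cmod (f x) * cmod (g x)" by simp
    ultimately have "cmod (f x) * cmod (g x) \<le> (cmod (f x))\<^sup>2 + (cmod (g x))\<^sup>2" by linarith
    then show "norm (f x * g x) \<le> norm ((cmod (f x))\<^sup>2 + (cmod (g x))\<^sup>2)"
      by (simp add: norm_mult)
  qed
qed (use assms in \<open>auto simp: square_integrable_def\<close>)

lemma square_integrable_if_bounded:
  assumes "integrable M f" "\<And>x. cmod (f x) \<le> C"
  shows "square_integrable M f"
  unfolding square_integrable_def
proof
  show "f \<in> borel_measurable M" using assms by auto
  show "integrable M (\<lambda>x. (cmod (f x))\<^sup>2)"
  proof (rule Bochner_Integration.integrable_bound)
    show "integrable M (\<lambda>x. C * cmod (f x))" using assms by auto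
    show "AE x in M. norm ((cmod (f x))\<^sup>2) \<le> norm (C * cmod (f x))"
    proof (rule AE_I2)
      fix x
      have "cmod (f x) * cmod (f x) \<le> C * cmod (f x)" using assms(2) by (intro mult_right_mono) auto
      then show "norm ((cmod (f x))\<^sup>2) \<le> norm (C * cmod (f x))" by (simp add: power2_eq_square)
    qed
  qed (use assms in auto)
qed

text \<open>
  By the Cauchy-Schwarz inequality, convergence in \<open>L\<^sup>2\<close> implies convergence of the pairings with \<open>\<psi>\<close>.
\<close>

lemma L2_pairing:
  assumes lim: "L2_tendsto M f g" and [measurable]: "\<And>k. f k \<in> borel_measurable M" "g \<in> borel_measurable M"
    and \<psi>: "square_integrable M \<psi>"
    and int: "\<And>k. integrable M (\<lambda>x. f k x * \<psi> x)" "integrable M (\<lambda>x. g x * \<psi> x)"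
  shows "(\<lambda>k. LINT x|M. f k x * \<psi> x) \<longlonglongrightarrow> (LINT x|M. g x * \<psi> x)"
proof -
  have [measurable]: "\<psi> \<in> borel_measurable M" using \<psi> by (simp add: square_integrable_def)
  define a where "a = (\<lambda>k. \<integral>\<^sup>+x. ennreal ((cmod (f k x - g x))\<^sup>2) \<partial>M)"
  define C where "C = (\<integral>\<^sup>+x. ennreal ((cmod (\<psi> x))\<^sup>2) \<partial>M)"
  define d where "d = (\<lambda>k. (LINT x|M. f k x * \<psi> x) - (LINT x|M. g x * \<psi> x))"
  have a: "a \<longlonglongrightarrow> 0" using lim by (simp add: L2_tendsto_def a_def)
  have "C < \<infinity>" using \<psi> unfolding C_def square_integrable_def integrable_iff_bounded by simp
  have le: "ennreal ((cmod (d k))\<^sup>2) \<le> a k * C" for k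
  proof -
    have "d k = (LINT x|M. (f k x - g x) * \<psi> x)"
      unfolding d_def using int by (simp add: left_diff_distrib)
    then have "ennreal (cmod (d k)) \<le> (\<integral>\<^sup>+x. ennreal (cmod ((f k x - g x) * \<psi> x)) \<partial>M)"
      using int integral_norm_bound_ennreal[of M "\<lambda>x. (f k x - g x) * \<psi> x"] by (simp add: left_diff_distrib)
    also have "\<dots> = (\<integral>\<^sup>+x. ennreal (cmod (f k x - g x)) * ennreal (cmod (\<psi> x)) \<partial>M)"
      by (simp add: norm_mult ennreal_mult')
    finally have "(ennreal (cmod (d k)))\<^sup>2 \<le> (\<integral>\<^sup>+x. ennreal (cmod (f k x - g x)) * ennreal (cmod (\<psi> x)) \<partial>M)\<^sup>2"
      by (intro power_mono) auto
    also have "\<dots> \<le> (\<integral>\<^sup>+x. (ennreal (cmod (f k x - g x)))\<^sup>2 \<partial>M) * (\<integral>\<^sup>+x. (ennreal (cmod (\<psi> x)))\<^sup>2 \<partial>M)"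
      by (rule Cauchy_Schwarz_nn_integral) auto
    finally show ?thesis by (simp add: ennreal_power a_def C_def)
  qed
  have "(\<lambda>k. a k * C) \<longlonglongrightarrow> 0 * C"
    using a \<open>C < \<infinity>\<close> by (intro tendsto_mult_ennreal) auto
  then have aC: "(\<lambda>k. a k * C) \<longlonglongrightarrow> 0" by simp
  have "(\<lambda>k. ennreal ((cmod (d k))\<^sup>2)) \<longlonglongrightarrow> 0"
    by (rule tendsto_sandwich[OF _ _ tendsto_const aC]) (simp_all add: le)
  then have "(\<lambda>k. (cmod (d k))\<^sup>2) \<longlonglongrightarrow> 0" by (subst (asm) tendsto_ennreal_iff[of _ _ 0, simplified]) auto
  then have "(\<lambda>k. sqrt ((cmod (d k))\<^sup>2)) \<longlonglongrightarrow> sqrt 0" by (rule tendsto_real_sqrt)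
  then have "d \<longlonglongrightarrow> 0" by (simp add: tendsto_norm_zero_iff)
  then show ?thesis unfolding d_def by (rule LIM_zero_cancel)
qed

lemma finite_torus: "finite_measure (torus_measure :: (real ^ 'n) measure)"
  by (rule prob_space.axioms(1)[OF prob_torus])

lemma sigma_finite_torus: "sigma_finite_measure (torus_measure :: (real ^ 'n) measure)"
  by (rule finite_measure.axioms(1)[OF finite_torus])

lemma sigma_finite_space: "sigma_finite_measure (space_measure :: ((real ^ 'n) \<times> (real ^ 'n)) measure)"
  unfolding space_measure_def
  by (intro sigma_finite_pair_measure sigma_finite_torus sigma_finite_lborel)

lemma sigma_finite_count: "sigma_finite_measure (count_space (UNIV :: (int ^ 'n) set))"
  by (rule sigma_finite_measure_count_space_countable) simp

lemma sigma_finite_freq: "sigma_finite_measure (freq_measure :: ((int ^ 'n) \<times> (real ^ 'n)) measure)"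
  unfolding freq_measure_def
  by (intro sigma_finite_pair_measure sigma_finite_count sigma_finite_lborel)

lemma space_borel [measurable]: "(\<lambda>x. x) \<in> measurable (space_measure :: ((real ^ 'n) \<times> (real ^ 'n)) measure) borel"
proof -
  have "(\<lambda>x. (fst x, snd x)) \<in> measurable (torus_measure \<Otimes>\<^sub>M lborel) (borel \<Otimes>\<^sub>M borel :: ((real ^ 'n) \<times> (real ^ 'n)) measure)"
    by (intro measurable_Pair measurable_compose[OF measurable_fst torus_borel]) auto
  then show ?thesis by (simp add: space_measure_def borel_prod)
qed

definition fourier_kernel :: "(real ^ 'n) \<times> (real ^ 'n) \<Rightarrow> (int ^ 'n) \<times> (real ^ 'n) \<Rightarrow> complex" where
  "fourier_kernel x y = torus_char (fst y) (fst x) * cis (- 2 * pi * (snd y \<bullet> snd x))"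

lemma norm_fourier_kernel [simp]: "cmod (fourier_kernel x y) = 1"
  by (simp add: fourier_kernel_def norm_mult)

lemma fourier_L1_kernel: "fourier_L1 f y = (LINT x|space_measure. f x * fourier_kernel x y)"
  by (cases y) (simp add: fourier_L1_def fourier_kernel_def case_prod_beta' mult.assoc)

lemma fourier_kernel_measurable:
  "(\<lambda>(x, y). fourier_kernel x y) \<in> borel_measurable
     (space_measure \<Otimes>\<^sub>M (freq_measure :: ((int ^ 'n) \<times> (real ^ 'n)) measure))"
proof -
  let ?M = "space_measure \<Otimes>\<^sub>M (freq_measure :: ((int ^ 'n) \<times> (real ^ 'n)) measure)"
  have x: "fst \<in> borel_measurable ?M" by (rule measurable_compose[OF measurable_fst space_borel])
  have \<theta>: "(\<lambda>z. fst (fst z)) \<in> borel_measurable ?M" and s: "(\<lambda>z. snd (fst z)) \<in> borel_measurable ?M"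
    by (rule measurable_compose[OF x], simp add: borel_measurable_continuous_onI continuous_on_fst continuous_on_snd continuous_on_id)+
  have t: "(\<lambda>z. snd (snd z)) \<in> borel_measurable ?M"
    unfolding freq_measure_def by measurable
  have n: "(\<lambda>z. fst (snd z)) \<in> measurable ?M (count_space UNIV)"
    unfolding freq_measure_def by measurable
  have "(\<lambda>z. torus_char n (fst (fst z)) * cis (- 2 * pi * (snd (snd z) \<bullet> snd (fst z)))) \<in> borel_measurable ?M" for n
  proof (intro borel_measurable_times)
    show "(\<lambda>z. torus_char n (fst (fst z))) \<in> borel_measurable ?M"
      by (rule measurable_compose[OF \<theta> torus_char_measurable])
    have "cis \<in> borel_measurable borel"
      by (intro borel_measurable_continuous_onI continuous_intros)
    moreover have "(\<lambda>z. - 2 * pi * (snd (snd z) \<bullet> snd (fst z))) \<in> borel_measurable ?M"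
      by (intro borel_measurable_times borel_measurable_inner borel_measurable_const t s)
    ultimately show "(\<lambda>z. cis (- 2 * pi * (snd (snd z) \<bullet> snd (fst z)))) \<in> borel_measurable ?M"
      by (rule measurable_compose[rotated])
  qed
  from measurable_compose_countable[OF this n] show ?thesis
    by (simp add: fourier_kernel_def case_prod_beta)
qed

lemma cnj_fourier_kernel_measurable:
  "(\<lambda>(x, y). cnj (fourier_kernel x y)) \<in> borel_measurable
     (space_measure \<Otimes>\<^sub>M (freq_measure :: ((int ^ 'n) \<times> (real ^ 'n)) measure))"
proof -
  have "cnj \<in> borel_measurable borel" by (intro borel_measurable_continuous_onI continuous_intros)
  from measurable_compose[OF fourier_kernel_measurable this] show ?thesis by (simp add: case_prod_beta')
qed

lemma fourier_L1_measurable: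
  assumes "f \<in> borel_measurable space_measure"
  shows "fourier_L1 f \<in> borel_measurable (freq_measure :: ((int ^ 'n) \<times> (real ^ 'n)) measure)"
proof -
  let ?N = "freq_measure :: ((int ^ 'n) \<times> (real ^ 'n)) measure"
  let ?M = "space_measure :: ((real ^ 'n) \<times> (real ^ 'n)) measure"
  have "(\<lambda>z. (snd z, fst z)) \<in> measurable (?N \<Otimes>\<^sub>M ?M) (?M \<Otimes>\<^sub>M ?N)" by measurable
  from measurable_compose[OF this fourier_kernel_measurable]
  have "(\<lambda>z. f (snd z) * fourier_kernel (snd z) (fst z)) \<in> borel_measurable (?N \<Otimes>\<^sub>M ?M)"
    by (intro borel_measurable_times measurable_compose[OF measurable_snd assms]) simp
  then have "(\<lambda>y. LINT x|?M. f x * fourier_kernel x y) \<in> borel_measurable ?N"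
    by (intro sigma_finite_measure.borel_measurable_lebesgue_integral[OF sigma_finite_space]) (simp add: case_prod_beta)
  then show ?thesis by (simp add: fourier_L1_kernel[abs_def])
qed

definition truncate :: "nat \<Rightarrow> ('a \<times> 'b::real_normed_vector \<Rightarrow> complex) \<Rightarrow> 'a \<times> 'b \<Rightarrow> complex" where
  "truncate k F x = indicator (cball 0 (real k)) (snd x) * F x"

lemma truncate:
  fixes F :: "(real ^ 'n) \<times> (real ^ 'n) \<Rightarrow> complex"
  assumes F: "square_integrable space_measure F"
  shows "square_integrable space_measure (truncate k F)" "integrable space_measure (truncate k F)"
    and "L2_tendsto space_measure (\<lambda>k. truncate k F) F"
proof -
  have Fm [measurable]: "F \<in> borel_measurable space_measure" using F by (simp add: square_integrable_def)
  have "(\<lambda>x. indicator (cball 0 (real k)) (snd x) :: complex) \<in> borel_measurable space_measure" for k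
    unfolding space_measure_def
    by (intro measurable_compose[OF measurable_snd borel_measurable_indicator]) simp
  then have m [measurable]: "truncate k F \<in> borel_measurable space_measure" for k
    using Fm unfolding truncate_def by (intro borel_measurable_times)
  have le: "cmod (truncate k F x) \<le> cmod (F x)" for k x
    by (auto simp: truncate_def indicator_def)
  show sq: "square_integrable space_measure (truncate k F)" for k
    unfolding square_integrable_def
  proof
    show "integrable space_measure (\<lambda>x. (cmod (truncate k F x))\<^sup>2)"
      by (rule Bochner_Integration.integrable_bound[of _ "\<lambda>x. (cmod (F x))\<^sup>2"])
        (use F le in \<open>auto simp: square_integrable_def intro!: power_mono\<close>)
  qed fact
  have "integrable lborel (\<lambda>s :: real ^ 'n. complex_of_real (indicator (cball 0 (real k)) s))"
    using emeasure_bounded_finite[OF bounded_cball, of "0 :: real ^ 'n" "real k"]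
    by (intro integrable_of_real integrable_real_indicator) auto
  moreover have "(\<lambda>s :: real ^ 'n. complex_of_real (indicator (cball 0 (real k)) s)) = indicator (cball 0 (real k))"
    by (auto simp: indicator_def)
  ultimately have "integrable lborel (indicator (cball 0 (real k)) :: real ^ 'n \<Rightarrow> complex)" by simp
  moreover have "integrable torus_measure (\<lambda>_ :: real ^ 'n. 1 :: complex)"
    by (rule finite_measure.integrable_const[OF finite_torus])
  ultimately have "integrable space_measure (\<lambda>x :: (real ^ 'n) \<times> (real ^ 'n). 1 * indicator (cball 0 (real k)) (snd x) :: complex)"
    unfolding space_measure_def by (intro integrable_prod(1)[OF sigma_finite_torus sigma_finite_lborel])
  then have ind: "square_integrable space_measure (\<lambda>x :: (real ^ 'n) \<times> (real ^ 'n). indicator (cball 0 (real k)) (snd x) :: complex)"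
    by (intro square_integrable_if_bounded[where C = 1]) (auto simp: indicator_def)
  show "integrable space_measure (truncate k F)"
    using square_integrable_mult[OF ind F] by (simp add: truncate_def[abs_def])
  have "(\<lambda>k. \<integral>\<^sup>+x. ennreal ((cmod (truncate k F x - F x))\<^sup>2) \<partial>space_measure) \<longlonglongrightarrow>
      (\<integral>\<^sup>+x. 0 \<partial>(space_measure :: ((real ^ 'n) \<times> (real ^ 'n)) measure))"
  proof (rule nn_integral_dominated_convergence[where w = "\<lambda>x. ennreal ((cmod (F x))\<^sup>2)"])
    show "(\<integral>\<^sup>+x. ennreal ((cmod (F x))\<^sup>2) \<partial>space_measure) < \<infinity>"
      using F unfolding square_integrable_def integrable_iff_bounded by simp
    show "AE x in space_measure. ennreal ((cmod (truncate k F x - F x))\<^sup>2) \<le> ennreal ((cmod (F x))\<^sup>2)" for k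
      by (rule AE_I2) (auto simp: truncate_def indicator_def)
    show "AE x in space_measure. (\<lambda>k. ennreal ((cmod (truncate k F x - F x))\<^sup>2)) \<longlonglongrightarrow> 0"
    proof (rule AE_I2)
      fix x :: "(real ^ 'n) \<times> (real ^ 'n)"
      obtain k0 where "norm (snd x) \<le> real k0" using real_arch_simple by blast
      then have "eventually (\<lambda>k. ennreal ((cmod (truncate k F x - F x))\<^sup>2) = 0) sequentially"
        unfolding eventually_sequentially by (intro exI[of _ k0]) (auto simp: truncate_def indicator_def)
      then show "(\<lambda>k. ennreal ((cmod (truncate k F x - F x))\<^sup>2)) \<longlonglongrightarrow> 0" by (rule tendsto_eventually)
    qed
  qed auto
  then show "L2_tendsto space_measure (\<lambda>k. truncate k F) F" by (simp add: L2_tendsto_def)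
qed

text \<open>
  The truncations of \<open>F\<close> are integrable and tend to \<open>F\<close>, so every Plancherel transform of \<open>F\<close> is the limit
  of the same sequence.
\<close>

lemma is_fourier_unique:
  fixes F :: "(real ^ 'n) \<times> (real ^ 'n) \<Rightarrow> complex"
  assumes F: "square_integrable space_measure F" and g: "is_fourier F g" and h: "is_fourier F h"
  shows "AE y in freq_measure. g y = h y"
proof -
  let ?N = "freq_measure :: ((int ^ 'n) \<times> (real ^ 'n)) measure"
  define f where "f = (\<lambda>k. fourier_L1 (truncate k F))"
  have [measurable]: "f k \<in> borel_measurable ?N" "g \<in> borel_measurable ?N" "h \<in> borel_measurable ?N" for k
    using g h truncate(2)[OF F] unfolding f_def
    by (auto simp: is_fourier_def square_integrable_def intro!: fourier_L1_measurable)
  have lim: "L2_tendsto ?N f g" "L2_tendsto ?N f h"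
    using g h truncate[OF F] unfolding is_fourier_def f_def by auto
  define a where "a = (\<lambda>g k. \<integral>\<^sup>+y. ennreal ((cmod (f k y - g y))\<^sup>2) \<partial>?N)"
  have le: "(\<integral>\<^sup>+y. ennreal ((cmod (g y - h y))\<^sup>2) \<partial>?N) \<le> 2 * a g k + 2 * a h k" for k
  proof -
    have "(cmod (g y - h y))\<^sup>2 \<le> 2 * (cmod (f k y - g y))\<^sup>2 + 2 * (cmod (f k y - h y))\<^sup>2" for y
    proof -
      have "cmod (g y - h y) \<le> cmod (f k y - g y) + cmod (f k y - h y)"
        using norm_triangle_ineq4[of "f k y - h y" "f k y - g y"] by simp
      then have "(cmod (g y - h y))\<^sup>2 \<le> (cmod (f k y - g y) + cmod (f k y - h y))\<^sup>2" by (rule power_mono) simp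
      also have "\<dots> \<le> 2 * (cmod (f k y - g y))\<^sup>2 + 2 * (cmod (f k y - h y))\<^sup>2"
        using sum_squares_bound[of "cmod (f k y - g y)" "cmod (f k y - h y)"] by (simp add: power2_sum)
      finally show ?thesis .
    qed
    then have "(\<integral>\<^sup>+y. ennreal ((cmod (g y - h y))\<^sup>2) \<partial>?N) \<le>
        (\<integral>\<^sup>+y. 2 * ennreal ((cmod (f k y - g y))\<^sup>2) + 2 * ennreal ((cmod (f k y - h y))\<^sup>2) \<partial>?N)"
      by (intro nn_integral_mono) (auto simp: ennreal_mult[symmetric] ennreal_plus[symmetric] ennreal_numeral[symmetric] simp del: ennreal_plus ennreal_numeral)
    also have "\<dots> = 2 * a g k + 2 * a h k"
      unfolding a_def by (subst nn_integral_add) (auto simp: nn_integral_cmult)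
    finally show ?thesis .
  qed
  have "(\<lambda>k. 2 * a g k + 2 * a h k) \<longlonglongrightarrow> 2 * 0 + 2 * 0"
    using lim unfolding L2_tendsto_def a_def by (intro tendsto_add tendsto_mult_ennreal tendsto_const) auto
  then have "(\<integral>\<^sup>+y. ennreal ((cmod (g y - h y))\<^sup>2) \<partial>?N) \<le> 0"
    using le by (intro LIMSEQ_le_const) (auto intro!: exI[of _ 0])
  then have "(\<integral>\<^sup>+y. ennreal ((cmod (g y - h y))\<^sup>2) \<partial>?N) = 0" by simp
  then have "AE y in ?N. ennreal ((cmod (g y - h y))\<^sup>2) = 0" by (subst (asm) nn_integral_0_iff_AE) auto
  then show ?thesis by eventually_elim auto
qed

text \<open>
  For integrable functions this is Fubini's theorem; truncation and the defining continuity of the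
  Plancherel transform carry it over to \<open>F\<close>.
\<close>

lemma fourier_multiplication:
  fixes F :: "(real ^ 'n) \<times> (real ^ 'n) \<Rightarrow> complex"
  assumes F: "square_integrable space_measure F" and Fh: "is_fourier F Fh"
    and \<phi>: "integrable freq_measure \<phi>" "square_integrable freq_measure \<phi>"
    and \<psi>: "\<And>x. \<psi> x = (LINT y|freq_measure. fourier_kernel x y * \<phi> y)" "square_integrable space_measure \<psi>"
  shows "(LINT y|freq_measure. Fh y * \<phi> y) = (LINT x|space_measure. F x * \<psi> x)"
proof -
  note Fub = kernel_Fubini[OF sigma_finite_space sigma_finite_freq fourier_kernel_measurable _ truncate(2)[OF F] \<phi>(1)]
  have 1: "(\<lambda>k. LINT x|space_measure. truncate k F x * \<psi> x) \<longlonglongrightarrow> (LINT x|space_measure. F x * \<psi> x)"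
    by (rule L2_pairing[OF truncate(3)[OF F] _ _ \<psi>(2) square_integrable_mult[OF truncate(1)[OF F] \<psi>(2)]
          square_integrable_mult[OF F \<psi>(2)]])
      (use F truncate(1)[OF F] in \<open>simp_all add: square_integrable_def\<close>)
  have "(\<lambda>k. LINT y|freq_measure. fourier_L1 (truncate k F) y * \<phi> y) \<longlonglongrightarrow> (LINT y|freq_measure. Fh y * \<phi> y)"
  proof (rule L2_pairing)
    show "L2_tendsto freq_measure (\<lambda>k. fourier_L1 (truncate k F)) Fh"
      using Fh truncate[OF F] by (simp add: is_fourier_def)
    show "integrable freq_measure (\<lambda>y. fourier_L1 (truncate k F) y * \<phi> y)" for k
      unfolding fourier_L1_kernel by (rule Fub(2)) simp
    show "fourier_L1 (truncate k F) \<in> borel_measurable freq_measure" for k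
      using truncate(2)[OF F] by (intro fourier_L1_measurable) auto
    have Fh2: "square_integrable freq_measure Fh" using Fh by (simp add: is_fourier_def)
    show "integrable freq_measure (\<lambda>y. Fh y * \<phi> y)" using Fh2 \<phi>(2) by (rule square_integrable_mult)
    show "Fh \<in> borel_measurable freq_measure" using Fh2 by (simp add: square_integrable_def)
  qed (fact \<phi>(2))
  moreover have "(LINT y|freq_measure. fourier_L1 (truncate k F) y * \<phi> y) = (LINT x|space_measure. truncate k F x * \<psi> x)" for k
    unfolding fourier_L1_kernel \<psi>(1) by (rule Fub(3)) simp
  ultimately show ?thesis using 1 LIMSEQ_unique by simp
qed

definition inverse_fourier :: "((int ^ 'n) \<times> (real ^ 'n) \<Rightarrow> complex) \<Rightarrow> (real ^ 'n) \<times> (real ^ 'n) \<Rightarrow> complex" where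
  "inverse_fourier g x = (LINT y|freq_measure. g y * cnj (fourier_kernel x y))"

lemma kernel_section_measurable:
  fixes x :: "(real ^ 'n) \<times> (real ^ 'n)"
  shows "(\<lambda>y. cnj (fourier_kernel x y)) \<in> borel_measurable freq_measure"
proof -
  have t: "snd \<in> borel_measurable (freq_measure :: ((int ^ 'n) \<times> (real ^ 'n)) measure)"
    and n: "fst \<in> measurable (freq_measure :: ((int ^ 'n) \<times> (real ^ 'n)) measure) (count_space UNIV)"
    unfolding freq_measure_def by measurable
  have "(\<lambda>t. cnj (torus_char n (fst x) * cis (- 2 * pi * (t \<bullet> snd x)))) \<in> borel_measurable borel" for n
    by (intro borel_measurable_continuous_onI continuous_intros)
  from measurable_compose_countable[OF measurable_compose[OF t this] n]
  show ?thesis by (simp add: fourier_kernel_def)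
qed

context
  fixes g :: "(int ^ 'n) \<times> (real ^ 'n) \<Rightarrow> complex"
  assumes g: "integrable freq_measure g"
begin

lemma inverse_fourier_integrand_measurable:
  "(\<lambda>y. g y * cnj (fourier_kernel x y)) \<in> borel_measurable freq_measure"
  by (intro borel_measurable_times borel_measurable_integrable[OF g] kernel_section_measurable)

lemma integrable_inverse_fourier: "integrable freq_measure (\<lambda>y. g y * cnj (fourier_kernel x y))"
  by (rule Bochner_Integration.integrable_bound[OF g inverse_fourier_integrand_measurable])
    (simp add: norm_mult)

lemma inverse_fourier_periodic: "inverse_fourier g (\<theta> + (\<chi> j. of_int (k $ j)), s) = inverse_fourier g (\<theta>, s)"
  by (simp add: inverse_fourier_def fourier_kernel_def torus_char_periodic)

lemma continuous_inverse_fourier: "continuous_on UNIV (inverse_fourier g)"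
  unfolding continuous_on_sequentially
proof (intro ballI allI impI, elim conjE)
  fix x :: "nat \<Rightarrow> (real ^ 'n) \<times> (real ^ 'n)" and a assume lim: "x \<longlonglongrightarrow> a"
  show "(inverse_fourier g \<circ> x) \<longlonglongrightarrow> inverse_fourier g a"
    unfolding inverse_fourier_def comp_def
  proof (rule integral_dominated_convergence)
    show "integrable freq_measure (\<lambda>y. cmod (g y))" using g by auto
    show "AE y in freq_measure. (\<lambda>i. g y * cnj (fourier_kernel (x i) y)) \<longlonglongrightarrow> g y * cnj (fourier_kernel a y)"
    proof (rule AE_I2)
      fix y
      have "continuous_on UNIV (\<lambda>x. g y * cnj (fourier_kernel x y))"
        unfolding fourier_kernel_def by (intro continuous_intros)
      then show "(\<lambda>i. g y * cnj (fourier_kernel (x i) y)) \<longlonglongrightarrow> g y * cnj (fourier_kernel a y)"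
        using lim by (rule continuous_on_tendsto_compose) auto
    qed
  qed (simp_all add: inverse_fourier_integrand_measurable norm_mult)
qed

lemma inverse_fourier_multiplication:
  assumes "integrable space_measure \<psi>"
  shows "integrable space_measure (\<lambda>x. inverse_fourier g x * \<psi> x)"
    and "(LINT x|space_measure. inverse_fourier g x * \<psi> x) =
      (LINT y|freq_measure. g y * (LINT x|space_measure. \<psi> x * cnj (fourier_kernel x y)))"
  using kernel_Fubini[OF sigma_finite_space sigma_finite_freq cnj_fourier_kernel_measurable _ assms g]
  by (simp_all add: inverse_fourier_def mult.commute)

end

lemma lborel_integral_translate:
  fixes f :: "'a::euclidean_space \<Rightarrow> complex"
  assumes "integrable lborel f"
  shows "integrable lborel (\<lambda>s. f (s - a))" "(LINT s|lborel. f (s - a)) = (LINT s|lborel. f s)"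
proof -
  have [measurable]: "f \<in> borel_measurable borel" using assms by auto
  have "(\<lambda>s. s - a) = (+) (- a)" by auto
  then have eq: "lborel = distr lborel borel (\<lambda>s. s - a)" using lborel_distr_plus[of "- a"] by simp
  show "integrable lborel (\<lambda>s. f (s - a))"
    using assms by (subst (asm) eq) (simp add: integrable_distr_eq)
  show "(LINT s|lborel. f (s - a)) = (LINT s|lborel. f s)"
    by (subst (2) eq) (simp add: integral_distr)
qed

section \<open>Waves and trigonometric polynomials\<close>

text \<open>
  The functions against which the inversion error is tested. Gaussians have explicit transforms in both
  directions, so a wave and its transform \<open>wave_hat\<close> satisfy inversion by computation.
\<close>

definition wave :: "int ^ 'n \<Rightarrow> real \<Rightarrow> real ^ 'n \<Rightarrow> (real ^ 'n) \<times> (real ^ 'n) \<Rightarrow> complex" where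
  "wave m p a x = torus_char m (fst x) * of_real (gaussian p (snd x - a))"

definition wave_hat :: "int ^ 'n \<Rightarrow> real \<Rightarrow> real ^ 'n \<Rightarrow> (int ^ 'n) \<times> (real ^ 'n) \<Rightarrow> complex" where
  "wave_hat m p a y = (if fst y = m then 1 else 0) *
     (cis (2 * pi * (snd y \<bullet> a)) * of_real ((1 / sqrt p) ^ CARD('n) * gaussian (1 / p) (snd y)))"

lemma integrable_gaussian:
  assumes "q > 0"
  shows "integrable lborel (\<lambda>s :: real ^ 'n. complex_of_real (gaussian q s))"
  using gaussian_vec(1)[OF assms, of 0] by simp

lemma torus_bounded_integrable:
  fixes f :: "real ^ 'n \<Rightarrow> complex"
  assumes "f \<in> borel_measurable borel" "\<And>x. cmod (f x) \<le> C"
  shows "integrable torus_measure f"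
proof (rule finite_measure.integrable_const_bound[OF finite_torus])
  show "f \<in> borel_measurable torus_measure" by (rule measurable_compose[OF torus_borel assms(1)])
qed (use assms in auto)

lemma count_space_point_integrable:
  fixes f :: "int ^ 'n \<Rightarrow> complex" and m :: "int ^ 'n"
  shows "integrable (count_space UNIV) (\<lambda>n. if n = m then f n else 0)"
    and "(LINT n|count_space UNIV. (if n = m then f n else 0)) = f m"
proof -
  have "has_bochner_integral (count_space UNIV) (indicat_real {m}) (measure (count_space UNIV) {m})"
    by (rule has_bochner_integral_real_indicator) (auto simp: emeasure_count_space)
  from has_bochner_integral_scaleR_left[OF this, of "f m"]
  have "has_bochner_integral (count_space UNIV) (\<lambda>n. indicat_real {m} n *\<^sub>R f m) (f m)"
    by (simp add: measure_def)
  moreover have "(\<lambda>n. indicat_real {m} n *\<^sub>R f m) = (\<lambda>n. if n = m then f n else 0)"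
    by (auto simp: indicator_def)
  ultimately have *: "has_bochner_integral (count_space UNIV) (\<lambda>n. if n = m then f n else 0) (f m)"
    by simp
  show "integrable (count_space UNIV) (\<lambda>n. if n = m then f n else 0)"
    and "(LINT n|count_space UNIV. (if n = m then f n else 0)) = f m"
    using has_bochner_integral_iff[THEN iffD1, OF *] by auto
qed

context
  fixes m :: "int ^ 'n" and p :: real and a :: "real ^ 'n"
  assumes p: "p > 0"
begin

lemma wave_integrable: "integrable space_measure (wave m p a)"
  and wave_square_integrable: "square_integrable space_measure (wave m p a)"
proof -
  show int: "integrable space_measure (wave m p a)"
    unfolding wave_def[abs_def] space_measure_def
    using lborel_integral_translate(1)[OF integrable_gaussian[OF p], of a]
    by (intro integrable_prod[OF sigma_finite_torus sigma_finite_lborel] torus_bounded_integrable[where C = 1]) auto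
  show "square_integrable space_measure (wave m p a)"
    by (rule square_integrable_if_bounded[OF int, of 1])
      (auto simp: wave_def norm_mult abs_of_pos gaussian_pos gaussian_le_1 less_imp_le[OF p])
qed

lemma integral_wave_cnj_kernel:
  "(LINT x|space_measure. wave m p a x * cnj (fourier_kernel x y)) = wave_hat m p a y"
proof -
  obtain n t where y: "y = (n, t)" by (cases y)
  define g where "g = (\<lambda>s. complex_of_real (gaussian p s) * cis (2 * pi * (t \<bullet> s)))"
  have g: "integrable lborel g" unfolding g_def by (rule gaussian_vec(1)[OF p])
  have g': "of_real (gaussian p (s - a)) * cis (2 * pi * (t \<bullet> s)) = cis (2 * pi * (t \<bullet> a)) * g (s - a)" for s
  proof -
    have "cis (2 * pi * (t \<bullet> s)) = cis (2 * pi * (t \<bullet> a)) * cis (2 * pi * (t \<bullet> (s - a)))"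
      by (simp add: cis_mult inner_diff_right algebra_simps)
    then show ?thesis by (simp only: g_def mult_ac)
  qed
  have "wave m p a x * cnj (fourier_kernel x y) =
      torus_char (m - n) (fst x) * (cis (2 * pi * (t \<bullet> a)) * g (snd x - a))" for x
  proof -
    have "wave m p a x * cnj (fourier_kernel x y) =
        (torus_char m (fst x) * of_real (gaussian p (snd x - a))) * (torus_char (- n) (fst x) * cis (2 * pi * (t \<bullet> snd x)))"
      by (simp add: wave_def fourier_kernel_def y cnj_torus_char cis_cnj)
    also have "\<dots> = (torus_char m (fst x) * torus_char (- n) (fst x)) *
        (of_real (gaussian p (snd x - a)) * cis (2 * pi * (t \<bullet> snd x)))"
      by (simp only: mult_ac)
    also have "\<dots> = torus_char (m - n) (fst x) * (cis (2 * pi * (t \<bullet> a)) * g (snd x - a))"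
      by (simp only: g' torus_char_add[symmetric] add_uminus_conv_diff)
    finally show ?thesis .
  qed
  then have "(LINT x|space_measure. wave m p a x * cnj (fourier_kernel x y)) =
      (LINT x|(torus_measure \<Otimes>\<^sub>M lborel). torus_char (m - n) (fst x) * (cis (2 * pi * (t \<bullet> a)) * g (snd x - a)))"
    by (simp add: space_measure_def)
  also have "\<dots> = (LINT \<theta>|torus_measure. torus_char (m - n) \<theta>) * (LINT s|lborel. cis (2 * pi * (t \<bullet> a)) * g (s - a))"
    by (intro integrable_prod(2)[OF sigma_finite_torus sigma_finite_lborel] torus_bounded_integrable[where C = 1]
        integrable_mult_right lborel_integral_translate(1) g) auto
  also have "\<dots> = wave_hat m p a y"
    using gaussian_vec(2)[OF p, of t] lborel_integral_translate(2)[OF g, of a]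
    by (auto simp: integral_torus_char wave_hat_def y g_def)
  finally show ?thesis .
qed

lemma wave_hat_gaussian_integrable:
  "integrable lborel (\<lambda>t :: real ^ 'n. cis (2 * pi * (t \<bullet> a)) * of_real ((1 / sqrt p) ^ CARD('n) * gaussian (1 / p) t))"
proof -
  have "integrable lborel (\<lambda>t :: real ^ 'n. of_real ((1 / sqrt p) ^ CARD('n)) * (of_real (gaussian (1 / p) t) * cis (2 * pi * (a \<bullet> t))))"
    using p by (intro integrable_mult_right gaussian_vec(1)) simp
  then show ?thesis by (simp add: mult_ac inner_commute)
qed

lemma wave_hat_integrable: "integrable freq_measure (wave_hat m p a)"
  and wave_hat_square_integrable: "square_integrable freq_measure (wave_hat m p a)"
proof -
  show int: "integrable freq_measure (wave_hat m p a)"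
    unfolding wave_hat_def[abs_def] freq_measure_def
    by (intro integrable_prod[OF sigma_finite_count sigma_finite_lborel] count_space_point_integrable
        wave_hat_gaussian_integrable)
  show "square_integrable freq_measure (wave_hat m p a)"
  proof (rule square_integrable_if_bounded[OF int, of "(1 / sqrt p) ^ CARD('n)"])
    fix y :: "(int ^ 'n) \<times> (real ^ 'n)"
    define C where "C = (1 / sqrt p) ^ CARD('n)"
    have "gaussian (1 / p) (snd y) \<le> 1" "0 < gaussian (1 / p) (snd y)"
      using p by (auto intro: gaussian_le_1 gaussian_pos)
    moreover have "0 \<le> C" using p by (simp add: C_def)
    ultimately have "cmod (of_real (C * gaussian (1 / p) (snd y))) \<le> C"
      unfolding norm_of_real by (simp add: abs_mult mult_left_le)
    then show "cmod (wave_hat m p a y) \<le> (1 / sqrt p) ^ CARD('n)"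
      using \<open>0 \<le> C\<close> unfolding wave_hat_def norm_mult C_def[symmetric] by (simp del: of_real_mult)
  qed
qed

lemma integral_kernel_wave_hat:
  "(LINT y|freq_measure. fourier_kernel x y * wave_hat m p a y) = wave m p a x"
proof -
  obtain \<theta> s where x: "x = (\<theta>, s)" by (cases x)
  define C where "C = (1 / sqrt p) ^ CARD('n)"
  define g where "g = (\<lambda>t :: real ^ 'n. complex_of_real C * (of_real (gaussian (1 / p) t) * cis (2 * pi * ((a - s) \<bullet> t))))"
  have p': "1 / p > 0" using p by simp
  have g: "integrable lborel g"
    unfolding g_def by (intro integrable_mult_right gaussian_vec(1)[OF p'])
  have "fourier_kernel x y * wave_hat m p a y = (if fst y = m then torus_char (fst y) \<theta> else 0) * g (snd y)" for y
  proof -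
    obtain n t where y: "y = (n, t)" by (cases y)
    have "cis (- 2 * pi * (t \<bullet> s)) * cis (2 * pi * (t \<bullet> a)) = cis (2 * pi * ((a - s) \<bullet> t))"
      by (simp add: cis_mult inner_diff_left inner_commute algebra_simps)
    then have eq: "(z * cis (- 2 * pi * (t \<bullet> s))) * (cis (2 * pi * (t \<bullet> a)) * w) = z * (w * cis (2 * pi * ((a - s) \<bullet> t)))"
      for z w by (metis mult.assoc mult.commute)
    show ?thesis
    proof (cases "n = m")
      case True
      then show ?thesis
        using eq[of "torus_char m \<theta>" "of_real (C * gaussian (1 / p) t)"]
        by (simp only: fourier_kernel_def wave_hat_def x y g_def C_def[symmetric] fst_conv snd_conv if_True
            simp_thms mult_1_left of_real_mult mult.assoc)
    qed (simp add: wave_hat_def y)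
  qed
  then have "(LINT y|freq_measure. fourier_kernel x y * wave_hat m p a y) =
      (LINT y|(count_space UNIV \<Otimes>\<^sub>M lborel). (if fst y = m then torus_char (fst y) \<theta> else 0) * g (snd y))"
    by (simp add: freq_measure_def)
  also have "\<dots> = (LINT n|count_space UNIV. (if n = m then torus_char n \<theta> else 0)) * (LINT t|lborel. g t)"
    by (intro integrable_prod(2)[OF sigma_finite_count sigma_finite_lborel, where f = "\<lambda>n. if n = m then torus_char n \<theta> else 0"]
        count_space_point_integrable g)
  also have "(LINT t|lborel. g t) = of_real (C * ((1 / sqrt (1 / p)) ^ CARD('n) * gaussian (1 / (1 / p)) (a - s)))"
    unfolding g_def using gaussian_vec(2)[OF p', of "a - s"] by simp
  also have "C * ((1 / sqrt (1 / p)) ^ CARD('n) * gaussian (1 / (1 / p)) (a - s)) = gaussian p (s - a)"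
  proof -
    have "1 / sqrt p * (1 / sqrt (1 / p)) = 1" using p by (simp add: real_sqrt_divide)
    then have "C * (1 / sqrt (1 / p)) ^ CARD('n) = 1"
      unfolding C_def power_mult_distrib[symmetric] by simp
    then show ?thesis by (simp add: gaussian_def norm_minus_commute flip: mult.assoc)
  qed
  finally show ?thesis by (simp add: count_space_point_integrable(2) wave_def x)
qed

end

inductive trig_poly :: "(real ^ 'n \<Rightarrow> complex) \<Rightarrow> bool" where
  char: "trig_poly (torus_char m)"
| add: "trig_poly f \<Longrightarrow> trig_poly g \<Longrightarrow> trig_poly (\<lambda>\<theta>. f \<theta> + g \<theta>)"
| scale: "trig_poly f \<Longrightarrow> trig_poly (\<lambda>\<theta>. c * f \<theta>)"

lemma trig_poly_mult: "trig_poly f \<Longrightarrow> trig_poly g \<Longrightarrow> trig_poly (\<lambda>\<theta>. f \<theta> * g \<theta>)"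
proof (induction f rule: trig_poly.induct)
  case (char m)
  from \<open>trig_poly g\<close> show ?case
  proof (induction g rule: trig_poly.induct)
    case (char n)
    have "(\<lambda>\<theta>. torus_char m \<theta> * torus_char n \<theta>) = torus_char (m + n)" by (simp add: fun_eq_iff torus_char_add)
    then show ?case by (simp add: trig_poly.char)
  next
    case (add f g)
    then show ?case using trig_poly.add by (fastforce simp: distrib_left)
  next
    case (scale f c)
    have "(\<lambda>\<theta>. torus_char m \<theta> * (c * f \<theta>)) = (\<lambda>\<theta>. c * (torus_char m \<theta> * f \<theta>))" by (simp add: mult_ac)
    then show ?case using trig_poly.scale[OF scale.IH] by simp
  qed
next
  case (add f g)
  then show ?case using trig_poly.add by (fastforce simp: distrib_right)
next
  case (scale f c)
  have "(\<lambda>\<theta>. c * f \<theta> * g \<theta>) = (\<lambda>\<theta>. c * (f \<theta> * g \<theta>))" for g by (simp add: mult_ac)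
  then show ?case using trig_poly.scale[of _ c] scale by simp
qed

lemma trig_poly_1: "trig_poly (\<lambda>_ :: real ^ 'n. 1)"
proof -
  have "(torus_char 0 :: real ^ 'n \<Rightarrow> complex) = (\<lambda>_. 1)" by (simp add: fun_eq_iff)
  then show ?thesis by (metis trig_poly.char)
qed

lemma trig_poly_prod: "(\<And>j. j \<in> J \<Longrightarrow> trig_poly (f j)) \<Longrightarrow> trig_poly (\<lambda>\<theta>. \<Prod>j\<in>J. f j \<theta>)"
  by (induction J rule: infinite_finite_induct) (auto intro: trig_poly_1 trig_poly_mult)

lemma trig_poly_power: "trig_poly f \<Longrightarrow> trig_poly (\<lambda>\<theta>. f \<theta> ^ k)"
  by (induction k) (auto intro: trig_poly_1 trig_poly_mult)

text \<open>
  A trigonometric polynomial with values in \<open>[0, 1]\<close> that equals 1 only at \<open>a\<close> modulo \<open>\<int>\<^sup>N\<close>. Its powers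
  concentrate at \<open>a\<close>, and they lie in the span of the characters.
\<close>

definition cos_bump :: "real ^ 'n \<Rightarrow> real ^ 'n \<Rightarrow> real" where
  "cos_bump a \<theta> = (\<Prod>j\<in>UNIV. (1 + cos (2 * pi * (\<theta> $ j - a $ j))) / 2)"

lemma trig_poly_cos_bump: "trig_poly (\<lambda>\<theta>. of_real (cos_bump a \<theta>))"
  unfolding cos_bump_def of_real_prod
proof (rule trig_poly_prod)
  fix j
  define e :: "int ^ 'a" where "e = axis j 1"
  have "real_of_int (e $ i) * \<theta> $ i = (if i = j then \<theta> $ i else 0)" for \<theta> i
    by (simp add: e_def axis_def)
  then have "(\<Sum>i\<in>UNIV. real_of_int (e $ i) * \<theta> $ i) = \<theta> $ j" for \<theta>
    by simp
  then have e: "torus_char e \<theta> = cis (- (2 * pi * \<theta> $ j))" "torus_char (- e) \<theta> = cis (2 * pi * \<theta> $ j)" for \<theta>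
    by (simp_all add: torus_char_def sum_negf)
  define c where "c = cis (2 * pi * a $ j)"
  have "complex_of_real ((1 + cos (2 * pi * (\<theta> $ j - a $ j))) / 2) =
      1 / 2 * torus_char 0 \<theta> + (c / 4 * torus_char e \<theta> + cnj c / 4 * torus_char (- e) \<theta>)" for \<theta>
  proof -
    have "c * torus_char e \<theta> = cis (- (2 * pi * (\<theta> $ j - a $ j)))" "cnj c * torus_char (- e) \<theta> = cis (2 * pi * (\<theta> $ j - a $ j))"
      by (simp_all add: c_def e cis_mult cis_cnj algebra_simps)
    then have "c / 4 * torus_char e \<theta> + cnj c / 4 * torus_char (- e) \<theta> =
        (cis (- (2 * pi * (\<theta> $ j - a $ j))) + cis (2 * pi * (\<theta> $ j - a $ j))) / 4"
      by (simp add: field_simps)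
    also have "\<dots> = of_real (cos (2 * pi * (\<theta> $ j - a $ j)) / 2)"
      by (simp add: complex_eq_iff)
    finally show ?thesis by (simp add: field_simps)
  qed
  then have eq: "(\<lambda>\<theta>. complex_of_real ((1 + cos (2 * pi * (\<theta> $ j - a $ j))) / 2)) =
      (\<lambda>\<theta>. 1 / 2 * torus_char 0 \<theta> + (c / 4 * torus_char e \<theta> + cnj c / 4 * torus_char (- e) \<theta>))" by blast
  show "trig_poly (\<lambda>\<theta>. complex_of_real ((1 + cos (2 * pi * (\<theta> $ j - a $ j))) / 2))"
    unfolding eq by (intro trig_poly.intros)
qed

section \<open>The inversion formula\<close>

text \<open>
  If \<open>f\<close> is nonnegative where \<open>\<kappa>\<close> is close to its peak and positive on \<open>W\<close>, its integrals against high
  powers of \<open>\<kappa>\<close> cannot all vanish: the powers of \<open>\<kappa>\<close> on \<open>W\<close> eventually dominate those away from the peak.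
\<close>

lemma peak_kernel:
  fixes f \<kappa> :: "'a \<Rightarrow> real"
  assumes int: "\<And>k. k \<ge> 1 \<Longrightarrow> integrable M (\<lambda>x. f x * \<kappa> x ^ k)"
    and zero: "\<And>k. k \<ge> 1 \<Longrightarrow> (LINT x|M. f x * \<kappa> x ^ k) = 0"
    and \<kappa>: "\<And>x. 0 \<le> \<kappa> x"
    and \<rho>: "0 < \<rho>" "\<rho> < \<rho>'" and \<eta>: "0 < \<eta>"
    and W: "W \<in> sets M" "0 < emeasure M W" "emeasure M W < \<infinity>"
    and on_W: "\<And>x. x \<in> W \<Longrightarrow> \<eta> \<le> f x \<and> \<rho>' \<le> \<kappa> x"
    and off_W: "\<And>x. x \<in> space M \<Longrightarrow> 0 \<le> f x \<or> \<kappa> x \<le> \<rho>"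
  shows False
proof -
  define C where "C = (LINT x|M. \<bar>f x * \<kappa> x ^ 1\<bar>)"
  have int1: "integrable M (\<lambda>x. \<bar>f x * \<kappa> x ^ 1\<bar>)" using int[of 1] by (intro integrable_abs) simp
  have "measure M W > 0" using W by (simp add: measure_def enn2real_positive_iff)
  have le: "\<eta> * \<rho>' * measure M W * (\<rho>' / \<rho>) ^ q \<le> C" for q
  proof -
    \<comment> \<open>On \<open>W\<close> the integrand is bounded below, where \<open>f\<close> is nonnegative it may be dropped, and
       elsewhere one factor \<open>\<kappa>\<close> is kept for integrability.\<close>
    have ptw: "\<eta> * \<rho>' ^ Suc q * indicator W x - \<rho> ^ q * \<bar>f x * \<kappa> x ^ 1\<bar> \<le> f x * \<kappa> x ^ Suc q" if "x \<in> space M" for x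
    proof (cases "0 \<le> f x")
      case True
      then have "\<eta> * \<rho>' ^ Suc q * indicator W x \<le> f x * \<kappa> x ^ Suc q"
      proof (cases "x \<in> W")
        case True
        then show ?thesis using on_W[OF True] \<eta> \<rho> by (auto intro!: mult_mono power_mono simp del: power_Suc)
      qed (use \<kappa> True in simp)
      moreover have "0 \<le> \<rho> ^ q * \<bar>f x * \<kappa> x ^ 1\<bar>" using \<rho> by simp
      ultimately show ?thesis by linarith
    next
      case False
      then have "x \<notin> W" using on_W \<eta> by force
      have "\<kappa> x \<le> \<rho>" using False off_W[OF that] by simp
      then have "\<kappa> x ^ q \<le> \<rho> ^ q" using \<kappa> by (intro power_mono)
      then have "(- f x * \<kappa> x) * \<kappa> x ^ q \<le> (- f x * \<kappa> x) * \<rho> ^ q"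
        using False \<kappa> by (intro mult_left_mono) (simp_all add: mult_nonpos_nonneg)
      then show ?thesis using \<open>x \<notin> W\<close> False \<kappa>[of x] by (simp add: abs_mult mult_ac)
    qed
    have iW: "integrable M (indicator W :: 'a \<Rightarrow> real)" using W by (intro integrable_real_indicator) auto
    have "(LINT x|M. \<eta> * \<rho>' ^ Suc q * indicator W x - \<rho> ^ q * \<bar>f x * \<kappa> x ^ 1\<bar>) \<le> (LINT x|M. f x * \<kappa> x ^ Suc q)"
      using iW int1 int[of "Suc q"] ptw by (intro integral_mono) auto
    also have "\<dots> = 0" by (rule zero) simp
    also have "(LINT x|M. \<eta> * \<rho>' ^ Suc q * indicator W x - \<rho> ^ q * \<bar>f x * \<kappa> x ^ 1\<bar>) = \<eta> * \<rho>' ^ Suc q * measure M W - \<rho> ^ q * C"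
      using iW int1 W unfolding C_def
      by (subst Bochner_Integration.integral_diff) (simp_all del: power_one_right add: sets.Int_space_eq2)
    finally have "\<eta> * \<rho>' * measure M W * \<rho>' ^ q \<le> C * \<rho> ^ q" by (simp add: mult_ac)
    then show ?thesis using \<rho> by (simp add: power_divide pos_divide_le_eq)
  qed
  define A where "A = \<eta> * \<rho>' * measure M W"
  have A: "A > 0" using \<open>measure M W > 0\<close> \<eta> \<rho> by (simp add: A_def)
  have "1 < \<rho>' / \<rho>" using \<rho> by simp
  then obtain q where "C / A < (\<rho>' / \<rho>) ^ q" using real_arch_pow by blast
  then have "C < A * (\<rho>' / \<rho>) ^ q" using A by (simp add: pos_divide_less_eq mult.commute)
  then show False using le[of q] by (simp add: A_def)
qed

lemma half_one_plus_cos: "0 \<le> (1 + cos x) / 2" "(1 + cos x) / 2 \<le> 1" for x :: real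
proof -
  have "0 \<le> 1 + cos x" by (smt (verit) cos_ge_minus_one)
  then show "0 \<le> (1 + cos x) / 2" by simp
  have "1 + cos x \<le> 2" by (smt (verit) cos_le_one)
  then show "(1 + cos x) / 2 \<le> 1" by simp
qed

lemma cos_bump_bounds: "0 \<le> cos_bump a \<theta>" "cos_bump a \<theta> \<le> 1"
  unfolding cos_bump_def using half_one_plus_cos by (auto intro!: prod_nonneg prod_le_1)

lemma cos_bump_self: "cos_bump a a = 1"
  by (simp add: cos_bump_def)

lemma cos_bump_less_1:
  assumes "\<And>j. \<bar>\<theta> $ j - a $ j\<bar> < 1" "\<theta> \<noteq> a"
  shows "cos_bump a \<theta> < 1"
proof -
  define c where "c = (\<lambda>j. (1 + cos (2 * pi * (\<theta> $ j - a $ j))) / 2)"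
  have c: "0 \<le> c j" "c j \<le> 1" for j
    unfolding c_def by (rule half_one_plus_cos)+
  obtain i where i: "\<theta> $ i \<noteq> a $ i" using assms(2) by (auto simp: Finite_Cartesian_Product.vec_eq_iff)
  have "cos (2 * pi * (\<theta> $ i - a $ i)) \<noteq> 1"
  proof
    assume "cos (2 * pi * (\<theta> $ i - a $ i)) = 1"
    then obtain n :: int where "2 * pi * (\<theta> $ i - a $ i) = real_of_int n * 2 * pi"
      unfolding cos_one_2pi_int by auto
    then have "\<theta> $ i - a $ i = of_int n" by simp
    then have "n = 0" using assms(1)[of i] by linarith
    then show False using i \<open>\<theta> $ i - a $ i = of_int n\<close> by simp
  qed
  then have "cos (2 * pi * (\<theta> $ i - a $ i)) < 1" by (rule le_neq_trans[OF cos_le_one])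
  then have "c i < 1" by (simp add: c_def)
  have "cos_bump a \<theta> = c i * (\<Prod>j\<in>UNIV - {i}. c j)"
    unfolding cos_bump_def c_def by (rule prod.remove) auto
  also have "\<dots> \<le> c i * 1" using c by (intro mult_left_mono prod_le_1) auto
  finally show ?thesis using \<open>c i < 1\<close> by simp
qed

lemma continuous_cos_bump [continuous_intros]:
  fixes f :: "'b::t2_space \<Rightarrow> real ^ 'n"
  shows "continuous_on A f \<Longrightarrow> continuous_on A (\<lambda>x. cos_bump a (f x))"
  unfolding cos_bump_def by (intro continuous_intros) auto

context
  fixes F :: "(real ^ 'n) \<times> (real ^ 'n) \<Rightarrow> complex" and Fh
  assumes F_cont: "continuous_on UNIV F" and F_sq: "square_integrable space_measure F"
    and F_per: "torus_periodic F"
    and Fh: "is_fourier F Fh" and Fh_int: "integrable freq_measure Fh"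
begin

definition inversion_error :: "(real ^ 'n) \<times> (real ^ 'n) \<Rightarrow> complex" where
  "inversion_error x = F x - inverse_fourier Fh x"

text \<open>
  Paired with a wave, both \<open>F\<close> and the inverse transform of \<open>Fh\<close> give the pairing of \<open>Fh\<close> with the transform
  of the wave.
\<close>

lemma inversion_error_wave:
  assumes p: "p > 0"
  shows "integrable space_measure (\<lambda>x. inversion_error x * wave m p a x)"
    and "(LINT x|space_measure. inversion_error x * wave m p a x) = 0"
proof -
  note F_int = square_integrable_mult[OF F_sq wave_square_integrable[OF p, of m a]]
  note I = inverse_fourier_multiplication[OF Fh_int wave_integrable[OF p, of m a]]
  have "(LINT y|freq_measure. Fh y * wave_hat m p a y) = (LINT x|space_measure. F x * wave m p a x)"
    by (rule fourier_multiplication[OF F_sq Fh wave_hat_integrable[OF p] wave_hat_square_integrable[OF p]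
          integral_kernel_wave_hat[OF p, symmetric] wave_square_integrable[OF p]])
  then show "(LINT x|space_measure. inversion_error x * wave m p a x) = 0"
    using F_int I by (simp add: inversion_error_def left_diff_distrib integral_wave_cnj_kernel[OF p])
  show "integrable space_measure (\<lambda>x. inversion_error x * wave m p a x)"
    using F_int I by (simp add: inversion_error_def left_diff_distrib)
qed

lemma inversion_error_trig_poly:
  assumes "trig_poly q" and p: "p > 0"
  shows "integrable space_measure (\<lambda>x. inversion_error x * (q (fst x) * of_real (gaussian p (snd x - a)))) \<and>
    (LINT x|space_measure. inversion_error x * (q (fst x) * of_real (gaussian p (snd x - a)))) = 0"
  using assms(1)
proof (induction q rule: trig_poly.induct)
  case (char m)
  then show ?case using inversion_error_wave[OF p] by (simp add: wave_def)
next
  case (add f g)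
  then show ?case by (simp add: distrib_left distrib_right)
next
  case (scale f c)
  have "inversion_error x * (c * f (fst x) * of_real (gaussian p (snd x - a))) =
      c * (inversion_error x * (f (fst x) * of_real (gaussian p (snd x - a))))" for x
    by (simp add: mult_ac)
  then show ?case
    using scale.IH by (simp only:) simp
qed

lemma continuous_inversion_error: "continuous_on UNIV inversion_error"
  unfolding inversion_error_def[abs_def]
  by (intro continuous_on_diff F_cont continuous_inverse_fourier Fh_int)

text \<open>
  The powers of \<open>\<kappa>\<close>, a bump in \<open>\<theta>\<close> times a Gaussian in \<open>s\<close>, are combinations of waves, so the integrals of
  the continuous inversion error against all of them vanish. For \<open>\<theta>\<close> in the open cube \<open>\<kappa>\<close> has a single peak
  in the closed cube; for \<open>\<theta>\<close> on the boundary there would be several.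
\<close>

lemma inversion_error_interior:
  assumes \<theta>: "\<theta> \<in> box 0 (vec 1)"
  shows "inversion_error (\<theta>, s) = 0"
proof (rule ccontr)
  define D where "D = inversion_error"
  define x0 where "x0 = (\<theta>, s)"
  assume "inversion_error (\<theta>, s) \<noteq> 0"
  then have D0: "D x0 \<noteq> 0" by (simp add: D_def x0_def)
  define f where "f = (\<lambda>x. Re (cnj (D x0) * D x))"
  have f_cont: "continuous_on UNIV f"
    unfolding f_def D_def by (intro continuous_intros continuous_inversion_error)
  have "f x0 = (cmod (D x0))\<^sup>2" unfolding f_def cmod_power2 by (simp add: power2_eq_square)
  then have f0: "f x0 > 0" using D0 by simp
  define \<kappa> where "\<kappa> = (\<lambda>x :: (real ^ 'n) \<times> (real ^ 'n). cos_bump \<theta> (fst x) * gaussian 1 (snd x - s))"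
  have \<kappa>_cont: "continuous_on A \<kappa>" for A unfolding \<kappa>_def by (intro continuous_intros)
  have \<kappa>0: "0 \<le> \<kappa> x" for x by (simp add: \<kappa>_def cos_bump_bounds gaussian_pos less_imp_le)
  have \<kappa>_le_gauss: "\<kappa> x \<le> gaussian 1 (snd x - s)" for x
    unfolding \<kappa>_def using cos_bump_bounds[of \<theta> "fst x"] gaussian_pos[of 1 "snd x - s"]
    by (intro mult_left_le_one_le) auto
  have \<kappa>_less: "\<kappa> x < 1" if "fst x \<in> cbox 0 (vec 1)" "x \<noteq> x0" for x
  proof (cases "snd x = s")
    case True
    then have "fst x \<noteq> \<theta>" using that by (auto simp: x0_def prod_eq_iff)
    moreover have "\<bar>fst x $ j - \<theta> $ j\<bar> < 1" for j
    proof -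
      have "0 \<le> fst x $ j" "fst x $ j \<le> 1" "0 < \<theta> $ j" "\<theta> $ j < 1"
        using that(1) \<theta> by (simp_all add: mem_box_cart)
      then show ?thesis by linarith
    qed
    ultimately have "cos_bump \<theta> (fst x) < 1" by (intro cos_bump_less_1)
    then show ?thesis using True by (simp add: \<kappa>_def gaussian_def)
  next
    case False
    then have "gaussian 1 (snd x - s) < 1" by (simp add: gaussian_def)
    then show ?thesis using \<kappa>_le_gauss[of x] by linarith
  qed
  \<comment> \<open>The bound \<open>\<rho>\<close> for \<open>\<kappa>\<close> away from the peak comes from compactness near \<open>s\<close> and decay far from it.\<close>
  obtain \<delta> where \<delta>: "\<delta> > 0" "\<And>x. dist x x0 < \<delta> \<Longrightarrow> f x0 / 2 < f x"
  proof -
    have "open (f -` {f x0 / 2<..})" by (rule open_vimage[OF _ f_cont]) simp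
    moreover have "x0 \<in> f -` {f x0 / 2<..}" using f0 by simp
    ultimately obtain \<delta> where "\<delta> > 0" "\<forall>x. dist x x0 < \<delta> \<longrightarrow> x \<in> f -` {f x0 / 2<..}"
      unfolding open_dist by blast
    then show ?thesis using that by auto
  qed
  define K where "K = (cbox 0 (vec 1) \<times> cball s 1) - ball x0 \<delta>"
  have "compact K" unfolding K_def by (intro compact_diff compact_Times compact_cbox compact_cball) auto
  obtain r where r: "r < 1" "\<And>x. x \<in> K \<Longrightarrow> \<kappa> x \<le> r"
  proof (cases "K = {}")
    case False
    obtain y where y: "y \<in> K" "\<forall>x\<in>K. \<kappa> x \<le> \<kappa> y"
      using continuous_attains_sup[OF \<open>compact K\<close> False \<kappa>_cont] by blast
    have "\<kappa> y < 1" using y(1) \<delta>(1) by (intro \<kappa>_less) (auto simp: K_def)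
    then show ?thesis using that y(2) by blast
  qed (use that[of 0] in auto)
  define \<rho> where "\<rho> = max (max r (exp (- pi))) (1 / 2)"
  have \<rho>: "0 < \<rho>" "\<rho> < 1" using r by (auto simp: \<rho>_def)
  define \<rho>' where "\<rho>' = (1 + \<rho>) / 2"
  have \<rho>': "\<rho> < \<rho>'" "\<rho>' < 1" using \<rho> by (simp_all add: \<rho>'_def)
  have off: "\<kappa> x \<le> \<rho>" if "fst x \<in> cbox 0 (vec 1)" "\<delta> \<le> dist x x0" for x
  proof (cases "dist s (snd x) \<le> 1")
    case True
    then have "x \<in> K" using that by (auto simp: K_def dist_commute mem_Times_iff)
    then show ?thesis using r(2)[of x] by (simp add: \<rho>_def)
  next
    case False
    then have "1 \<le> (norm (snd x - s))\<^sup>2" by (simp add: dist_norm norm_minus_commute)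
    then have "gaussian 1 (snd x - s) \<le> exp (- pi)" by (simp add: gaussian_def)
    then show ?thesis using \<kappa>_le_gauss[of x] by (simp add: \<rho>_def)
  qed
  \<comment> \<open>The neighbourhood is shrunk to a product of balls, whose measure is positive and finite.\<close>
  define U where "U = \<kappa> -` {\<rho>'<..} \<inter> ball x0 \<delta> \<inter> (box 0 (vec 1) \<times> UNIV)"
  have "open U"
    unfolding U_def by (intro open_Int open_Times open_vimage \<kappa>_cont) auto
  moreover have "x0 \<in> U"
    using \<rho>' \<delta> \<theta> by (simp add: U_def \<kappa>_def x0_def cos_bump_self gaussian_def)
  ultimately obtain A B where AB: "open A" "open B" "x0 \<in> A \<times> B" "A \<times> B \<subseteq> U"
    by (rule open_prod_elim)
  obtain e1 where e1: "e1 > 0" "ball \<theta> e1 \<subseteq> A" using AB by (auto simp: x0_def open_contains_ball)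
  obtain e2 where e2: "e2 > 0" "ball s e2 \<subseteq> B" using AB by (auto simp: x0_def open_contains_ball)
  define W where "W = ball \<theta> e1 \<times> ball s e2"
  have WU: "W \<subseteq> U" using e1 e2 AB by (auto simp: W_def)
  have ball_cbox: "ball \<theta> e1 \<subseteq> cbox 0 (vec 1)"
  proof
    fix z assume "z \<in> ball \<theta> e1"
    then have "(z, s) \<in> U" using WU e2 by (auto simp: W_def)
    then show "z \<in> cbox 0 (vec 1)" using box_subset_cbox by (auto simp: U_def)
  qed
  have sets1: "ball \<theta> e1 \<in> sets torus_measure"
    unfolding torus_measure_def using ball_cbox by (subst sets_restrict_space_iff) auto
  have em: "emeasure space_measure W = emeasure lborel (ball \<theta> e1) * emeasure lborel (ball s e2)"
  proof -
    have "emeasure space_measure W = emeasure torus_measure (ball \<theta> e1) * emeasure lborel (ball s e2)"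
      unfolding W_def space_measure_def using sets1
      by (intro sigma_finite_measure.emeasure_pair_measure_Times sigma_finite_lborel) auto
    also have "emeasure torus_measure (ball \<theta> e1) = emeasure lborel (ball \<theta> e1)"
      unfolding torus_measure_def using ball_cbox by (intro emeasure_restrict_space) auto
    finally show ?thesis .
  qed
  have ball_pos: "0 < emeasure lborel (ball z e)" and ball_fin: "emeasure lborel (ball z e) < \<infinity>"
    if "e > 0" for z :: "real ^ 'n" and e :: real
  proof -
    show fin: "emeasure lborel (ball z e) < \<infinity>" by (rule emeasure_bounded_finite[OF bounded_ball])
    show "0 < emeasure lborel (ball z e)"
      using content_ball_pos[OF that, of z] fin by (simp add: measure_def enn2real_positive_iff)
  qed
  have powers: "of_real (\<kappa> x ^ k) = (of_real (cos_bump \<theta> (fst x)) ^ k) * complex_of_real (gaussian (real k) (snd x - s))" for x k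
    by (simp add: \<kappa>_def power_mult_distrib gaussian_def flip: exp_of_nat_mult)
  have int0: "integrable space_measure (\<lambda>x. D x * of_real (\<kappa> x ^ k)) \<and> (LINT x|space_measure. D x * of_real (\<kappa> x ^ k)) = 0"
    if "k \<ge> 1" for k
    unfolding powers D_def
    using inversion_error_trig_poly[OF trig_poly_power[OF trig_poly_cos_bump], of "real k" \<theta> k s] that by simp
  have f_eq: "f x * \<kappa> x ^ k = Re (cnj (D x0) * (D x * of_real (\<kappa> x ^ k)))" for x k
    by (simp add: f_def algebra_simps)
  show False
  proof (rule peak_kernel[of space_measure f \<kappa> \<rho> \<rho>' "f x0 / 2" W])
    fix k :: nat assume k: "k \<ge> 1"
    show "integrable space_measure (\<lambda>x. f x * \<kappa> x ^ k)"
      unfolding f_eq using int0[OF k] by (intro integrable_Re integrable_mult_right) auto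
    have "(LINT x|space_measure. f x * \<kappa> x ^ k) = Re (LINT x|space_measure. cnj (D x0) * (D x * of_real (\<kappa> x ^ k)))"
      unfolding f_eq using int0[OF k] by (intro integral_Re integrable_mult_right) auto
    also have "(LINT x|space_measure. cnj (D x0) * (D x * of_real (\<kappa> x ^ k))) = 0"
      using int0[OF k] by simp
    finally show "(LINT x|space_measure. f x * \<kappa> x ^ k) = 0" by simp
  next
    show "W \<in> sets space_measure" unfolding W_def space_measure_def using sets1 by (intro pair_measureI) auto
    show "0 < emeasure space_measure W" unfolding em using ball_pos e1 e2 by (simp add: ennreal_zero_less_mult_iff)
    show "emeasure space_measure W < \<infinity>" unfolding em using ball_fin e1 e2 by (simp add: ennreal_mult_less_top)
  next
    fix x assume "x \<in> W"
    then have "x \<in> U" using WU by auto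
    then show "f x0 / 2 \<le> f x \<and> \<rho>' \<le> \<kappa> x" using \<delta>(2)[of x] by (auto simp: U_def dist_commute)
  next
    fix x :: "(real ^ 'n) \<times> (real ^ 'n)" assume "x \<in> space space_measure"
    then have "fst x \<in> cbox 0 (vec 1)"
      by (auto simp: space_measure_def space_pair_measure space_torus)
    then show "0 \<le> f x \<or> \<kappa> x \<le> \<rho>"
      using off[of x] \<delta>(2)[of x] f0 by (cases "dist x x0 < \<delta>") auto
  qed (use \<kappa>0 \<rho> \<rho>' f0 in auto)
qed

lemma inversion_error_eq_0: "inversion_error (\<theta>, s) = 0"
proof -
  have cube: "inversion_error (\<theta>, s) = 0" if "\<theta> \<in> cbox 0 (vec 1)" for \<theta>
  proof (rule continuous_constant_on_closure[of "box 0 (vec 1)" "\<lambda>\<theta>. inversion_error (\<theta>, s)"])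
    show "continuous_on (closure (box 0 (vec 1))) (\<lambda>\<theta>. inversion_error (\<theta>, s))"
      by (rule continuous_on_compose2[OF continuous_inversion_error]) (auto intro!: continuous_intros)
    have "(vec (1 / 2) :: real ^ 'n) \<in> box 0 (vec 1)"
      by (simp add: mem_box_cart)
    then show "\<theta> \<in> closure (box 0 (vec 1))" using that by (subst closure_box) auto
  qed (rule inversion_error_interior)
  define k :: "int ^ 'n" where "k = (\<chi> j. \<lfloor>\<theta> $ j\<rfloor>)"
  define \<theta>' where "\<theta>' = (\<chi> j. frac (\<theta> $ j))"
  have "\<theta> = \<theta>' + (\<chi> j. of_int (k $ j))"
    by (simp add: Finite_Cartesian_Product.vec_eq_iff k_def \<theta>'_def frac_def)
  moreover have "\<theta>' \<in> cbox 0 (vec 1)"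
    by (simp add: mem_box_cart \<theta>'_def frac_ge_0 less_imp_le[OF frac_lt_1])
  moreover have "inversion_error (\<theta>' + (\<chi> j. of_int (k $ j)), s) = inversion_error (\<theta>', s)"
    using F_per by (simp add: inversion_error_def inverse_fourier_periodic[OF Fh_int] torus_periodic_def)
  ultimately show ?thesis using cube by simp
qed

end

theorem fourier_inversion:
  fixes F :: "(real ^ 'n) \<times> (real ^ 'n) \<Rightarrow> complex"
  assumes F: "F \<in> test_functions"
  shows "integrable freq_measure (fourier F)" and "F x = inverse_fourier (fourier F) x"
proof -
  obtain Fh where Fh: "is_fourier F Fh" "integrable freq_measure Fh"
    using F by (auto simp: test_functions_def)
  have sq: "square_integrable space_measure F" using F by (simp add: test_functions_def)
  have f: "is_fourier F (fourier F)" unfolding fourier_def by (rule someI[of "is_fourier F", OF Fh(1)])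
  have "AE y in freq_measure. fourier F y = Fh y" by (rule is_fourier_unique[OF sq f Fh(1)])
  then show int: "integrable freq_measure (fourier F)"
    using Fh f by (subst integrable_cong_AE[where g = Fh]) (auto simp: is_fourier_def square_integrable_def)
  show "F x = inverse_fourier (fourier F) x"
    using inversion_error_eq_0[OF _ sq _ f int, of "fst x" "snd x"] F
    by (simp add: inversion_error_def[OF _ sq _ f int] test_functions_def)
qed

section \<open>The equidistribution bound\<close>

text \<open>
  Both growth conditions in one inequality: beyond \<open>y\<close> the function is at least its value at \<open>y\<close>, and before
  \<open>y\<close> it decays at most like the square root.
\<close>

lemma growth_comparison:
  fixes G :: "real \<Rightarrow> real"
  assumes pos: "\<And>x. x > 0 \<Longrightarrow> G x > 0" and mono: "mono_on {0<..} G"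
    and anti: "antimono_on {0<..} (\<lambda>x. G x / sqrt x)"
    and x: "0 < x" and y: "0 < y"
  shows "G y * min 1 (sqrt (x / y)) \<le> G x"
proof (cases "y \<le> x")
  case True
  then have "G y \<le> G x" using mono x y by (auto simp: mono_on_def)
  moreover have "G y * min 1 (sqrt (x / y)) \<le> G y * 1"
    using pos[OF y] by (intro mult_left_mono) auto
  ultimately show ?thesis by simp
next
  case False
  then have "G y / sqrt y \<le> G x / sqrt x" using anti x y by (auto simp: monotone_on_def)
  then have "G y * sqrt (x / y) \<le> G x" using x y by (simp add: real_sqrt_divide field_simps)
  moreover have "G y * min 1 (sqrt (x / y)) \<le> G y * sqrt (x / y)"
    using pos[OF y] by (intro mult_left_mono) auto
  ultimately show ?thesis by simp
qed

lemma cmod_cis_minus_1: "cmod (cis x - 1) \<le> \<bar>x\<bar>"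
proof -
  have "(cmod (cis x - 1))\<^sup>2 = (2 * sin (x / 2))\<^sup>2"
  proof -
    have "(cmod (cis x - 1))\<^sup>2 = (cos x - 1)\<^sup>2 + (sin x)\<^sup>2" by (simp add: cmod_power2)
    also have "\<dots> = 2 - 2 * cos x" using sin_cos_squared_add[of x] by (simp add: power2_eq_square algebra_simps)
    also have "cos x = 1 - 2 * (sin (x / 2))\<^sup>2" using cos_double_sin[of "x / 2"] by simp
    finally show ?thesis by (simp add: power_mult_distrib)
  qed
  also have "\<dots> \<le> \<bar>x\<bar>\<^sup>2"
    unfolding power2_abs[of "2 * sin (x / 2)", symmetric]
    using abs_sin_x_le_abs_x[of "x / 2"] by (intro power_mono) (auto simp: abs_mult)
  finally show ?thesis by (rule power2_le_imp_le) simp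
qed

lemma l1norm_pos: "n \<noteq> 0 \<Longrightarrow> l1norm n \<ge> 1"
proof -
  assume "n \<noteq> 0"
  then obtain j where "n $ j \<noteq> 0" by (auto simp: Finite_Cartesian_Product.vec_eq_iff)
  then have "1 \<le> nat \<bar>n $ j\<bar>" by simp
  also have "\<dots> \<le> l1norm n" unfolding l1norm_def by (rule member_le_sum) auto
  finally show ?thesis .
qed

context
  fixes \<xi> :: "complex ^ 'n"
  assumes alg: "\<And>j. algebraic (\<xi> $ j)" and nz: "\<And>j. \<xi> $ j \<noteq> 0"
begin

lemma character_xi: "algebraic (character n \<xi>)" "character n \<xi> \<noteq> 0"
  using character_algebraic[OF alg nz orbit_refl[OF alg]] character_nonzero[OF alg nz orbit_refl[OF alg]] by auto

lemma gen_degree_le: "n \<noteq> 0 \<Longrightarrow> gen_degree \<xi> \<le> l1norm n * alg_degree (character n \<xi>)"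
  unfolding gen_degree_def by (rule cINF_lower) auto

lemma gen_degree_pos: "gen_degree \<xi> \<ge> 1"
proof -
  have "(1 :: int ^ 'n) \<noteq> 0" by (simp add: Finite_Cartesian_Product.vec_eq_iff)
  then have "gen_degree \<xi> \<in> (\<lambda>n. l1norm n * alg_degree (character n \<xi>)) ` (UNIV - {0})"
    unfolding gen_degree_def by (intro Inf_nat_def1) blast
  then obtain n where n: "n \<noteq> 0" "gen_degree \<xi> = l1norm n * alg_degree (character n \<xi>)" by auto
  then show ?thesis using l1norm_pos[OF n(1)] alg_degree_pos[OF character_xi(1), of n] by simp
qed

lemma height_D_pos: "height_D \<xi> > 0"
proof -
  have "0 < ln (2 * real (gen_degree \<xi>)) / (3 * real (gen_degree \<xi>))"
    using gen_degree_pos by (intro divide_pos_pos) auto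
  then show ?thesis using height_nonneg[OF alg nz] by (simp add: height_D_def)
qed

text \<open>
  The degree \<open>D\<close> may exceed the generalized degree divided by \<open>\<parallel>n\<parallel>\<^sub>1\<close>; the monotonicity of \<open>ln (2 k) / k\<close>
  turns the bound for the degree into one for the penalty.
\<close>

lemma character_height_D:
  assumes n: "n \<noteq> 0"
  defines "D \<equiv> alg_degree (character n \<xi>)"
  shows "weil_height (character n \<xi>) + ln (2 * real D) / (3 * real D) \<le> real (l1norm n) * height_D \<xi>"
proof -
  define l where "l = l1norm n"
  define d where "d = gen_degree \<xi>"
  have pos: "l \<ge> 1" "D \<ge> 1" "d \<ge> 1"
    using l1norm_pos[OF n] alg_degree_pos[OF character_xi(1), of n] gen_degree_pos by (auto simp: l_def D_def d_def)
  have "ln (2 * real D) / real D \<le> ln (2 * real (l * D)) / real D"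
    using pos by (intro divide_right_mono ln_mono) auto
  also have "\<dots> = real l * (ln (2 * real (l * D)) / real (l * D))" using pos by simp
  also have "\<dots> \<le> real l * (ln (2 * real d) / real d)"
    using gen_degree_le[OF n] pos by (intro mult_left_mono ln_double_div_antimono) (auto simp: d_def l_def D_def)
  finally have "ln (2 * real D) / real D \<le> real l * (ln (2 * real d) / real d)" .
  then have "ln (2 * real D) / real D / 3 \<le> real l * (ln (2 * real d) / real d) / 3"
    by (rule divide_right_mono) simp
  moreover have "ln (2 * real D) / (3 * real D) = ln (2 * real D) / real D / 3" by simp
  moreover have "real l * (ln (2 * real d) / (3 * real d)) = real l * (ln (2 * real d) / real d) / 3" by simp
  ultimately have "ln (2 * real D) / (3 * real D) \<le> real l * (ln (2 * real d) / (3 * real d))"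
    by (simp only:)
  then show ?thesis
    using weil_height_character_l1norm[OF alg nz, of n] by (simp add: height_D_def l_def d_def distrib_left)
qed

text \<open>
  In polar coordinates the conjugate of the torus character is \<open>\<chi>\<^sup>n(\<alpha>) / \<bar>\<chi>\<^sup>n(\<alpha>)\<bar>\<close>, so the sum over the
  orbit is a multiple of the angular sum over the conjugates of \<open>\<chi>\<^sup>n(\<xi>)\<close>.
\<close>

lemma orbit_char_average:
  assumes n: "n \<noteq> 0"
  shows "cmod (\<Sum>\<alpha>\<in>galois_orbit \<xi>. cnj (torus_char n (fst (polar_coords \<alpha>)))) \<le>
    real (card (galois_orbit \<xi>)) * sqrt (24 * (real (l1norm n) * height_D \<xi>))"
proof -
  define X where "X = (character n :: complex ^ 'n \<Rightarrow> complex)"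
  define D where "D = alg_degree (X \<xi>)"
  note char = character_algebraic[OF alg nz] character_galois_act[OF alg nz]
  have "cnj (torus_char n (fst (polar_coords \<alpha>))) = X \<alpha> / of_real (cmod (X \<alpha>))" if \<alpha>: "\<alpha> \<in> galois_orbit \<xi>" for \<alpha>
  proof -
    have "cnj (torus_char n (fst (polar_coords \<alpha>))) = cis (\<Sum>j\<in>UNIV. real_of_int (n $ j) * Arg (\<alpha> $ j))"
    proof -
      have "- (- 2 * pi * (\<Sum>j\<in>UNIV. real_of_int (n $ j) * (Arg (\<alpha> $ j) / (2 * pi)))) =
          (\<Sum>j\<in>UNIV. real_of_int (n $ j) * Arg (\<alpha> $ j))"
        by (simp add: sum_distrib_left sum_negf)
      then show ?thesis by (simp only: torus_char_def polar_coords_def cis_cnj fst_conv vec_lambda_beta)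
    qed
    also have "\<dots> = (\<Prod>j\<in>UNIV. sgn (\<alpha> $ j) powi (n $ j))"
      using orbit_nonzero[OF alg nz \<alpha>] by (simp add: cis_sum cis_Arg cis_power_int[symmetric])
    also have "\<dots> = X \<alpha> / of_real (cmod (X \<alpha>))"
      by (simp add: X_def character_def sgn_eq power_int_divide_distrib prod_dividef prod_norm[symmetric]
          norm_power_int of_real_prod)
    finally show ?thesis .
  qed
  then have "(\<Sum>\<alpha>\<in>galois_orbit \<xi>. cnj (torus_char n (fst (polar_coords \<alpha>)))) =
      (\<Sum>\<alpha>\<in>galois_orbit \<xi>. X \<alpha> / of_real (cmod (X \<alpha>)))" by (intro sum.cong) auto
  also have "\<dots> = of_nat (fibre_card \<xi> X) * (\<Sum>z\<in>conjugates (X \<xi>). z / of_real (cmod z))"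
    unfolding X_def by (rule sum_orbit[where X = "character n", OF alg char])
  finally have "cmod (\<Sum>\<alpha>\<in>galois_orbit \<xi>. cnj (torus_char n (fst (polar_coords \<alpha>)))) =
      real (fibre_card \<xi> X) * cmod (\<Sum>z\<in>conjugates (X \<xi>). z / of_real (cmod z))"
    by (simp add: norm_mult)
  also have "\<dots> \<le> real (fibre_card \<xi> X) * (real D * sqrt (24 * (weil_height (X \<xi>) + ln (2 * real D) / (3 * real D))))"
    unfolding D_def X_def by (intro mult_left_mono angular_sum_bound character_xi) auto
  also have "\<dots> = real (card (galois_orbit \<xi>)) * sqrt (24 * (weil_height (X \<xi>) + ln (2 * real D) / (3 * real D)))"
    using fibre_card(1)[where X = "character n", OF alg char] by (simp add: D_def X_def)
  also have "\<dots> \<le> real (card (galois_orbit \<xi>)) * sqrt (24 * (real (l1norm n) * height_D \<xi>))"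
    using character_height_D[OF n] by (intro mult_left_mono real_sqrt_le_mono) (auto simp: D_def X_def)
  finally show ?thesis .
qed

lemma orbit_radial_average:
  "(\<Sum>\<alpha>\<in>galois_orbit \<xi>. cmod (cis (2 * pi * (t \<bullet> snd (polar_coords \<alpha>))) - 1)) \<le>
     real (card (galois_orbit \<xi>)) * (4 * pi * infnorm t * height \<xi>)"
proof -
  have "cmod (cis (2 * pi * (t \<bullet> snd (polar_coords \<alpha>))) - 1) \<le> 2 * pi * infnorm t * (\<Sum>j\<in>UNIV. \<bar>ln (cmod (\<alpha> $ j))\<bar>)" for \<alpha> :: "complex ^ 'n"
  proof -
    have "\<bar>t \<bullet> snd (polar_coords \<alpha>)\<bar> \<le> (\<Sum>j\<in>UNIV. \<bar>t $ j * ln (cmod (\<alpha> $ j))\<bar>)"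
      unfolding inner_vec_def polar_coords_def by (simp add: sum_abs)
    also have "\<dots> \<le> (\<Sum>j\<in>UNIV. infnorm t * \<bar>ln (cmod (\<alpha> $ j))\<bar>)"
      unfolding abs_mult by (intro sum_mono mult_right_mono component_le_infnorm_cart) auto
    finally have "\<bar>t \<bullet> snd (polar_coords \<alpha>)\<bar> \<le> infnorm t * (\<Sum>j\<in>UNIV. \<bar>ln (cmod (\<alpha> $ j))\<bar>)"
      by (simp only: sum_distrib_left)
    then have "2 * pi * \<bar>t \<bullet> snd (polar_coords \<alpha>)\<bar> \<le> 2 * pi * (infnorm t * (\<Sum>j\<in>UNIV. \<bar>ln (cmod (\<alpha> $ j))\<bar>))"
      by (rule mult_left_mono) simp
    moreover have "cmod (cis (2 * pi * (t \<bullet> snd (polar_coords \<alpha>))) - 1) \<le> 2 * pi * \<bar>t \<bullet> snd (polar_coords \<alpha>)\<bar>"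
      using cmod_cis_minus_1[of "2 * pi * (t \<bullet> snd (polar_coords \<alpha>))"] by (simp add: abs_mult)
    ultimately show ?thesis by (simp only: mult.assoc)
  qed
  then have "(\<Sum>\<alpha>\<in>galois_orbit \<xi>. cmod (cis (2 * pi * (t \<bullet> snd (polar_coords \<alpha>))) - 1)) \<le>
      (\<Sum>\<alpha>\<in>galois_orbit \<xi>. 2 * pi * infnorm t * (\<Sum>j\<in>UNIV. \<bar>ln (cmod (\<alpha> $ j))\<bar>))"
    by (intro sum_mono)
  also have "\<dots> = 2 * pi * infnorm t * (\<Sum>j\<in>UNIV. \<Sum>\<alpha>\<in>galois_orbit \<xi>. \<bar>ln (cmod (\<alpha> $ j))\<bar>)"
    by (subst sum.swap) (simp add: sum_distrib_left)
  also have "\<dots> \<le> 2 * pi * infnorm t * (\<Sum>j\<in>UNIV. 2 * real (card (galois_orbit \<xi>)) * weil_height (\<xi> $ j))"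
    by (intro mult_left_mono sum_mono orbit_abs_ln_le alg nz) (auto simp: infnorm_pos_le)
  also have "\<dots> = real (card (galois_orbit \<xi>)) * (4 * pi * infnorm t * height \<xi>)"
    by (simp add: height_def sum_distrib_left mult_ac)
  finally show ?thesis .
qed

end

lemma nn_integral_freq:
  fixes g :: "(int ^ 'n) \<times> (real ^ 'n) \<Rightarrow> ennreal"
  assumes "g \<in> borel_measurable freq_measure"
  shows "(\<integral>\<^sup>+y. g y \<partial>freq_measure) = (\<integral>\<^sup>+n. (\<integral>\<^sup>+t. g (n, t) \<partial>lborel) \<partial>count_space UNIV)"
  using sigma_finite_measure.nn_integral_fst[OF sigma_finite_lborel assms[unfolded freq_measure_def]]
  by (simp add: freq_measure_def)

context
  fixes F :: "(real ^ 'n) \<times> (real ^ 'n) \<Rightarrow> complex"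
  assumes F: "F \<in> test_functions"
begin

lemma integral_freq:
  assumes A: "\<And>n. cmod (A n) \<le> 1"
  shows "integrable (count_space UNIV) (\<lambda>n. A n * (LINT t|lborel. fourier F (n, t)))"
    and "(LINT y|freq_measure. fourier F y * A (fst y)) = (LINT n|count_space UNIV. A n * (LINT t|lborel. fourier F (n, t)))"
proof -
  interpret pair_sigma_finite "count_space (UNIV :: (int ^ 'n) set)" "lborel :: (real ^ 'n) measure"
    by (intro pair_sigma_finite.intro sigma_finite_count sigma_finite_lborel)
  have int: "integrable freq_measure (\<lambda>y. fourier F y * A (fst y))"
  proof (rule Bochner_Integration.integrable_bound[OF fourier_inversion(1)[OF F]])
    have "(\<lambda>y. A (fst y)) \<in> borel_measurable freq_measure"
      unfolding freq_measure_def by (rule measurable_compose[OF measurable_fst]) simp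
    then show "(\<lambda>y. fourier F y * A (fst y)) \<in> borel_measurable freq_measure"
      by (intro borel_measurable_times borel_measurable_integrable[OF fourier_inversion(1)[OF F]])
    show "AE y in freq_measure. norm (fourier F y * A (fst y)) \<le> norm (fourier F y)"
      using A by (intro AE_I2) (simp add: norm_mult mult_left_le)
  qed
  then have int': "integrable (count_space UNIV \<Otimes>\<^sub>M lborel) (\<lambda>y. fourier F y * A (fst y))"
    by (simp add: freq_measure_def)
  show "integrable (count_space UNIV) (\<lambda>n. A n * (LINT t|lborel. fourier F (n, t)))"
    and "(LINT y|freq_measure. fourier F y * A (fst y)) = (LINT n|count_space UNIV. A n * (LINT t|lborel. fourier F (n, t)))"
    using integrable_fst'[OF int'] integral_fst'[OF int'] by (simp_all add: freq_measure_def mult.commute)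
qed

lemma F_at_0: "F (\<theta>, 0) = (LINT y|freq_measure. fourier F y * cnj (torus_char (fst y) \<theta>))"
  using fourier_inversion(2)[OF F, of "(\<theta>, 0)"] by (simp add: inverse_fourier_def fourier_kernel_def)

text \<open>
  Restricting \<open>F\<close> to the polycircle integrates the radial frequencies out of its transform.
\<close>

lemma fourier_zero_eq: "fourier_zero F n = (LINT t|lborel. fourier F (n, t))"
proof -
  let ?N = "freq_measure :: ((int ^ 'n) \<times> (real ^ 'n)) measure"
  define K where "K = (\<lambda>(\<theta> :: real ^ 'n) (y :: (int ^ 'n) \<times> (real ^ 'n)). cnj (torus_char (fst y) \<theta>))"
  have meas: "(\<lambda>(\<theta>, y). K \<theta> y) \<in> borel_measurable (torus_measure \<Otimes>\<^sub>M ?N)"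
  proof -
    have \<theta>: "fst \<in> borel_measurable (torus_measure \<Otimes>\<^sub>M ?N)"
      by (rule measurable_compose[OF measurable_fst torus_borel])
    have n: "(\<lambda>z. fst (snd z)) \<in> measurable (torus_measure \<Otimes>\<^sub>M ?N) (count_space UNIV)"
      unfolding freq_measure_def by measurable
    have "(\<lambda>\<theta>. cnj (torus_char n \<theta>)) \<in> borel_measurable borel" for n :: "int ^ 'n"
      by (intro borel_measurable_continuous_onI continuous_intros)
    from measurable_compose_countable[OF measurable_compose[OF \<theta> this] n]
    show ?thesis by (simp add: K_def case_prod_beta')
  qed
  have tc: "integrable torus_measure (torus_char n)"
    by (rule torus_bounded_integrable[where C = 1]) auto
  have "fourier_zero F n = (LINT \<theta>|torus_measure. torus_char n \<theta> * (LINT y|?N. K \<theta> y * fourier F y))"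
    by (simp add: fourier_zero_def F_at_0 K_def mult.commute)
  also have "\<dots> = (LINT y|?N. (LINT \<theta>|torus_measure. torus_char n \<theta> * K \<theta> y) * fourier F y)"
    by (rule kernel_Fubini(3)[OF sigma_finite_torus sigma_finite_freq meas _ tc fourier_inversion(1)[OF F], symmetric])
      (simp add: K_def)
  also have "\<dots> = (LINT y|?N. fourier F y * (if fst y = n then 1 else 0))"
    by (simp add: K_def cnj_torus_char integral_torus_char mult.commute flip: torus_char_add)
      (simp add: add_eq_0_iff eq_commute[of n] cong: if_cong)
  also have "\<dots> = (LINT m|count_space UNIV. (if m = n then 1 else 0) * (LINT t|lborel. fourier F (m, t)))"
    using integral_freq[of "\<lambda>m. if m = n then 1 else 0"] by simp
  also have "\<dots> = (LINT m|count_space UNIV. (if m = n then (LINT t|lborel. fourier F (m, t)) else 0))"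
    by (intro Bochner_Integration.integral_cong) auto
  also have "\<dots> = (LINT t|lborel. fourier F (n, t))" by (rule count_space_point_integrable(2))
  finally show ?thesis .
qed

end

lemma nn_integral_bound_divide:
  assumes "ennreal (c * e) \<le> A" "c > 0" "e \<ge> 0" "k \<ge> 0"
  shows "ennreal (k * e) \<le> ennreal k * A / ennreal c"
proof (cases A)
  case (real a)
  then have "c * e \<le> a" using assms by (simp add: ennreal_le_iff)
  then have "k * (c * e) \<le> k * a" using assms(4) by (rule mult_left_mono)
  then have "k * e \<le> k * a / c" using assms(2) by (simp add: field_simps)
  then show ?thesis using real assms by (simp add: ennreal_mult[symmetric] divide_ennreal ennreal_leI)
next
  case top
  then show ?thesis
    using assms by (cases "k = 0") (auto simp: ennreal_mult_top ennreal_top_divide)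
qed

context
  fixes \<xi> :: "complex ^ 'n" and F :: "(real ^ 'n) \<times> (real ^ 'n) \<Rightarrow> complex"
  assumes alg: "\<And>j. algebraic (\<xi> $ j)" and nz: "\<And>j. \<xi> $ j \<noteq> 0" and F: "F \<in> test_functions"
begin

definition radial_error :: complex where
  "radial_error = (\<Sum>\<alpha>\<in>galois_orbit \<xi>. F (polar_coords \<alpha>) - F (fst (polar_coords \<alpha>), 0)) / of_nat (card (galois_orbit \<xi>))"

definition angular_error :: complex where
  "angular_error = (\<Sum>\<alpha>\<in>galois_orbit \<xi>. F (fst (polar_coords \<alpha>), 0)) / of_nat (card (galois_orbit \<xi>)) -
     (LINT \<theta>|torus_measure. F (\<theta>, 0))"

lemma card_orbit_pos: "card (galois_orbit \<xi>) > 0"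
  using finite_orbit[OF alg] orbit_refl[OF alg] card_gt_0_iff by blast

lemma equi_error_le: "equi_error F \<xi> \<le> cmod radial_error + cmod angular_error"
proof -
  have "equi_error F \<xi> = cmod (radial_error + angular_error)"
    by (simp add: equi_error_def radial_error_def angular_error_def sum_subtractf diff_divide_distrib)
  then show ?thesis using norm_triangle_ineq by simp
qed

definition radial_weight :: "real ^ 'n \<Rightarrow> real" where
  "radial_weight t = (\<Sum>\<alpha>\<in>galois_orbit \<xi>. cmod (cis (2 * pi * (t \<bullet> snd (polar_coords \<alpha>))) - 1)) / real (card (galois_orbit \<xi>))"

lemma radial_weight_le_2: "radial_weight t \<le> 2"
proof -
  have "cmod (cis x - 1) \<le> 2" for x using norm_triangle_ineq4[of "cis x" 1] by simp
  then have "(\<Sum>\<alpha>\<in>galois_orbit \<xi>. cmod (cis (2 * pi * (t \<bullet> snd (polar_coords \<alpha>))) - 1)) \<le> (\<Sum>\<alpha>\<in>galois_orbit \<xi>. 2)"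
    by (intro sum_mono)
  then show ?thesis using card_orbit_pos by (simp add: radial_weight_def pos_divide_le_eq mult.commute)
qed

lemma radial_weight_le_height: "radial_weight t \<le> 4 * pi * infnorm t * height \<xi>"
  using orbit_radial_average[OF alg nz, of t] card_orbit_pos
  by (simp add: radial_weight_def pos_divide_le_eq mult.commute)

text \<open>
  By inversion the radial error is the integral of the transform against the orbit average of the
  differences of two kernels, whose modulus is at most \<open>radial_weight\<close>.
\<close>

lemma radial_error_bound:
  assumes c: "c \<ge> 0" and w: "\<And>t. t \<noteq> 0 \<Longrightarrow> c * radial_weight t \<le> G (infnorm t)"
  shows "ennreal (c * cmod radial_error) \<le> C1 F G"
proof -
  define S where "S = galois_orbit \<xi>"
  define M where "M = complex_of_nat (card S)"
  define k where "k = (\<lambda>y. (\<Sum>\<alpha>\<in>S. cnj (fourier_kernel (polar_coords \<alpha>) y) - cnj (fourier_kernel (fst (polar_coords \<alpha>), 0) y)) / M)"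
  note int = integrable_inverse_fourier[OF fourier_inversion(1)[OF F]]
  have k_eq: "fourier F y * k y = (\<Sum>\<alpha>\<in>S. fourier F y * cnj (fourier_kernel (polar_coords \<alpha>) y) -
      fourier F y * cnj (fourier_kernel (fst (polar_coords \<alpha>), 0) y)) / M" for y
    by (simp add: k_def sum_distrib_left right_diff_distrib)
  have k_int: "integrable freq_measure (\<lambda>y. fourier F y * k y)"
    unfolding k_eq by (intro integrable_divide Bochner_Integration.integrable_sum Bochner_Integration.integrable_diff int)
  have "radial_error = (\<Sum>\<alpha>\<in>S. (LINT y|freq_measure. fourier F y * cnj (fourier_kernel (polar_coords \<alpha>) y)) -
      (LINT y|freq_measure. fourier F y * cnj (fourier_kernel (fst (polar_coords \<alpha>), 0) y))) / M"
    using fourier_inversion(2)[OF F] by (simp add: radial_error_def S_def M_def inverse_fourier_def)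
  also have "\<dots> = (LINT y|freq_measure. fourier F y * k y)"
    unfolding k_eq using int
    by (simp add: Bochner_Integration.integral_sum Bochner_Integration.integral_diff)
  finally have err: "radial_error = (LINT y|freq_measure. fourier F y * k y)" .
  have k_le: "cmod (k (n, t)) \<le> radial_weight t" for n t
  proof -
    have "cmod (cnj (fourier_kernel (polar_coords \<alpha>) (n, t)) - cnj (fourier_kernel (fst (polar_coords \<alpha>), 0) (n, t))) =
        cmod (cis (2 * pi * (t \<bullet> snd (polar_coords \<alpha>))) - 1)" for \<alpha> :: "complex ^ 'n"
    proof -
      have "cnj (fourier_kernel (polar_coords \<alpha>) (n, t)) - cnj (fourier_kernel (fst (polar_coords \<alpha>), 0) (n, t)) =
          cnj (torus_char n (fst (polar_coords \<alpha>))) * (cis (2 * pi * (t \<bullet> snd (polar_coords \<alpha>))) - 1)"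
        by (simp add: fourier_kernel_def cis_cnj right_diff_distrib)
      then show ?thesis by (simp add: norm_mult)
    qed
    then have "cmod (\<Sum>\<alpha>\<in>S. cnj (fourier_kernel (polar_coords \<alpha>) (n, t)) - cnj (fourier_kernel (fst (polar_coords \<alpha>), 0) (n, t))) \<le>
        (\<Sum>\<alpha>\<in>S. cmod (cis (2 * pi * (t \<bullet> snd (polar_coords \<alpha>))) - 1))"
      by (intro sum_norm_le) simp
    then show ?thesis
      by (simp add: k_def radial_weight_def norm_divide M_def S_def divide_right_mono)
  qed
  have "ennreal (c * cmod radial_error) = ennreal (cmod (LINT y|freq_measure. of_real c * (fourier F y * k y)))"
    using c by (simp add: err norm_mult)
  also have "\<dots> \<le> (\<integral>\<^sup>+y. ennreal (cmod (of_real c * (fourier F y * k y))) \<partial>freq_measure)"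
    using k_int by (intro integral_norm_bound_ennreal) auto
  also have "\<dots> = (\<integral>\<^sup>+n. (\<integral>\<^sup>+t. ennreal (cmod (of_real c * (fourier F (n, t) * k (n, t)))) \<partial>lborel) \<partial>count_space UNIV)"
    using k_int by (intro nn_integral_freq) auto
  also have "\<dots> \<le> C1 F G"
    unfolding C1_def
  proof (rule nn_integral_mono, rule nn_integral_mono_AE)
    fix n :: "int ^ 'n"
    have "AE t in lborel. t \<noteq> (0 :: real ^ 'n)" by (rule AE_lborel_singleton)
    then show "AE t in lborel. ennreal (cmod (of_real c * (fourier F (n, t) * k (n, t)))) \<le>
        ennreal (cmod (fourier F (n, t)) * G (infnorm t))"
    proof eventually_elim
      case (elim t)
      have "c * cmod (k (n, t)) \<le> c * radial_weight t" using k_le c by (rule mult_left_mono)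
      also have "\<dots> \<le> G (infnorm t)" by (rule w[OF elim])
      finally have "cmod (fourier F (n, t)) * (c * cmod (k (n, t))) \<le> cmod (fourier F (n, t)) * G (infnorm t)"
        by (rule mult_left_mono) simp
      then show ?case using c by (intro ennreal_leI) (simp add: norm_mult mult_ac)
    qed
  qed
  finally show ?thesis .
qed

definition angular_weight :: "int ^ 'n \<Rightarrow> complex" where
  "angular_weight n = (\<Sum>\<alpha>\<in>galois_orbit \<xi>. cnj (torus_char n (fst (polar_coords \<alpha>)))) / of_nat (card (galois_orbit \<xi>))"

lemma angular_weight_le_1: "cmod (angular_weight n) \<le> 1"
proof -
  have "cmod (\<Sum>\<alpha>\<in>galois_orbit \<xi>. cnj (torus_char n (fst (polar_coords \<alpha>)))) \<le> (\<Sum>\<alpha>\<in>galois_orbit \<xi>. 1)"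
    by (intro sum_norm_le) simp
  then show ?thesis using card_orbit_pos by (simp add: angular_weight_def norm_divide)
qed

lemma angular_weight_0: "angular_weight 0 = 1"
  using card_orbit_pos by (simp add: angular_weight_def)

lemma angular_weight_le:
  assumes "n \<noteq> 0"
  shows "cmod (angular_weight n) \<le> sqrt (24 * (real (l1norm n) * height_D \<xi>))"
  using orbit_char_average[OF alg nz assms] card_orbit_pos
  by (simp add: angular_weight_def norm_divide pos_divide_le_eq mult.commute)

text \<open>
  By inversion on the polycircle the angular error is the sum of the Fourier coefficients against the
  orbit averages; the coefficient at \<open>n = 0\<close> is the integral that is subtracted.
\<close>

lemma angular_error_bound:
  assumes c: "c \<ge> 0" and w: "\<And>n. n \<noteq> 0 \<Longrightarrow> c * cmod (angular_weight n) \<le> H (real (l1norm n))"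
  shows "ennreal (c * cmod angular_error) \<le> C2 F H"
proof -
  define S where "S = galois_orbit \<xi>"
  define M where "M = complex_of_nat (card S)"
  have int: "integrable freq_measure (\<lambda>y. fourier F y * cnj (torus_char (fst y) \<theta>))" for \<theta>
    using integrable_inverse_fourier[OF fourier_inversion(1)[OF F], of "(\<theta>, 0)"] by (simp add: fourier_kernel_def)
  have A: "fourier F y * angular_weight (fst y) = (\<Sum>\<alpha>\<in>S. fourier F y * cnj (torus_char (fst y) (fst (polar_coords \<alpha>)))) / M" for y
    by (simp add: angular_weight_def S_def M_def sum_distrib_left)
  have "(\<Sum>\<alpha>\<in>S. F (fst (polar_coords \<alpha>), 0)) / M = (LINT y|freq_measure. fourier F y * angular_weight (fst y))"
    unfolding A F_at_0[OF F] using int by (simp add: Bochner_Integration.integral_sum)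
  also have "\<dots> = (LINT n|count_space UNIV. angular_weight n * fourier_zero F n)"
    using integral_freq[OF F, of angular_weight] angular_weight_le_1 by (simp add: fourier_zero_eq[OF F])
  finally have 1: "(\<Sum>\<alpha>\<in>S. F (fst (polar_coords \<alpha>), 0)) / M = (LINT n|count_space UNIV. angular_weight n * fourier_zero F n)" .
  have int1: "integrable (count_space UNIV) (\<lambda>n. angular_weight n * fourier_zero F n)"
    using integral_freq[OF F, of angular_weight] angular_weight_le_1 by (simp add: fourier_zero_eq[OF F])
  define g where "g = (\<lambda>n. angular_weight n * fourier_zero F n - (if n = 0 then fourier_zero F n else 0))"
  have int_g: "integrable (count_space UNIV) g"
    unfolding g_def by (intro Bochner_Integration.integrable_diff int1 count_space_point_integrable)
  have "(LINT \<theta>|torus_measure. F (\<theta>, 0)) = fourier_zero F 0" by (simp add: fourier_zero_def)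
  then have err: "angular_error = (LINT n|count_space UNIV. g n)"
    unfolding g_def using int1 count_space_point_integrable[of 0 "fourier_zero F"]
    by (simp add: angular_error_def 1[unfolded S_def M_def] Bochner_Integration.integral_diff)
  have "ennreal (c * cmod angular_error) = ennreal (cmod (LINT n|count_space UNIV. of_real c * g n))"
    using c by (simp add: err norm_mult)
  also have "\<dots> \<le> (\<integral>\<^sup>+n. ennreal (cmod (of_real c * g n)) \<partial>count_space UNIV)"
    using int_g by (intro integral_norm_bound_ennreal) auto
  also have "\<dots> \<le> (\<integral>\<^sup>+n. ennreal (cmod (fourier_zero F n) * H (real (l1norm n))) * indicator (UNIV - {0}) n \<partial>count_space UNIV)"
  proof (rule nn_integral_mono)
    fix n :: "int ^ 'n"
    show "ennreal (cmod (of_real c * g n)) \<le> ennreal (cmod (fourier_zero F n) * H (real (l1norm n))) * indicator (UNIV - {0}) n"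
    proof (cases "n = 0")
      case True
      then show ?thesis by (simp add: g_def angular_weight_0)
    next
      case False
      have "cmod (fourier_zero F n) * (c * cmod (angular_weight n)) \<le> cmod (fourier_zero F n) * H (real (l1norm n))"
        by (rule mult_left_mono[OF w[OF False]]) simp
      then show ?thesis using False c by (simp add: g_def norm_mult mult_ac ennreal_leI)
    qed
  qed
  also have "\<dots> = C2 F H"
    unfolding C2_def by (rule nn_integral_count_space_indicator[symmetric]) simp
  finally show ?thesis .
qed

end

theorem theorem2:
  fixes G H :: "real \<Rightarrow> real"
    and \<xi> :: "complex ^ 'n"
    and F :: "(real ^ 'n) \<times> (real ^ 'n) \<Rightarrow> complex"
  assumes G_pos: "\<And>x. x > 0 \<Longrightarrow> G x > 0"
    and H_pos: "\<And>x. x > 0 \<Longrightarrow> H x > 0"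
    and G_mono: "mono_on {0<..} G"
    and H_mono: "mono_on {0<..} H"
    and G_lim: "filterlim G at_top at_top"
    and H_lim: "filterlim H at_top at_top"
    and G_sqrt: "antimono_on {0<..} (\<lambda>x. G x / sqrt x)"
    and H_sqrt: "antimono_on {0<..} (\<lambda>x. H x / sqrt x)"
    and \<xi>_alg: "\<And>j. algebraic (\<xi> $ j)"
    and \<xi>_nz: "\<And>j. \<xi> $ j \<noteq> 0"
    and F: "F \<in> test_functions"
  shows "ennreal (equi_error F \<xi>) \<le>
    (if C1 F G = \<infinity> \<or> C2 F H = \<infinity> then \<infinity>
     else (if height \<xi> = 0 then 0
           else 2 * C1 F G / ennreal (G (1 / (8 * pi * height \<xi>))))
          + C2 F H / ennreal (H (1 / (24 * height_D \<xi>))))"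
proof -
  define h where "h = height \<xi>"
  define E1 where "E1 = radial_error \<xi> F"
  define E2 where "E2 = angular_error \<xi> F"
  note ctx = \<xi>_alg \<xi>_nz F
  have h0: "h \<ge> 0" using height_nonneg[OF \<xi>_alg \<xi>_nz] by (simp add: h_def)
  have hD: "height_D \<xi> > 0" by (rule height_D_pos[OF \<xi>_alg \<xi>_nz])
  have E1: "ennreal (cmod E1) \<le> (if h = 0 then 0 else 2 * C1 F G / ennreal (G (1 / (8 * pi * h))))"
  proof (cases "h = 0")
    case True
    have "ennreal (1 * cmod E1) \<le> C1 F (\<lambda>_. 0)"
      unfolding E1_def
      by (rule radial_error_bound[OF ctx]) (use radial_weight_le_height[OF ctx] True in \<open>auto simp: h_def\<close>)
    then show ?thesis using True by (simp add: C1_def)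
  next
    case False
    define X where "X = 1 / (8 * pi * h)"
    have X: "X > 0" using False h0 by (simp add: X_def)
    have "G X / 2 * radial_weight \<xi> t \<le> G (infnorm t)" if "t \<noteq> 0" for t :: "real ^ 'n"
    proof -
      define \<tau> where "\<tau> = infnorm t"
      have \<tau>: "\<tau> > 0" using that by (simp add: \<tau>_def infnorm_pos_lt)
      \<comment> \<open>With \<open>u = 8 pi h \<tau>\<close> the weight is at most \<open>min 2 (u / 2)\<close>, so half of it is at most
         \<open>min 1 (sqrt u)\<close>.\<close>
      define u where "u = \<tau> / X"
      have u: "u > 0" using \<tau> X by (simp add: u_def)
      have "4 * pi * \<tau> * h = u / 2" using False by (simp add: u_def X_def)
      then have b: "radial_weight \<xi> t \<le> u / 2" "radial_weight \<xi> t \<le> 2"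
        using radial_weight_le_height[OF ctx, of t] radial_weight_le_2[OF ctx] by (auto simp: \<tau>_def h_def)
      have "radial_weight \<xi> t / 2 \<le> min 1 (sqrt u)"
      proof (cases "u \<le> 1")
        case True
        then have "u \<le> sqrt u" using u by (intro real_le_rsqrt) (simp add: power2_eq_square mult_left_le)
        then show ?thesis using b u by linarith
      next
        case False
        then have "1 \<le> sqrt u" by simp
        then show ?thesis using b by linarith
      qed
      then have "G X * (radial_weight \<xi> t / 2) \<le> G X * min 1 (sqrt u)"
        using G_pos[OF X] by (intro mult_left_mono) auto
      also have "\<dots> \<le> G \<tau>" unfolding u_def by (rule growth_comparison[OF G_pos G_mono G_sqrt \<tau> X])
      finally show ?thesis by (simp add: \<tau>_def)
    qed
    then have "ennreal (G X / 2 * cmod E1) \<le> C1 F G"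
      unfolding E1_def using G_pos[OF X] by (intro radial_error_bound[OF ctx]) auto
    then have "ennreal (G X * (cmod E1 / 2)) \<le> C1 F G" by simp
    from nn_integral_bound_divide[OF this G_pos[OF X], of 2]
    show ?thesis using False by (simp add: X_def)
  qed
  have E2: "ennreal (cmod E2) \<le> C2 F H / ennreal (H (1 / (24 * height_D \<xi>)))"
  proof -
    define Y where "Y = 1 / (24 * height_D \<xi>)"
    have Y: "Y > 0" using hD by (simp add: Y_def)
    have "H Y * cmod (angular_weight \<xi> n) \<le> H (real (l1norm n))" if n: "n \<noteq> 0" for n :: "int ^ 'n"
    proof -
      have l: "real (l1norm n) > 0" using l1norm_pos[OF n] by simp
      have "real (l1norm n) / Y = 24 * (real (l1norm n) * height_D \<xi>)" by (simp add: Y_def)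
      then have "cmod (angular_weight \<xi> n) \<le> min 1 (sqrt (real (l1norm n) / Y))"
        using angular_weight_le[OF ctx n] angular_weight_le_1[OF ctx, of n] by simp
      then have "H Y * cmod (angular_weight \<xi> n) \<le> H Y * min 1 (sqrt (real (l1norm n) / Y))"
        using H_pos[OF Y] by (intro mult_left_mono) auto
      also have "\<dots> \<le> H (real (l1norm n))" by (rule growth_comparison[OF H_pos H_mono H_sqrt l Y])
      finally show ?thesis .
    qed
    then have "ennreal (H Y * cmod E2) \<le> C2 F H"
      unfolding E2_def using H_pos[OF Y] by (intro angular_error_bound[OF ctx]) auto
    from nn_integral_bound_divide[OF this H_pos[OF Y], of 1]
    show ?thesis by (simp add: Y_def)
  qed
  have "ennreal (equi_error F \<xi>) \<le> ennreal (cmod E1) + ennreal (cmod E2)"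
    using equi_error_le[OF ctx] by (simp add: E1_def E2_def ennreal_leI flip: ennreal_plus)
  also have "\<dots> \<le> (if h = 0 then 0 else 2 * C1 F G / ennreal (G (1 / (8 * pi * h)))) +
      C2 F H / ennreal (H (1 / (24 * height_D \<xi>)))"
    using E1 E2 by (rule add_mono)
  finally show ?thesis unfolding h_def by simp
qed

end
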